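(* Let $n\ge 2$ and $k\ge 1$, let $W\subseteq [n]$, let $W=W_1\sqcup\cdots\sqcup W_k$ be a partition of $W$, and let $G=F_k^W(K_n)$ be a $k$-fan graph of the complete graph $K_n$ on the set $W$ (with respect to this partition). Let $S=\mathbb{K}[x_u : u\in V(G)]$ and let $I_G\subset S$ be the edge ideal of $G$. Then $$\operatorname{depth}(S/I_G)=1+|W|-\max\{|W_1|,|W_2|,\ldots,|W_k|\}.$$
   Context: $\mathbb{K}$ is a field; $[n]=\{1,\dots,n\}$. For a finite simple graph $G$ the edge ideal is $I_G=(x_ux_v : \{u,v\}\in E(G))\subset S=\mathbb{K}[x_u:u\in V(G)]$. For a finitely generated graded $S$-module $M$, $\operatorname{depth}(M)=\min\{i : \operatorname{Ext}^i_S(\mathbb{K},M)\ne 0\}$. Fan graphs: let $K_n$ be the complete graph on $[n]$. Given $U=\{u_1,\dots,u_r\}\subseteq[n]$ (with a chosen ordering), suppose that for each $i\in[r]$ a new complete graph $K_{a_i}$ on $a_i>i$ vertices is attached to $K_n$ in such a way that $V(K_n)\cap V(K_{a_i})=\{u_1,\dots,u_i\}$ (the new vertices of different attached cliques are pairwise distinct). The resulting graph is said to be obtained by adding a fan to $K_n$ on $U$, and $\{K_{a_1},\dots,K_{a_r}\}$ is the branch of that fan on $U$. If $W\subseteq[n]$ and $W=W_1\sqcup\cdots\sqcup W_k$ is a partition into nonempty subsets, a $k$-fan graph $F_k^W(K_n)$ of $K_n$ on $W$ is a graph obtained from $K_n$ by adding a fan on each $W_i$. *)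

theory Defs
  imports
    "HOL-Algebra.Algebra"
    "HOL-Library.Poly_Mapping"
    "HOL-Library.Disjoint_Sets"
    "HOL-Library.Extended_Nat"
begin

section \<open>Graphs\<close>

record 'v ugraph =
  verts :: "'v set"
  edges :: "'v set set"

definition complete_graph :: "'v set \<Rightarrow> 'v ugraph" where
  "complete_graph A = \<lparr>verts = A, edges = {{u, v} |u v. u \<in> A \<and> v \<in> A \<and> u \<noteq> v}\<rparr>"

definition graph_Union :: "'v ugraph set \<Rightarrow> 'v ugraph" where
  "graph_Union \<G> = \<lparr>verts = \<Union>(verts ` \<G>), edges = \<Union>(edges ` \<G>)\<rparr>"

text \<open>
  \<open>C\<close> is the vertex set of the complete graph to which a fan is added, the list
  \<open>us = [u\<^sub>1, \<dots>, u\<^sub>r]\<close> is the set \<open>U\<close> with its chosen ordering, and \<open>A j\<close>, for \<open>1 \<le> j \<le> r\<close>,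
  is the vertex set of the \<open>j\<close>-th attached complete graph, so that its size is \<open>a\<^sub>j = card (A j)\<close>
  and its new vertices are \<open>A j - C\<close>.
\<close>

definition fan_branch :: "'v set \<Rightarrow> 'v list \<Rightarrow> (nat \<Rightarrow> 'v set) \<Rightarrow> bool" where
  "fan_branch C us A \<longleftrightarrow>
     distinct us \<and> set us \<subseteq> C \<and>
     (\<forall>j\<in>{1..length us}. finite (A j) \<and> card (A j) > j \<and> C \<inter> A j = set (take j us)) \<and>
     disjoint_family_on (\<lambda>j. A j - C) {1..length us}"

text \<open>
  \<open>G\<close> is a \<open>k\<close>-fan graph of \<open>K\<^sub>n\<close> (on \<open>{1..n}\<close>) with respect to the family
  \<open>W 1, \<dots>, W k\<close>: one fan is added on each \<open>W i\<close>, and distinct fans have disjoint sets of new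
  vertices. The new vertices are arbitrary natural numbers outside \<open>{1..n}\<close>.
\<close>

definition k_fan_graph :: "nat \<Rightarrow> nat \<Rightarrow> (nat \<Rightarrow> nat set) \<Rightarrow> nat ugraph \<Rightarrow> bool" where
  "k_fan_graph n k W G \<longleftrightarrow>
     (\<exists>us A.
        (\<forall>i\<in>{1..k}. set (us i) = W i \<and> fan_branch {1..n} (us i) (A i)) \<and>
        disjoint_family_on (\<lambda>i. \<Union>j\<in>{1..length (us i)}. A i j - {1..n}) {1..k} \<and>
        G = graph_Union
              (insert (complete_graph {1..n})
                 {complete_graph (A i j) |i j. i \<in> {1..k} \<and> j \<in> {1..length (us i)}}))"


section \<open>Polynomial rings and edge ideals\<close>

type_synonym ('v, 'k) mpoly = "('v \<Rightarrow>\<^sub>0 nat) \<Rightarrow>\<^sub>0 'k"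

text \<open>The polynomial ring over \<open>'k\<close> in the variables indexed by \<open>V\<close>: a monomial is its exponent
  vector, and a polynomial is its finitely supported coefficient function.\<close>

definition mpoly_ring :: "'v set \<Rightarrow> ('v, 'k::field) mpoly ring" where
  "mpoly_ring V =
     \<lparr>carrier = {p. \<forall>m\<in>Poly_Mapping.keys p. Poly_Mapping.keys m \<subseteq> V},
      monoid.mult = (*), monoid.one = 1, ring.zero = 0, ring.add = (+)\<rparr>"

definition mpoly_var :: "'v \<Rightarrow> ('v, 'k::field) mpoly" where
  "mpoly_var u = Poly_Mapping.single (Poly_Mapping.single u 1) 1"

definition edge_ideal :: "'v ugraph \<Rightarrow> ('v, 'k::field) mpoly set" where
  "edge_ideal G =
     Idl\<^bsub>mpoly_ring (verts G)\<^esub> {mpoly_var u * mpoly_var v |u v. {u, v} \<in> edges G}"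

text \<open>The coefficient field as a module over the polynomial ring: every variable acts as zero.\<close>

definition coeff_field_module :: "(('v, 'k::field) mpoly, 'k) module" where
  "coeff_field_module =
     \<lparr>carrier = UNIV, monoid.mult = (*), monoid.one = 1, ring.zero = 0, ring.add = (+),
      module.smult = (\<lambda>p c. Poly_Mapping.lookup p 0 * c)\<rparr>"


section \<open>Ext and depth\<close>

text \<open>The ring \<open>R / I\<close> regarded as an \<open>R\<close>-module.\<close>

definition quot_module :: "('a, 'm) ring_scheme \<Rightarrow> 'a set \<Rightarrow> ('a, 'a set) module" where
  "quot_module R I =
     \<lparr>carrier = carrier (R Quot I), monoid.mult = monoid.mult (R Quot I), monoid.one = monoid.one (R Quot I),
      ring.zero = ring.zero (R Quot I), ring.add = ring.add (R Quot I),
      module.smult = (\<lambda>r C. (I +>\<^bsub>R\<^esub> r) \<otimes>\<^bsub>R Quot I\<^esub> C)\<rparr>"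

text \<open>Module homomorphisms are taken to be extensional outside the carrier, so that they can be
  compared as functions.\<close>

definition module_hom ::
  "('a, 'm) ring_scheme \<Rightarrow> ('a, 'b, 'n) module_scheme \<Rightarrow> ('a, 'c, 'o) module_scheme \<Rightarrow> ('b \<Rightarrow> 'c) set"
  where
  "module_hom R M N =
     {f \<in> carrier M \<rightarrow>\<^sub>E carrier N.
        (\<forall>x\<in>carrier M. \<forall>y\<in>carrier M. f (x \<oplus>\<^bsub>M\<^esub> y) = f x \<oplus>\<^bsub>N\<^esub> f y) \<and>
        (\<forall>r\<in>carrier R. \<forall>x\<in>carrier M. f (r \<odot>\<^bsub>M\<^esub> x) = r \<odot>\<^bsub>N\<^esub> f x)}"

text \<open>The fields \<open>mult\<close> and \<open>one\<close>, which every module record inherits from the ring record,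
  carry no meaning in the next two definitions.\<close>

definition Hom_module ::
  "('a, 'm) ring_scheme \<Rightarrow> ('a, 'b, 'n) module_scheme \<Rightarrow> ('a, 'c, 'o) module_scheme
     \<Rightarrow> ('a, 'b \<Rightarrow> 'c) module"
  where
  "Hom_module R M N =
     \<lparr>carrier = module_hom R M N, monoid.mult = undefined, monoid.one = undefined,
      ring.zero = (\<lambda>x\<in>carrier M. \<zero>\<^bsub>N\<^esub>),
      ring.add = (\<lambda>f g. \<lambda>x\<in>carrier M. f x \<oplus>\<^bsub>N\<^esub> g x),
      module.smult = (\<lambda>r f. \<lambda>x\<in>carrier M. r \<odot>\<^bsub>N\<^esub> f x)\<rparr>"

definition free_module :: "('a, 'm) ring_scheme \<Rightarrow> nat \<Rightarrow> ('a, nat \<Rightarrow> 'a) module" where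
  "free_module R b =
     \<lparr>carrier = {..<b} \<rightarrow>\<^sub>E carrier R, monoid.mult = undefined, monoid.one = undefined,
      ring.zero = (\<lambda>i\<in>{..<b}. \<zero>\<^bsub>R\<^esub>),
      ring.add = (\<lambda>x y. \<lambda>i\<in>{..<b}. x i \<oplus>\<^bsub>R\<^esub> y i),
      module.smult = (\<lambda>r x. \<lambda>i\<in>{..<b}. r \<otimes>\<^bsub>R\<^esub> x i)\<rparr>"

text \<open>
  \<open>(b, d, \<epsilon>)\<close> is a resolution of \<open>N\<close> by free modules of finite rank:
  \<open>\<dots> \<rightarrow> R^(b 2) \<rightarrow> R^(b 1) \<rightarrow> R^(b 0) \<rightarrow> N \<rightarrow> 0\<close> is exact, with maps
  \<open>d i : R^(b (i + 1)) \<rightarrow> R^(b i)\<close> and \<open>\<epsilon> : R^(b 0) \<rightarrow> N\<close>.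
\<close>

definition free_resolution ::
  "('a, 'm) ring_scheme \<Rightarrow> ('a, 'c, 'n) module_scheme
     \<Rightarrow> (nat \<Rightarrow> nat) \<times> (nat \<Rightarrow> (nat \<Rightarrow> 'a) \<Rightarrow> (nat \<Rightarrow> 'a)) \<times> ((nat \<Rightarrow> 'a) \<Rightarrow> 'c) \<Rightarrow> bool"
  where
  "free_resolution R N = (\<lambda>(b, d, \<epsilon>).
     \<epsilon> \<in> module_hom R (free_module R (b 0)) N \<and>
     (\<forall>i. d i \<in> module_hom R (free_module R (b (Suc i))) (free_module R (b i))) \<and>
     \<epsilon> ` carrier (free_module R (b 0)) = carrier N \<and>
     d 0 ` carrier (free_module R (b 1)) = a_kernel (free_module R (b 0)) N \<epsilon> \<and>
     (\<forall>i. d (Suc i) ` carrier (free_module R (b (Suc (Suc i)))) =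
            a_kernel (free_module R (b (Suc i))) (free_module R (b i)) (d i)))"

text \<open>
  \<open>Ext R i N M\<close> is the \<open>i\<close>-th cohomology group of the complex \<open>Hom(F, M)\<close>, where \<open>F\<close> is a chosen
  free resolution of \<open>N\<close>. Up to isomorphism it does not depend on the choice. Such a resolution
  exists whenever \<open>R\<close> is noetherian and \<open>N\<close> is finitely generated; otherwise the definition
  need not be meaningful.
\<close>

definition Ext ::
  "('a, 'm) ring_scheme \<Rightarrow> nat \<Rightarrow> ('a, 'c, 'n) module_scheme \<Rightarrow> ('a, 'b, 'o) module_scheme
     \<Rightarrow> ((nat \<Rightarrow> 'a) \<Rightarrow> 'b) set monoid"
  where
  "Ext R i N M =
     (let (b, d, \<epsilon>) = (SOME res. free_resolution R N res);
          F = (\<lambda>j. free_module R (b j));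
          C = (\<lambda>j. Hom_module R (F j) M);
          \<delta> = (\<lambda>j f. compose (carrier (F (Suc j))) f (d j));
          cocycles = a_kernel (C i) (C (Suc i)) (\<delta> i);
          coboundaries = (case i of 0 \<Rightarrow> {\<zero>\<^bsub>C 0\<^esub>} | Suc j \<Rightarrow> \<delta> j ` carrier (C j))
      in (C i)\<lparr>carrier := cocycles\<rparr> A_Mod coboundaries)"

text \<open>The depth over the polynomial ring in the variables \<open>V\<close>; it is \<open>\<infinity>\<close> if all Ext groups
  vanish.\<close>

definition depth ::
  "'v set \<Rightarrow> (('v, 'k::field) mpoly, 'b, 'o) module_scheme \<Rightarrow> enat"
  where
  "depth V M =
     Inf {enat i |i.
            carrier (Ext (mpoly_ring V) i (coeff_field_module :: (('v, 'k) mpoly, 'k) module) M)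
              \<noteq> {\<one>\<^bsub>Ext (mpoly_ring V) i (coeff_field_module :: (('v, 'k) mpoly, 'k) module) M\<^esub>}}"

end

theory Submission
  imports Defs
begin

text \<open>
  Write \<open>S\<close> for the polynomial ring, \<open>K\<close> for its residue field and \<open>S/I\<^sub>\<Delta>\<close> for the Stanley--Reisner ring
  of a simplicial complex \<open>\<Delta>\<close>. The edge ideal of \<open>G\<close> is \<open>I\<^sub>\<Delta>\<close> for the complex \<open>\<Delta>\<close> of independent
  sets of \<open>G\<close>, and for every vertex \<open>v\<close> multiplication by \<open>x\<^sub>v\<close> gives an exact sequence
  \<open>0 \<rightarrow> S/I\<^bsub>star v\<^esub> \<rightarrow> S/I\<^sub>\<Delta> \<rightarrow> S/I\<^bsub>\<Delta> - v\<^esub> \<rightarrow> 0\<close>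
  (lemma \<open>star_deletion_exact\<close>). Through the long exact sequence of Ext, lower bounds for the depths of
  the outer terms pass to the middle one, and if the left term has depth exactly \<open>s > 0\<close> while the right
  term has depth at least \<open>s\<close>, then the middle term has depth exactly \<open>s\<close>, because
  \<open>Ext\<^sup>s\<^sup>-\<^sup>1\<close> of the right term vanishes and hence \<open>Ext\<^sup>s\<close> of the left term embeds into that of the middle one.

  Delete the vertices of \<open>K\<^sub>n\<close> from \<open>G\<close> one at a time. The star of \<open>v \<in> [n]\<close> in any of the complexes that
  arise consists of the partial transversals of a disjoint family: \<open>{v}\<close> together with the sets of new
  vertices of the attached cliques that avoid \<open>v\<close>. After all deletions the partial transversals of all
  the sets of new vertices remain. The same exact sequence, now applied inside a member of the family,
  reduces such a complex to simplices, whose depth is the number of vertices; thus the complex of partial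
  transversals of \<open>s\<close> sets has depth \<open>s\<close>. If the vertex deleted first minimizes \<open>1 + #{cliques avoiding v}\<close>
  and the minimum is at most \<open>|W|\<close>, then it is the depth of \<open>S/I\<^sub>G\<close> (theorem \<open>depth_clique_attachment\<close>).
  A vertex of \<open>W\<^sub>i\<close> lies in at most \<open>|W\<^sub>i|\<close> of the \<open>|W|\<close> cliques, and the first vertex of a largest
  \<open>W\<^sub>i\<close> attains this bound, which gives the formula.

  Two points of homological algebra carry the argument for an arbitrary free resolution \<open>F\<close> of \<open>K\<close>, such as
  the one that Ext chooses. First, a variable annihilates \<open>K\<close>, so it acts on \<open>F\<close> by a null-homotopic map
  and hence as zero on Ext; dividing by a regular variable therefore lowers the depth by one
  (lemma \<open>regular_element_vanishing\<close>), which computes the depth of a simplex by induction. Second, a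
  finite free resolution of \<open>K\<close> must exist: the Koszul complex is built by iterated mapping cones
  (lemmas \<open>cone_augmented\<close> and \<open>simplex_resolution\<close>).
\<close>


section \<open>Linear maps\<close>

text \<open>Homomorphisms without the extensionality condition, so that compositions and sums can be written as
  plain lambda terms; two of them are compared on the carrier only.\<close>

definition linear_maps ::
  "('a, 'm) ring_scheme \<Rightarrow> ('a, 'b, 'n) module_scheme \<Rightarrow> ('a, 'c, 'o) module_scheme \<Rightarrow> ('b \<Rightarrow> 'c) set"
  where
  "linear_maps R M N =
     {f \<in> carrier M \<rightarrow> carrier N.
        (\<forall>x\<in>carrier M. \<forall>y\<in>carrier M. f (x \<oplus>\<^bsub>M\<^esub> y) = f x \<oplus>\<^bsub>N\<^esub> f y) \<and>
        (\<forall>r\<in>carrier R. \<forall>x\<in>carrier M. f (r \<odot>\<^bsub>M\<^esub> x) = r \<odot>\<^bsub>N\<^esub> f x)}"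

lemma linear_mapsI:
  assumes "\<And>x. x \<in> carrier M \<Longrightarrow> f x \<in> carrier N"
    and "\<And>x y. x \<in> carrier M \<Longrightarrow> y \<in> carrier M \<Longrightarrow> f (x \<oplus>\<^bsub>M\<^esub> y) = f x \<oplus>\<^bsub>N\<^esub> f y"
    and "\<And>r x. r \<in> carrier R \<Longrightarrow> x \<in> carrier M \<Longrightarrow> f (r \<odot>\<^bsub>M\<^esub> x) = r \<odot>\<^bsub>N\<^esub> f x"
  shows "f \<in> linear_maps R M N"
  using assms by (auto simp: linear_maps_def)

lemma linear_maps_closed: "f \<in> linear_maps R M N \<Longrightarrow> x \<in> carrier M \<Longrightarrow> f x \<in> carrier N"
  by (auto simp: linear_maps_def)

lemma linear_maps_add:
  "f \<in> linear_maps R M N \<Longrightarrow> x \<in> carrier M \<Longrightarrow> y \<in> carrier M \<Longrightarrow> f (x \<oplus>\<^bsub>M\<^esub> y) = f x \<oplus>\<^bsub>N\<^esub> f y"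
  by (auto simp: linear_maps_def)

lemma linear_maps_smult:
  "f \<in> linear_maps R M N \<Longrightarrow> r \<in> carrier R \<Longrightarrow> x \<in> carrier M \<Longrightarrow> f (r \<odot>\<^bsub>M\<^esub> x) = r \<odot>\<^bsub>N\<^esub> f x"
  by (auto simp: linear_maps_def)

lemma linear_maps_group_hom:
  assumes "module R M" "module R N" "f \<in> linear_maps R M N"
  shows "abelian_group_hom M N f"
  using assms unfolding module_def linear_maps_def
  by (intro abelian_group_homI group_hom.intro group_hom_axioms.intro abelian_group.a_group homI) auto

lemma linear_maps_zero:
  assumes "module R M" "module R N" "f \<in> linear_maps R M N"
  shows "f \<zero>\<^bsub>M\<^esub> = \<zero>\<^bsub>N\<^esub>"
  using abelian_group_hom.hom_zero[OF linear_maps_group_hom[OF assms]] .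

lemma linear_maps_minus:
  assumes "module R M" "module R N" "f \<in> linear_maps R M N" "x \<in> carrier M" "y \<in> carrier M"
  shows "f (x \<ominus>\<^bsub>M\<^esub> y) = f x \<ominus>\<^bsub>N\<^esub> f y"
proof -
  interpret abelian_group_hom M N f by (rule linear_maps_group_hom) fact+
  show ?thesis using assms(4,5) by (simp add: a_minus_def)
qed

lemma linear_maps_cong:
  assumes "\<And>x. x \<in> carrier M \<Longrightarrow> f x = g x" "module R M"
  shows "f \<in> linear_maps R M N \<longleftrightarrow> g \<in> linear_maps R M N"
proof -
  interpret module R M by fact
  show ?thesis using assms(1) by (auto simp: linear_maps_def Pi_def)
qed

lemma linear_maps_comp:
  "f \<in> linear_maps R M N \<Longrightarrow> g \<in> linear_maps R N P \<Longrightarrow> (\<lambda>x. g (f x)) \<in> linear_maps R M P"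
  by (auto simp: linear_maps_def Pi_def)

lemma linear_maps_zero_map:
  assumes "module R N"
  shows "(\<lambda>x. \<zero>\<^bsub>N\<^esub>) \<in> linear_maps R M N"
proof -
  interpret module R N by fact
  show ?thesis by (auto simp: linear_maps_def)
qed

lemma linear_maps_plus_map:
  assumes "module R N" "f \<in> linear_maps R M N" "g \<in> linear_maps R M N"
  shows "(\<lambda>x. f x \<oplus>\<^bsub>N\<^esub> g x) \<in> linear_maps R M N"
proof -
  interpret module R N by fact
  show ?thesis using assms(2,3)
    by (auto simp: linear_maps_def Pi_def M.a_ac smult_r_distr)
qed

lemma linear_maps_scaling:
  assumes "module R M" "r \<in> carrier R"
  shows "(\<lambda>x. r \<odot>\<^bsub>M\<^esub> x) \<in> linear_maps R M M"
proof -
  interpret module R M by fact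
  show ?thesis using assms(2)
    by (auto simp: linear_maps_def Pi_def smult_r_distr smult_assoc1[symmetric] R.m_comm)
qed

lemma linear_maps_minus_map:
  assumes "module R N" "f \<in> linear_maps R M N" "g \<in> linear_maps R M N"
  shows "(\<lambda>x. f x \<ominus>\<^bsub>N\<^esub> g x) \<in> linear_maps R M N"
proof -
  interpret module R N by fact
  show ?thesis using assms(2,3)
    by (auto simp: linear_maps_def Pi_def M.a_ac M.minus_add a_minus_def smult_r_distr smult_r_minus)
qed

lemma linear_maps_factor_inj:
  assumes mods: "module R A" "module R B" and f: "f \<in> linear_maps R M B"
    and \<alpha>: "\<alpha> \<in> linear_maps R A B" "inj_on \<alpha> (carrier A)"
    and im: "\<And>x. x \<in> carrier M \<Longrightarrow> f x \<in> \<alpha> ` carrier A" and M: "module R M"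
  shows "\<exists>g\<in>linear_maps R M A. \<forall>x\<in>carrier M. \<alpha> (g x) = f x"
proof -
  interpret A: module R A by fact
  interpret B: module R B by fact
  interpret M: module R M by fact
  define g where "g = (\<lambda>x. inv_into (carrier A) \<alpha> (f x))"
  have g: "g x \<in> carrier A" "\<alpha> (g x) = f x" if "x \<in> carrier M" for x
    using im[OF that] unfolding g_def by (auto simp: inv_into_into f_inv_into_f)
  have "g \<in> linear_maps R M A"
  proof (rule linear_mapsI)
    fix x y assume xy: "x \<in> carrier M" "y \<in> carrier M"
    have "\<alpha> (g (x \<oplus>\<^bsub>M\<^esub> y)) = \<alpha> (g x \<oplus>\<^bsub>A\<^esub> g y)"
      using xy g by (simp add: linear_maps_add[OF f] linear_maps_add[OF \<alpha>(1)])
    then show "g (x \<oplus>\<^bsub>M\<^esub> y) = g x \<oplus>\<^bsub>A\<^esub> g y"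
      using inj_onD[OF \<alpha>(2)] g xy by auto
  next
    fix r x assume xy: "r \<in> carrier R" "x \<in> carrier M"
    have "\<alpha> (g (r \<odot>\<^bsub>M\<^esub> x)) = \<alpha> (r \<odot>\<^bsub>A\<^esub> g x)"
      using xy g by (simp add: linear_maps_smult[OF f] linear_maps_smult[OF \<alpha>(1)])
    then show "g (r \<odot>\<^bsub>M\<^esub> x) = r \<odot>\<^bsub>A\<^esub> g x"
      using inj_onD[OF \<alpha>(2)] g xy by auto
  qed (rule g)
  then show ?thesis using g(2) by (intro bexI[of _ g]) auto
qed

lemma module_hom_iff: "f \<in> module_hom R M N \<longleftrightarrow> f \<in> linear_maps R M N \<and> f \<in> extensional (carrier M)"
  by (auto simp: module_hom_def linear_maps_def PiE_def)

lemma restrict_module_hom: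
  assumes "module R M" "f \<in> linear_maps R M N"
  shows "restrict f (carrier M) \<in> module_hom R M N"
  using assms linear_maps_cong[of M "restrict f (carrier M)" f R N] by (simp add: module_hom_iff)


section \<open>Free modules\<close>

lemma free_module_simps:
  "carrier (free_module R b) = {..<b} \<rightarrow>\<^sub>E carrier R"
  "\<zero>\<^bsub>free_module R b\<^esub> = (\<lambda>i\<in>{..<b}. \<zero>\<^bsub>R\<^esub>)"
  "x \<oplus>\<^bsub>free_module R b\<^esub> y = (\<lambda>i\<in>{..<b}. x i \<oplus>\<^bsub>R\<^esub> y i)"
  "r \<odot>\<^bsub>free_module R b\<^esub> x = (\<lambda>i\<in>{..<b}. r \<otimes>\<^bsub>R\<^esub> x i)"
  by (simp_all add: free_module_def)

lemma (in cring) free_module_module: "module R (free_module R b)"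
proof (rule moduleI)
  show "abelian_group (free_module R b)"
  proof (rule abelian_groupI)
    fix x assume x: "x \<in> carrier (free_module R b)"
    then show "\<exists>y\<in>carrier (free_module R b). y \<oplus>\<^bsub>free_module R b\<^esub> x = \<zero>\<^bsub>free_module R b\<^esub>"
      by (intro bexI[of _ "\<lambda>i\<in>{..<b}. \<ominus> x i"])
        (auto simp: free_module_simps PiE_def Pi_def l_neg intro!: restrict_ext)
  qed (auto simp: free_module_simps PiE_def Pi_def a_ac extensional_def intro!: ext)
qed (auto simp: free_module_simps PiE_def Pi_def is_cring l_distr r_distr m_assoc extensional_def intro!: ext)

text \<open>The standard basis argument: a linear map out of \<open>R^b\<close> may be prescribed on the unit vectors,
  so it can be lifted through any linear map \<open>\<beta>\<close> whose image contains its image.\<close>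

lemma free_module_lift:
  assumes R: "cring R" and mods: "module R B" "module R C"
    and f: "f \<in> linear_maps R (free_module R b) C" and \<beta>: "\<beta> \<in> linear_maps R B C"
    and im: "\<And>x. x \<in> carrier (free_module R b) \<Longrightarrow> f x \<in> \<beta> ` carrier B"
  shows "\<exists>h\<in>linear_maps R (free_module R b) B. \<forall>x\<in>carrier (free_module R b). \<beta> (h x) = f x"
proof -
  interpret cring R by fact
  interpret B: module R B by fact
  interpret C: module R C by fact
  let ?F = "free_module R b"
  interpret F: module R ?F by (rule free_module_module)
  interpret \<beta>: abelian_group_hom B C \<beta> by (rule linear_maps_group_hom) fact+
  define e where "e i = (\<lambda>j\<in>{..<b}. if j = i then \<one>\<^bsub>R\<^esub> else \<zero>\<^bsub>R\<^esub>)" for i :: nat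
  have e: "e i \<in> carrier ?F" for i by (auto simp: e_def free_module_simps)
  define y where "y i = inv_into (carrier B) \<beta> (f (e i))" for i
  have y: "y i \<in> carrier B" "\<beta> (y i) = f (e i)" for i
    unfolding y_def using im[OF e, of i] by (auto simp: inv_into_into f_inv_into_f)
  define h where "h x = (\<Oplus>\<^bsub>B\<^esub>i\<in>{..<b}. x i \<odot>\<^bsub>B\<^esub> y i)" for x
  have cl: "x i \<in> carrier R" if "x \<in> carrier ?F" "i < b" for x i
    using that by (auto simp: free_module_simps)
  have "h \<in> linear_maps R ?F B"
  proof (rule linear_mapsI)
    fix x x' assume *: "x \<in> carrier ?F" "x' \<in> carrier ?F"
    have "h (x \<oplus>\<^bsub>?F\<^esub> x') = (\<Oplus>\<^bsub>B\<^esub>i\<in>{..<b}. x i \<odot>\<^bsub>B\<^esub> y i \<oplus>\<^bsub>B\<^esub> x' i \<odot>\<^bsub>B\<^esub> y i)"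
      unfolding h_def using * y cl
      by (intro B.M.finsum_cong') (auto simp: free_module_simps(3) B.smult_l_distr)
    also have "\<dots> = h x \<oplus>\<^bsub>B\<^esub> h x'"
      unfolding h_def using * y cl by (intro B.M.finsum_addf) auto
    finally show "h (x \<oplus>\<^bsub>?F\<^esub> x') = h x \<oplus>\<^bsub>B\<^esub> h x'" .
  next
    fix r x assume *: "r \<in> carrier R" "x \<in> carrier ?F"
    have "h (r \<odot>\<^bsub>?F\<^esub> x) = (\<Oplus>\<^bsub>B\<^esub>i\<in>{..<b}. r \<odot>\<^bsub>B\<^esub> (x i \<odot>\<^bsub>B\<^esub> y i))"
      unfolding h_def using * y cl
      by (intro B.M.finsum_cong') (auto simp: free_module_simps(4) B.smult_assoc1)
    also have "\<dots> = r \<odot>\<^bsub>B\<^esub> h x"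
      unfolding h_def using * y cl by (intro B.finsum_smult_ldistr[symmetric]) auto
    finally show "h (r \<odot>\<^bsub>?F\<^esub> x) = r \<odot>\<^bsub>B\<^esub> h x" .
  qed (use y cl in \<open>auto simp: h_def\<close>)
  moreover have "\<beta> (h x) = f x" if x: "x \<in> carrier ?F" for x
  proof -
    \<comment> \<open>\<open>f x\<close> is recovered from the unit vectors by truncating \<open>x\<close> after \<open>k\<close> entries.\<close>
    define t where "t k = (\<lambda>i\<in>{..<b}. if i < k then x i else \<zero>\<^bsub>R\<^esub>)" for k
    have t: "t k \<in> carrier ?F" for k using cl[OF x] by (auto simp: t_def free_module_simps)
    have "f (t k) = (\<Oplus>\<^bsub>C\<^esub>i\<in>{..<k}. x i \<odot>\<^bsub>C\<^esub> f (e i))" if "k \<le> b" for k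
      using that
    proof (induction k)
      case 0
      have "t 0 = \<zero>\<^bsub>?F\<^esub>" by (auto simp: t_def free_module_simps)
      then show ?case using linear_maps_zero[OF F.module_axioms mods(2) f] by simp
    next
      case (Suc k)
      have xk: "x k \<in> carrier R" using cl[OF x] Suc.prems by simp
      have "t (Suc k) = x k \<odot>\<^bsub>?F\<^esub> e k \<oplus>\<^bsub>?F\<^esub> t k"
        using cl[OF x] xk by (auto simp: t_def e_def free_module_simps less_Suc_eq intro!: restrict_ext)
      then have "f (t (Suc k)) = x k \<odot>\<^bsub>C\<^esub> f (e k) \<oplus>\<^bsub>C\<^esub> f (t k)"
        using xk by (simp add: linear_maps_add[OF f] linear_maps_smult[OF f] e t)
      also have "\<dots> = (\<Oplus>\<^bsub>C\<^esub>i\<in>insert k {..<k}. x i \<odot>\<^bsub>C\<^esub> f (e i))"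
        using Suc cl[OF x] linear_maps_closed[OF f e]
        by (subst C.M.finsum_insert) (auto simp: Pi_def)
      also have "insert k {..<k} = {..<Suc k}" by auto
      finally show ?case .
    qed
    moreover have "t b = x" using x by (auto simp: t_def free_module_simps PiE_def extensional_def)
    ultimately have "f x = (\<Oplus>\<^bsub>C\<^esub>i\<in>{..<b}. x i \<odot>\<^bsub>C\<^esub> f (e i))" by (metis order_refl)
    also have "\<dots> = (\<Oplus>\<^bsub>C\<^esub>i\<in>{..<b}. \<beta> (x i \<odot>\<^bsub>B\<^esub> y i))"
      using cl[OF x] y by (intro C.M.finsum_cong') (auto simp: linear_maps_smult[OF \<beta>] linear_maps_closed[OF f e])
    also have "\<dots> = \<beta> (h x)"
    proof -
      have "\<beta> (\<Oplus>\<^bsub>B\<^esub>i\<in>S. x i \<odot>\<^bsub>B\<^esub> y i) = (\<Oplus>\<^bsub>C\<^esub>i\<in>S. \<beta> (x i \<odot>\<^bsub>B\<^esub> y i))"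
        if "finite S" "S \<subseteq> {..<b}" for S
        using that
      proof (induction S)
        case (insert i S)
        then show ?case using cl[OF x] y
          by (subst B.M.finsum_insert C.M.finsum_insert; (auto simp: Pi_def subset_eq)[1])+
      qed simp
      then show ?thesis unfolding h_def by simp
    qed
    finally show ?thesis by simp
  qed
  ultimately show ?thesis by (intro bexI[of _ h]) auto
qed


section \<open>Cohomology of a complex of free modules\<close>

lemma (in abelian_group) add_minus_cancel:
  assumes "x \<in> carrier G" "y \<in> carrier G"
  shows "y \<oplus> (x \<ominus> y) = x"
  using assms by (metis a_minus_def a_comm add.inv_closed r_neg2)

definition short_exact ::
  "('a, 'm) ring_scheme \<Rightarrow> ('a, 'b, 'n) module_scheme \<Rightarrow> ('a, 'c, 'o) module_scheme
     \<Rightarrow> ('a, 'd, 'p) module_scheme \<Rightarrow> ('b \<Rightarrow> 'c) \<Rightarrow> ('c \<Rightarrow> 'd) \<Rightarrow> bool"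
  where
  "short_exact R A B C \<alpha> \<beta> \<longleftrightarrow>
     module R A \<and> module R B \<and> module R C \<and>
     \<alpha> \<in> linear_maps R A B \<and> \<beta> \<in> linear_maps R B C \<and> inj_on \<alpha> (carrier A) \<and>
     \<alpha> ` carrier A = {x \<in> carrier B. \<beta> x = \<zero>\<^bsub>C\<^esub>} \<and> \<beta> ` carrier B = carrier C"

locale free_complex = cring R for R :: "('a, 'm) ring_scheme" (structure) +
  fixes b :: "nat \<Rightarrow> nat" and d :: "nat \<Rightarrow> (nat \<Rightarrow> 'a) \<Rightarrow> (nat \<Rightarrow> 'a)"
  assumes d_linear: "d i \<in> linear_maps R (free_module R (b (Suc i))) (free_module R (b i))"
    and d_d: "x \<in> carrier (free_module R (b (Suc (Suc i)))) \<Longrightarrow> d i (d (Suc i) x) = \<zero>\<^bsub>free_module R (b i)\<^esub>"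
begin

abbreviation F where "F i \<equiv> free_module R (b i)"

definition cocycle :: "('a, 'b, 'n) module_scheme \<Rightarrow> nat \<Rightarrow> ((nat \<Rightarrow> 'a) \<Rightarrow> 'b) \<Rightarrow> bool" where
  "cocycle M i f \<longleftrightarrow> f \<in> linear_maps R (F (Suc i)) M \<and>
     (\<forall>x\<in>carrier (F (Suc (Suc i))). f (d (Suc i) x) = \<zero>\<^bsub>M\<^esub>)"

definition coboundary :: "('a, 'b, 'n) module_scheme \<Rightarrow> nat \<Rightarrow> ((nat \<Rightarrow> 'a) \<Rightarrow> 'b) \<Rightarrow> bool" where
  "coboundary M i f \<longleftrightarrow> (\<exists>g\<in>linear_maps R (F i) M. \<forall>x\<in>carrier (F (Suc i)). f x = g (d i x))"

text \<open>The degree is shifted by one: \<open>cohomology_vanishes M i\<close> speaks about the middle term of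
  \<open>Hom(F i, M) \<rightarrow> Hom(F (i + 1), M) \<rightarrow> Hom(F (i + 2), M)\<close>. Thus a resolution is entered with
  a zero module in degree \<open>0\<close>, and its first cohomology group is the case \<open>i = 0\<close> of the same formula.\<close>

definition cohomology_vanishes :: "('a, 'b, 'n) module_scheme \<Rightarrow> nat \<Rightarrow> bool" where
  "cohomology_vanishes M i \<longleftrightarrow> (\<forall>f. cocycle M i f \<longrightarrow> coboundary M i f)"

lemma coboundaryI:
  assumes "g \<in> linear_maps R (F i) M" "\<And>x. x \<in> carrier (F (Suc i)) \<Longrightarrow> f x = g (d i x)"
  shows "coboundary M i f"
  unfolding coboundary_def using assms by (intro bexI[of _ g]) auto

lemma F_module: "module R (F i)"
  by (rule free_module_module)

lemma d_closed: "x \<in> carrier (F (Suc i)) \<Longrightarrow> d i x \<in> carrier (F i)"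
  using linear_maps_closed[OF d_linear] .

lemma lift_through_surjection:
  assumes "module R B" "module R C" "f \<in> linear_maps R (F i) C" "\<beta> \<in> linear_maps R B C"
    and "\<And>x. x \<in> carrier (F i) \<Longrightarrow> f x \<in> \<beta> ` carrier B"
  shows "\<exists>h\<in>linear_maps R (F i) B. \<forall>x\<in>carrier (F i). \<beta> (h x) = f x"
  by (rule free_module_lift[OF is_cring assms])

context
  fixes A :: "('a, 'b, 'n) module_scheme" and B :: "('a, 'c, 'o) module_scheme"
    and C :: "('a, 'e, 'p) module_scheme" and \<alpha> \<beta>
  assumes ses: "short_exact R A B C \<alpha> \<beta>"
begin

lemma ses_modules: "module R A" "module R B" "module R C"
  and ses_linear: "\<alpha> \<in> linear_maps R A B" "\<beta> \<in> linear_maps R B C"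
  and ses_inj: "inj_on \<alpha> (carrier A)"
  and ses_exact: "\<alpha> ` carrier A = {x \<in> carrier B. \<beta> x = \<zero>\<^bsub>C\<^esub>}"
  and ses_surj: "\<beta> ` carrier B = carrier C"
  using ses by (auto simp: short_exact_def)

lemma ses_factor:
  assumes "f \<in> linear_maps R M B" "module R M" "\<And>x. x \<in> carrier M \<Longrightarrow> \<beta> (f x) = \<zero>\<^bsub>C\<^esub>"
  shows "\<exists>g\<in>linear_maps R M A. \<forall>x\<in>carrier M. \<alpha> (g x) = f x"
proof -
  have "f x \<in> \<alpha> ` carrier A" if "x \<in> carrier M" for x
    using that assms(3) linear_maps_closed[OF assms(1)] by (simp add: ses_exact)
  then show ?thesis
    by (rule linear_maps_factor_inj[OF ses_modules(1,2) assms(1) ses_linear(1) ses_inj _ assms(2)])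
qed

lemma ses_lift:
  assumes "f \<in> linear_maps R (F i) C"
  shows "\<exists>h\<in>linear_maps R (F i) B. \<forall>x\<in>carrier (F i). \<beta> (h x) = f x"
  by (rule lift_through_surjection[OF ses_modules(2,3) assms ses_linear(2)])
    (simp add: linear_maps_closed[OF assms] ses_surj)

lemma ses_composite: "x \<in> carrier A \<Longrightarrow> \<beta> (\<alpha> x) = \<zero>\<^bsub>C\<^esub>"
  using ses_exact by blast

lemma ses_cocycle_sub:
  assumes g: "g \<in> linear_maps R (F (Suc i)) A"
    and "\<And>x. x \<in> carrier (F (Suc (Suc i))) \<Longrightarrow> \<alpha> (g (d (Suc i) x)) = \<zero>\<^bsub>B\<^esub>"
  shows "cocycle A i g"
  unfolding cocycle_def
proof (intro conjI ballI g)
  interpret A: module R A by (rule ses_modules)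
  fix x assume x: "x \<in> carrier (F (Suc (Suc i)))"
  have "\<alpha> (g (d (Suc i) x)) = \<alpha> \<zero>\<^bsub>A\<^esub>"
    using assms(2)[OF x] linear_maps_zero[OF ses_modules(1,2) ses_linear(1)] by simp
  then show "g (d (Suc i) x) = \<zero>\<^bsub>A\<^esub>"
    using inj_onD[OF ses_inj] linear_maps_closed[OF g d_closed[OF x]] by blast
qed

text \<open>Exactness of \<open>H\<^sup>i(A) \<rightarrow> H\<^sup>i(B) \<rightarrow> H\<^sup>i(C)\<close>.\<close>

lemma cohomology_vanishes_middle:
  assumes VA: "cohomology_vanishes A i" and VC: "cohomology_vanishes C i"
  shows "cohomology_vanishes B i"
  unfolding cohomology_vanishes_def
proof (intro allI impI)
  interpret A: module R A by (rule ses_modules)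
  interpret B: module R B by (rule ses_modules)
  interpret C: module R C by (rule ses_modules)
  fix f assume "cocycle B i f"
  then have f: "f \<in> linear_maps R (F (Suc i)) B"
    and fz: "\<And>x. x \<in> carrier (F (Suc (Suc i))) \<Longrightarrow> f (d (Suc i) x) = \<zero>\<^bsub>B\<^esub>"
    by (auto simp: cocycle_def)
  have "cocycle C i (\<lambda>x. \<beta> (f x))"
    unfolding cocycle_def
    using linear_maps_comp[OF f ses_linear(2)] fz
      linear_maps_zero[OF ses_modules(2,3) ses_linear(2)] by auto
  then obtain g where g: "g \<in> linear_maps R (F i) C"
    and gf: "\<And>x. x \<in> carrier (F (Suc i)) \<Longrightarrow> \<beta> (f x) = g (d i x)"
    using VC unfolding cohomology_vanishes_def coboundary_def by blast
  obtain h where h: "h \<in> linear_maps R (F i) B"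
    and hg: "\<And>x. x \<in> carrier (F i) \<Longrightarrow> \<beta> (h x) = g x"
    using ses_lift[OF g] by metis
  let ?hd = "\<lambda>x. h (d i x)"
  have hd: "?hd \<in> linear_maps R (F (Suc i)) B" by (rule linear_maps_comp[OF d_linear h])
  let ?k = "\<lambda>x. f x \<ominus>\<^bsub>B\<^esub> h (d i x)"
  have k: "?k \<in> linear_maps R (F (Suc i)) B"
    by (rule linear_maps_minus_map[OF ses_modules(2) f hd])
  have cl: "f x \<in> carrier B" "h (d i x) \<in> carrier B" "d i x \<in> carrier (F i)"
    if "x \<in> carrier (F (Suc i))" for x
    using linear_maps_closed[OF f that] linear_maps_closed[OF hd that] d_closed[OF that] by auto
  have kz: "\<beta> (?k x) = \<zero>\<^bsub>C\<^esub>" if x: "x \<in> carrier (F (Suc i))" for x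
  proof -
    have "\<beta> (?k x) = \<beta> (f x) \<ominus>\<^bsub>C\<^esub> \<beta> (h (d i x))"
      using cl[OF x] by (intro linear_maps_minus[OF ses_modules(2,3) ses_linear(2)])
    also have "\<dots> = \<zero>\<^bsub>C\<^esub>"
      using cl[OF x] x by (simp add: gf hg C.r_neg a_minus_def linear_maps_closed[OF g])
    finally show ?thesis .
  qed
  obtain u where u: "u \<in> linear_maps R (F (Suc i)) A"
    and uk: "\<And>x. x \<in> carrier (F (Suc i)) \<Longrightarrow> \<alpha> (u x) = ?k x"
    using ses_factor[OF k F_module kz] by metis
  have "cocycle A i u"
  proof (rule ses_cocycle_sub[OF u])
    fix x assume x: "x \<in> carrier (F (Suc (Suc i)))"
    show "\<alpha> (u (d (Suc i) x)) = \<zero>\<^bsub>B\<^esub>"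
      using x by (simp add: uk d_closed fz d_d linear_maps_zero[OF F_module ses_modules(2) h] a_minus_def)
  qed
  then obtain v where v: "v \<in> linear_maps R (F i) A"
    and vu: "\<And>x. x \<in> carrier (F (Suc i)) \<Longrightarrow> u x = v (d i x)"
    using VA unfolding cohomology_vanishes_def coboundary_def by blast
  have "(\<lambda>x. h x \<oplus>\<^bsub>B\<^esub> \<alpha> (v x)) \<in> linear_maps R (F i) B"
    by (intro linear_maps_plus_map ses_modules h linear_maps_comp[OF v ses_linear(1)])
  moreover have "f x = h (d i x) \<oplus>\<^bsub>B\<^esub> \<alpha> (v (d i x))" if x: "x \<in> carrier (F (Suc i))" for x
    using cl[OF x] x by (simp add: vu[symmetric] uk B.add_minus_cancel)
  ultimately show "coboundary B i f" by (rule coboundaryI)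
qed

text \<open>Injectivity of \<open>H\<^sup>i\<^sup>+\<^sup>1(A) \<rightarrow> H\<^sup>i\<^sup>+\<^sup>1(B)\<close> when \<open>H\<^sup>i(C) = 0\<close>.\<close>

lemma coboundary_sub:
  assumes VC: "cohomology_vanishes C i"
    and f: "f \<in> linear_maps R (F (Suc (Suc i))) A"
    and cb: "coboundary B (Suc i) (\<lambda>x. \<alpha> (f x))"
  shows "coboundary A (Suc i) f"
proof -
  interpret A: module R A by (rule ses_modules)
  interpret B: module R B by (rule ses_modules)
  interpret C: module R C by (rule ses_modules)
  obtain g where g: "g \<in> linear_maps R (F (Suc i)) B"
    and fg: "\<And>x. x \<in> carrier (F (Suc (Suc i))) \<Longrightarrow> \<alpha> (f x) = g (d (Suc i) x)"
    using cb unfolding coboundary_def by blast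
  have "cocycle C i (\<lambda>x. \<beta> (g x))"
    unfolding cocycle_def
  proof (intro conjI ballI)
    show "(\<lambda>x. \<beta> (g x)) \<in> linear_maps R (F (Suc i)) C" by (rule linear_maps_comp[OF g ses_linear(2)])
    show "\<beta> (g (d (Suc i) x)) = \<zero>\<^bsub>C\<^esub>" if "x \<in> carrier (F (Suc (Suc i)))" for x
      using ses_composite[OF linear_maps_closed[OF f that]] by (simp only: fg[OF that])
  qed
  then obtain h where h: "h \<in> linear_maps R (F i) C"
    and gh: "\<And>x. x \<in> carrier (F (Suc i)) \<Longrightarrow> \<beta> (g x) = h (d i x)"
    using VC unfolding cohomology_vanishes_def coboundary_def by blast
  obtain h' where h': "h' \<in> linear_maps R (F i) B"
    and hh: "\<And>x. x \<in> carrier (F i) \<Longrightarrow> \<beta> (h' x) = h x"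
    using ses_lift[OF h] by metis
  have hd: "(\<lambda>x. h' (d i x)) \<in> linear_maps R (F (Suc i)) B" by (rule linear_maps_comp[OF d_linear h'])
  let ?k = "\<lambda>x. g x \<ominus>\<^bsub>B\<^esub> h' (d i x)"
  have k: "?k \<in> linear_maps R (F (Suc i)) B"
    by (rule linear_maps_minus_map[OF ses_modules(2) g hd])
  have cl: "g x \<in> carrier B" "h' (d i x) \<in> carrier B" "d i x \<in> carrier (F i)"
    if "x \<in> carrier (F (Suc i))" for x
    using linear_maps_closed[OF g that] linear_maps_closed[OF hd that] d_closed[OF that] by auto
  have kz: "\<beta> (?k x) = \<zero>\<^bsub>C\<^esub>" if x: "x \<in> carrier (F (Suc i))" for x
  proof -
    have "\<beta> (?k x) = \<beta> (g x) \<ominus>\<^bsub>C\<^esub> \<beta> (h' (d i x))"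
      using cl[OF x] by (intro linear_maps_minus[OF ses_modules(2,3) ses_linear(2)])
    also have "\<dots> = \<zero>\<^bsub>C\<^esub>"
      using cl[OF x] x by (simp add: gh hh C.r_neg a_minus_def linear_maps_closed[OF h])
    finally show ?thesis .
  qed
  obtain u where u: "u \<in> linear_maps R (F (Suc i)) A"
    and uk: "\<And>x. x \<in> carrier (F (Suc i)) \<Longrightarrow> \<alpha> (u x) = ?k x"
    using ses_factor[OF k F_module kz] by metis
  have "f x = u (d (Suc i) x)" if x: "x \<in> carrier (F (Suc (Suc i)))" for x
  proof -
    have "\<alpha> (u (d (Suc i) x)) = \<alpha> (f x)"
      using x linear_maps_closed[OF g] 
      by (simp add: uk d_closed d_d linear_maps_zero[OF F_module ses_modules(2) h'] a_minus_def fg)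
    then have "u (d (Suc i) x) = f x"
      by (rule inj_onD[OF ses_inj _ linear_maps_closed[OF u d_closed[OF x]] linear_maps_closed[OF f x]])
    then show ?thesis ..
  qed
  with u show ?thesis by (rule coboundaryI)
qed

lemma cohomology_vanishes_sub:
  assumes "cohomology_vanishes B (Suc i)" "cohomology_vanishes C i"
  shows "cohomology_vanishes A (Suc i)"
  unfolding cohomology_vanishes_def
proof (intro allI impI)
  fix f assume f: "cocycle A (Suc i) f"
  then have fl: "f \<in> linear_maps R (F (Suc (Suc i))) A" by (simp add: cocycle_def)
  have "cocycle B (Suc i) (\<lambda>x. \<alpha> (f x))"
    unfolding cocycle_def
    using f linear_maps_comp[OF fl ses_linear(1)]
      linear_maps_zero[OF ses_modules(1,2) ses_linear(1)] by (auto simp: cocycle_def)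
  then have "coboundary B (Suc i) (\<lambda>x. \<alpha> (f x))" using assms(1) by (simp add: cohomology_vanishes_def)
  then show "coboundary A (Suc i) f" by (rule coboundary_sub[OF assms(2) fl])
qed

text \<open>Exactness of \<open>H\<^sup>i(B) \<rightarrow> H\<^sup>i(C) \<rightarrow> H\<^sup>i\<^sup>+\<^sup>1(A)\<close>.\<close>

lemma cohomology_vanishes_quotient:
  assumes VB: "cohomology_vanishes B i" and VA: "cohomology_vanishes A (Suc i)"
  shows "cohomology_vanishes C i"
  unfolding cohomology_vanishes_def
proof (intro allI impI)
  interpret A: module R A by (rule ses_modules)
  interpret B: module R B by (rule ses_modules)
  interpret C: module R C by (rule ses_modules)
  fix f assume "cocycle C i f"
  then have f: "f \<in> linear_maps R (F (Suc i)) C"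
    and fz: "\<And>x. x \<in> carrier (F (Suc (Suc i))) \<Longrightarrow> f (d (Suc i) x) = \<zero>\<^bsub>C\<^esub>"
    by (auto simp: cocycle_def)
  obtain h where h: "h \<in> linear_maps R (F (Suc i)) B"
    and hf: "\<And>x. x \<in> carrier (F (Suc i)) \<Longrightarrow> \<beta> (h x) = f x"
    using ses_lift[OF f] by metis
  have hd: "(\<lambda>x. h (d (Suc i) x)) \<in> linear_maps R (F (Suc (Suc i))) B"
    by (rule linear_maps_comp[OF d_linear h])
  have hz: "\<beta> (h (d (Suc i) x)) = \<zero>\<^bsub>C\<^esub>" if "x \<in> carrier (F (Suc (Suc i)))" for x
    using that by (simp add: hf fz d_closed)
  obtain g where g: "g \<in> linear_maps R (F (Suc (Suc i))) A"
    and gh: "\<And>x. x \<in> carrier (F (Suc (Suc i))) \<Longrightarrow> \<alpha> (g x) = h (d (Suc i) x)"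
    using ses_factor[OF hd F_module hz] by metis
  have "cocycle A (Suc i) g"
    by (rule ses_cocycle_sub[OF g])
      (simp add: gh d_closed d_d linear_maps_zero[OF F_module ses_modules(2) h])
  then obtain u where u: "u \<in> linear_maps R (F (Suc i)) A"
    and ug: "\<And>x. x \<in> carrier (F (Suc (Suc i))) \<Longrightarrow> g x = u (d (Suc i) x)"
    using VA unfolding cohomology_vanishes_def coboundary_def by blast
  have au: "(\<lambda>x. \<alpha> (u x)) \<in> linear_maps R (F (Suc i)) B" by (rule linear_maps_comp[OF u ses_linear(1)])
  let ?k = "\<lambda>x. h x \<ominus>\<^bsub>B\<^esub> \<alpha> (u x)"
  have k: "?k \<in> linear_maps R (F (Suc i)) B"
    by (rule linear_maps_minus_map[OF ses_modules(2) h au])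
  have "cocycle B i ?k"
    unfolding cocycle_def
  proof (intro conjI ballI k)
    fix x assume x: "x \<in> carrier (F (Suc (Suc i)))"
    then show "?k (d (Suc i) x) = \<zero>\<^bsub>B\<^esub>"
      using linear_maps_closed[OF hd x] by (simp add: ug[symmetric] gh a_minus_def B.r_neg)
  qed
  then obtain v where v: "v \<in> linear_maps R (F i) B"
    and vk: "\<And>x. x \<in> carrier (F (Suc i)) \<Longrightarrow> ?k x = v (d i x)"
    using VB unfolding cohomology_vanishes_def coboundary_def by blast
  have "f x = \<beta> (v (d i x))" if x: "x \<in> carrier (F (Suc i))" for x
  proof -
    have "\<beta> (?k x) = \<beta> (h x) \<ominus>\<^bsub>C\<^esub> \<beta> (\<alpha> (u x))"
      using linear_maps_closed[OF h x] linear_maps_closed[OF au x]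
      by (intro linear_maps_minus[OF ses_modules(2,3) ses_linear(2)])
    also have "\<dots> = f x"
      using linear_maps_closed[OF u x] linear_maps_closed[OF f x] x
      by (simp add: ses_composite hf a_minus_def)
    finally show ?thesis using vk[OF x] by simp
  qed
  with linear_maps_comp[OF v ses_linear(2)] show "coboundary C i f" by (rule coboundaryI)
qed

end

end


subsection \<open>Resolutions\<close>

text \<open>An exact augmented complex: \<open>\<dots> \<rightarrow> F 2 \<rightarrow> F 1 \<rightarrow> N \<rightarrow> 0\<close> with \<open>F 0 = 0\<close>.\<close>

locale augmented_free_complex = free_complex R b d for R :: "('a, 'm) ring_scheme" (structure) and b d +
  fixes N :: "('a, 'c, 'n) module_scheme" and \<epsilon>
  assumes N_module: "module R N"
    and b_0: "b 0 = 0"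
    and \<epsilon>_linear: "\<epsilon> \<in> linear_maps R (F 1) N"
    and \<epsilon>_surj: "\<epsilon> ` carrier (F 1) = carrier N"
    and \<epsilon>_exact: "d 1 ` carrier (F 2) = {x \<in> carrier (F 1). \<epsilon> x = \<zero>\<^bsub>N\<^esub>}"
    and d_exact: "d (Suc (Suc i)) ` carrier (F (Suc (Suc (Suc i)))) =
       {x \<in> carrier (F (Suc (Suc i))). d (Suc i) x = \<zero>\<^bsub>F (Suc i)\<^esub>}"
begin

text \<open>If \<open>r\<close> annihilates \<open>N\<close>, then multiplication by \<open>r\<close> on the resolution lifts the zero map of \<open>N\<close>
  and hence is null-homotopic. The homotopy is built degree by degree.\<close>

lemma annihilator_null_homotopic:
  assumes r: "r \<in> carrier R" and ann: "\<And>y. y \<in> carrier N \<Longrightarrow> r \<odot>\<^bsub>N\<^esub> y = \<zero>\<^bsub>N\<^esub>"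
  shows "\<exists>s\<in>linear_maps R (F i) (F (Suc i)). \<exists>t\<in>linear_maps R (F (Suc i)) (F (Suc (Suc i))).
    \<forall>x\<in>carrier (F (Suc i)). r \<odot>\<^bsub>F (Suc i)\<^esub> x = d (Suc i) (t x) \<oplus>\<^bsub>F (Suc i)\<^esub> s (d i x)"
proof (induction i)
  case 0
  interpret N: module R N by (rule N_module)
  interpret F1: module R "F (Suc 0)" by (rule F_module)
  have rl: "(\<lambda>x. r \<odot>\<^bsub>F (Suc 0)\<^esub> x) \<in> linear_maps R (F (Suc 0)) (F (Suc 0))"
    by (rule linear_maps_scaling[OF F_module r])
  have im: "r \<odot>\<^bsub>F (Suc 0)\<^esub> x \<in> d (Suc 0) ` carrier (F (Suc (Suc 0)))"
    if x: "x \<in> carrier (F (Suc 0))" for x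
  proof -
    have "\<epsilon> (r \<odot>\<^bsub>F (Suc 0)\<^esub> x) = \<zero>\<^bsub>N\<^esub>"
      using linear_maps_smult[OF \<epsilon>_linear r] ann[OF linear_maps_closed[OF \<epsilon>_linear]] x by simp
    then show ?thesis
      using \<epsilon>_exact x r by (simp add: numeral_2_eq_2)
  qed
  obtain t where t: "t \<in> linear_maps R (F (Suc 0)) (F (Suc (Suc 0)))"
    and dt: "\<And>x. x \<in> carrier (F (Suc 0)) \<Longrightarrow> d (Suc 0) (t x) = r \<odot>\<^bsub>F (Suc 0)\<^esub> x"
    using lift_through_surjection[OF F_module F_module rl d_linear im] by metis
  show ?case
    by (intro bexI[OF _ linear_maps_zero_map[OF F_module]] bexI[OF _ t])
      (simp add: dt r del: One_nat_def)
next
  case (Suc i)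
  then obtain s t where t: "t \<in> linear_maps R (F (Suc i)) (F (Suc (Suc i)))"
    and s: "s \<in> linear_maps R (F i) (F (Suc i))"
    and st: "\<And>x. x \<in> carrier (F (Suc i)) \<Longrightarrow>
      r \<odot>\<^bsub>F (Suc i)\<^esub> x = d (Suc i) (t x) \<oplus>\<^bsub>F (Suc i)\<^esub> s (d i x)"
    by blast
  let ?G = "F (Suc (Suc i))"
  interpret G: module R ?G by (rule F_module)
  interpret H: module R "F (Suc i)" by (rule F_module)
  have td: "(\<lambda>x. t (d (Suc i) x)) \<in> linear_maps R ?G ?G" by (rule linear_maps_comp[OF d_linear t])
  let ?k = "\<lambda>x. r \<odot>\<^bsub>?G\<^esub> x \<ominus>\<^bsub>?G\<^esub> t (d (Suc i) x)"
  have k: "?k \<in> linear_maps R ?G ?G"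
    by (rule linear_maps_minus_map[OF F_module linear_maps_scaling[OF F_module r] td])
  have im: "?k x \<in> d (Suc (Suc i)) ` carrier (F (Suc (Suc (Suc i))))" if x: "x \<in> carrier ?G" for x
  proof -
    have cl: "d (Suc i) x \<in> carrier (F (Suc i))" "t (d (Suc i) x) \<in> carrier ?G"
      using d_closed[OF x] linear_maps_closed[OF t] by auto
    have "d (Suc i) (t (d (Suc i) x)) = r \<odot>\<^bsub>F (Suc i)\<^esub> d (Suc i) x"
      using st[OF cl(1)] d_closed[OF cl(2)] x
      by (simp add: d_d linear_maps_zero[OF F_module F_module s])
    moreover have "d (Suc i) (?k x) =
        r \<odot>\<^bsub>F (Suc i)\<^esub> d (Suc i) x \<ominus>\<^bsub>F (Suc i)\<^esub> d (Suc i) (t (d (Suc i) x))"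
      using x cl r by (simp add: linear_maps_minus[OF F_module F_module d_linear]
        linear_maps_smult[OF d_linear])
    ultimately have "d (Suc i) (?k x) = \<zero>\<^bsub>F (Suc i)\<^esub>"
      using cl r by (simp add: a_minus_def H.r_neg)
    then show ?thesis
      using linear_maps_closed[OF k x] by (simp add: d_exact)
  qed
  obtain u where u: "u \<in> linear_maps R ?G (F (Suc (Suc (Suc i))))"
    and du: "\<And>x. x \<in> carrier ?G \<Longrightarrow> d (Suc (Suc i)) (u x) = ?k x"
    using lift_through_surjection[OF F_module F_module k d_linear im] by metis
  have "r \<odot>\<^bsub>?G\<^esub> x = d (Suc (Suc i)) (u x) \<oplus>\<^bsub>?G\<^esub> t (d (Suc i) x)" if x: "x \<in> carrier ?G" for x
    using x r linear_maps_closed[OF td x] by (simp add: du a_minus_def G.a_assoc G.l_neg)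
  then show ?case using t u by blast
qed

text \<open>In \<open>r f = f (d t + s d)\<close> the cocycle \<open>f\<close> kills the first summand, and the second is a coboundary:
  \<open>r\<close> annihilates the cohomology with values in any module.\<close>

lemma annihilator_coboundary:
  assumes r: "r \<in> carrier R" and ann: "\<And>y. y \<in> carrier N \<Longrightarrow> r \<odot>\<^bsub>N\<^esub> y = \<zero>\<^bsub>N\<^esub>"
    and M: "module R M" and f: "cocycle M i f"
  shows "coboundary M i (\<lambda>x. r \<odot>\<^bsub>M\<^esub> f x)"
proof -
  interpret M: module R M by (rule M)
  interpret G: module R "F (Suc i)" by (rule F_module)
  have fl: "f \<in> linear_maps R (F (Suc i)) M"
    and fz: "\<And>x. x \<in> carrier (F (Suc (Suc i))) \<Longrightarrow> f (d (Suc i) x) = \<zero>\<^bsub>M\<^esub>"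
    using f by (auto simp: cocycle_def)
  obtain s t where t: "t \<in> linear_maps R (F (Suc i)) (F (Suc (Suc i)))"
    and s: "s \<in> linear_maps R (F i) (F (Suc i))"
    and st: "\<And>x. x \<in> carrier (F (Suc i)) \<Longrightarrow>
      r \<odot>\<^bsub>F (Suc i)\<^esub> x = d (Suc i) (t x) \<oplus>\<^bsub>F (Suc i)\<^esub> s (d i x)"
    using annihilator_null_homotopic[OF r ann] by metis
  have "r \<odot>\<^bsub>M\<^esub> f x = f (s (d i x))" if x: "x \<in> carrier (F (Suc i))" for x
  proof -
    have cl: "t x \<in> carrier (F (Suc (Suc i)))" "s (d i x) \<in> carrier (F (Suc i))"
      using linear_maps_closed[OF t x] linear_maps_closed[OF s d_closed[OF x]] by auto
    have "r \<odot>\<^bsub>M\<^esub> f x = f (d (Suc i) (t x) \<oplus>\<^bsub>F (Suc i)\<^esub> s (d i x))"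
      using x r by (simp add: linear_maps_smult[OF fl, symmetric] st)
    also have "\<dots> = f (s (d i x))"
      using cl d_closed[OF cl(1)] linear_maps_closed[OF fl]
      by (simp add: linear_maps_add[OF fl] fz)
    finally show ?thesis .
  qed
  with linear_maps_comp[OF s fl] show ?thesis by (rule coboundaryI)
qed

text \<open>For an \<open>M\<close>-regular \<open>r\<close> that annihilates \<open>N\<close>, the long exact sequence of
  \<open>0 \<rightarrow> M \<rightarrow> M \<rightarrow> M/rM \<rightarrow> 0\<close> splits into short ones, because \<open>r\<close> acts as zero on cohomology:
  \<open>H\<^sup>i\<^sup>+\<^sup>1(M)\<close> embeds into itself by multiplication with \<open>r\<close> as soon as \<open>H\<^sup>i(M/rM) = 0\<close>.\<close>

lemma regular_element_vanishing:
  assumes ses: "short_exact R M M C (\<lambda>x. r \<odot>\<^bsub>M\<^esub> x) \<beta>"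
    and r: "r \<in> carrier R" and ann: "\<And>y. y \<in> carrier N \<Longrightarrow> r \<odot>\<^bsub>N\<^esub> y = \<zero>\<^bsub>N\<^esub>"
  shows "cohomology_vanishes M 0"
    and "cohomology_vanishes C i \<Longrightarrow> cohomology_vanishes M (Suc i)"
proof -
  have M: "module R M" using ses by (simp add: short_exact_def)
  interpret M: module R M by (rule M)
  show "cohomology_vanishes C i \<Longrightarrow> cohomology_vanishes M (Suc i)"
    unfolding cohomology_vanishes_def[of M]
    using coboundary_sub[OF ses _ _ annihilator_coboundary[OF r ann M]]
    unfolding cocycle_def by blast
  show "cohomology_vanishes M 0"
    unfolding cohomology_vanishes_def
  proof (intro allI impI)
    fix f assume f: "cocycle M 0 f"
    then have fl: "f \<in> linear_maps R (F (Suc 0)) M" by (simp add: cocycle_def)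
    obtain g where g: "g \<in> linear_maps R (F 0) M"
      and gf: "\<And>x. x \<in> carrier (F (Suc 0)) \<Longrightarrow> r \<odot>\<^bsub>M\<^esub> f x = g (d 0 x)"
      using annihilator_coboundary[OF r ann M f] by (auto simp: coboundary_def)
    have "f x = \<zero>\<^bsub>M\<^esub>" if x: "x \<in> carrier (F (Suc 0))" for x
    proof -
      have "d 0 x = \<zero>\<^bsub>F 0\<^esub>" using d_closed[OF x] b_0 by (simp add: free_module_simps restrict_def)
      then have "r \<odot>\<^bsub>M\<^esub> f x = r \<odot>\<^bsub>M\<^esub> \<zero>\<^bsub>M\<^esub>"
        using gf[OF x] linear_maps_zero[OF F_module M g] r by simp
      then show ?thesis
        using ses linear_maps_closed[OF fl x] by (auto simp: short_exact_def dest: inj_onD)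
    qed
    with linear_maps_zero_map[OF M, of "F 0"] show "coboundary M 0 f" by (rule coboundaryI)
  qed
qed

text \<open>Composed with the augmentation, a nonzero map \<open>N \<rightarrow> M\<close> is a nonzero cocycle in the lowest degree,
  where \<open>F 0 = 0\<close> leaves only the zero coboundary.\<close>

lemma cohomology_0_self:
  assumes iso: "\<phi> \<in> linear_maps R N M" "module R M" and y: "y \<in> carrier N" "\<phi> y \<noteq> \<zero>\<^bsub>M\<^esub>"
  shows "\<not> cohomology_vanishes M 0"
proof
  assume V: "cohomology_vanishes M 0"
  have l: "(\<lambda>x. \<phi> (\<epsilon> x)) \<in> linear_maps R (F (Suc 0)) M"
    using linear_maps_comp[OF \<epsilon>_linear iso(1)] by simp
  have "\<epsilon> (d (Suc 0) x) = \<zero>\<^bsub>N\<^esub>" if "x \<in> carrier (F (Suc (Suc 0)))" for x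
    using \<epsilon>_exact that by (auto simp: numeral_2_eq_2)
  then have "cocycle M 0 (\<lambda>x. \<phi> (\<epsilon> x))"
    unfolding cocycle_def using l linear_maps_zero[OF N_module iso(2,1)] by auto
  then obtain g where g: "g \<in> linear_maps R (F 0) M"
    and gf: "\<And>x. x \<in> carrier (F (Suc 0)) \<Longrightarrow> \<phi> (\<epsilon> x) = g (d 0 x)"
    using V unfolding cohomology_vanishes_def coboundary_def by blast
  obtain x where x: "x \<in> carrier (F (Suc 0))" "\<epsilon> x = y"
    using \<epsilon>_surj y(1) by (metis One_nat_def imageE)
  have "d 0 x = \<zero>\<^bsub>F 0\<^esub>" using d_closed[OF x(1)] b_0 by (simp add: free_module_simps restrict_def)
  then show False using gf[OF x(1)] linear_maps_zero[OF F_module iso(2) g] y x by simp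
qed

end


subsection \<open>Ext as the cohomology of a shifted complex\<close>

text \<open>A resolution is shifted by one degree, and the zero module \<open>R^0\<close> is placed in front, to match the
  indexing of \<open>cohomology_vanishes\<close>.\<close>

definition shifted_ranks :: "(nat \<Rightarrow> nat) \<Rightarrow> nat \<Rightarrow> nat" where
  "shifted_ranks b i = (case i of 0 \<Rightarrow> 0 | Suc j \<Rightarrow> b j)"

definition shifted_maps ::
  "('a, 'm) ring_scheme \<Rightarrow> (nat \<Rightarrow> (nat \<Rightarrow> 'a) \<Rightarrow> (nat \<Rightarrow> 'a)) \<Rightarrow> nat \<Rightarrow> (nat \<Rightarrow> 'a) \<Rightarrow> (nat \<Rightarrow> 'a)"
  where "shifted_maps R d i = (case i of 0 \<Rightarrow> (\<lambda>_. \<zero>\<^bsub>free_module R 0\<^esub>) | Suc j \<Rightarrow> d j)"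

lemma shifted_simps [simp]:
  "shifted_ranks b 0 = 0" "shifted_ranks b (Suc i) = b i"
  "shifted_maps R d 0 = (\<lambda>_. \<zero>\<^bsub>free_module R 0\<^esub>)" "shifted_maps R d (Suc i) = d i"
  by (simp_all add: shifted_ranks_def shifted_maps_def)

lemma a_kernel_eq: "a_kernel G H h = {x \<in> carrier G. h x = \<zero>\<^bsub>H\<^esub>}"
  by (simp add: a_kernel_def')

lemma free_resolution_iff_augmented:
  assumes "cring R" "module R N" 
    and \<epsilon>: "\<epsilon> \<in> extensional (carrier (free_module R (b 0)))"
    and d: "\<And>i. d i \<in> extensional (carrier (free_module R (b (Suc i))))"
  shows "free_resolution R N (b, d, \<epsilon>) \<longleftrightarrow>
    augmented_free_complex R (shifted_ranks b) (shifted_maps R d) N \<epsilon>"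
proof -
  interpret cring R by fact
  interpret N: module R N by fact
  have 0: "module R (free_module R i)" for i by (rule free_module_module)
  let ?F = "\<lambda>i. free_module R (b i)"
  have "augmented_free_complex R (shifted_ranks b) (shifted_maps R d) N \<epsilon> \<longleftrightarrow>
    (\<forall>i. d i \<in> linear_maps R (?F (Suc i)) (?F i)) \<and>
    (\<forall>i. \<forall>x\<in>carrier (?F (Suc (Suc i))). d i (d (Suc i) x) = \<zero>\<^bsub>?F i\<^esub>) \<and>
    \<epsilon> \<in> linear_maps R (?F 0) N \<and> \<epsilon> ` carrier (?F 0) = carrier N \<and>
    d 0 ` carrier (?F 1) = {x \<in> carrier (?F 0). \<epsilon> x = \<zero>\<^bsub>N\<^esub>} \<and>
    (\<forall>i. d (Suc i) ` carrier (?F (Suc (Suc i))) = {x \<in> carrier (?F (Suc i)). d i x = \<zero>\<^bsub>?F i\<^esub>})"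
    (is "_ \<longleftrightarrow> ?R")
  proof
    assume "augmented_free_complex R (shifted_ranks b) (shifted_maps R d) N \<epsilon>"
    then interpret augmented_free_complex R "shifted_ranks b" "shifted_maps R d" N \<epsilon> .
    show ?R
      using d_linear[of "Suc _"] d_d[of _ "Suc _"] \<epsilon>_linear \<epsilon>_surj \<epsilon>_exact d_exact
      by (simp add: numeral_2_eq_2)
  next
    assume ?R
    then show "augmented_free_complex R (shifted_ranks b) (shifted_maps R d) N \<epsilon>"
      using assms(1,2) linear_maps_zero_map[OF 0]
      by unfold_locales (auto simp: numeral_2_eq_2 split: nat.split simp: shifted_ranks_def shifted_maps_def)
  qed
  also have "\<dots> \<longleftrightarrow> free_resolution R N (b, d, \<epsilon>)"
    unfolding free_resolution_def
    by (auto simp: module_hom_iff \<epsilon> d a_kernel_eq) blast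
  finally show ?thesis by blast
qed

lemma free_resolution_augmented:
  assumes "cring R" "module R N" "free_resolution R N (b, d, \<epsilon>)"
  shows "augmented_free_complex R (shifted_ranks b) (shifted_maps R d) N \<epsilon>"
  using assms(3) by (subst free_resolution_iff_augmented[symmetric, OF assms(1,2)])
    (auto simp: free_resolution_def module_hom_iff)

text \<open>The hypotheses are the facts that the computation with cosets uses, so that the lemma applies directly to
  the Hom modules, where each of them is a statement about cocycles or coboundaries.\<close>

lemma A_Mod_trivial_iff:
  assumes sub: "B \<subseteq> carrier G"
    and zero: "\<zero>\<^bsub>G\<^esub> \<in> B" "\<And>a. a \<in> carrier G \<Longrightarrow> \<zero>\<^bsub>G\<^esub> \<oplus>\<^bsub>G\<^esub> a = a"
    and add: "\<And>a h. a \<in> B \<Longrightarrow> h \<in> B \<Longrightarrow> h \<oplus>\<^bsub>G\<^esub> a \<in> B"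
    and diff: "\<And>a h. a \<in> B \<Longrightarrow> h \<in> B \<Longrightarrow> \<exists>h'\<in>B. h' \<oplus>\<^bsub>G\<^esub> a = h"
  shows "carrier (G A_Mod B) = {\<one>\<^bsub>G A_Mod B\<^esub>} \<longleftrightarrow> carrier G \<subseteq> B"
proof -
  have carrier: "carrier (G A_Mod B) = (\<lambda>a. B +>\<^bsub>G\<^esub> a) ` carrier G" and one: "\<one>\<^bsub>G A_Mod B\<^esub> = B"
    by (auto simp: A_FactGroup_def' A_RCOSETS_def')
  have coset: "B +>\<^bsub>G\<^esub> a = B" if "a \<in> B" for a
    using add[OF that] diff[OF that] by (force simp: a_r_coset_def')
  have self: "a \<in> B +>\<^bsub>G\<^esub> a" if "a \<in> carrier G" for a
    using zero(1) zero(2)[OF that] unfolding a_r_coset_def' by force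
  show ?thesis
  proof
    assume eq: "carrier (G A_Mod B) = {\<one>\<^bsub>G A_Mod B\<^esub>}"
    show "carrier G \<subseteq> B"
    proof
      fix a assume a: "a \<in> carrier G"
      then have "B +>\<^bsub>G\<^esub> a \<in> {B}" using eq unfolding carrier one by blast
      then show "a \<in> B" using self[OF a] by simp
    qed
  next
    assume "carrier G \<subseteq> B"
    then have "(\<lambda>a. B +>\<^bsub>G\<^esub> a) ` carrier G = (\<lambda>a. B) ` carrier G"
      using coset by (intro image_cong) auto
    also have "\<dots> = {B}" using zero(1) sub by auto
    finally show "carrier (G A_Mod B) = {\<one>\<^bsub>G A_Mod B\<^esub>}" by (simp add: carrier one)
  qed
qed

text \<open>The passage between extensional homomorphisms and \<open>linear_maps\<close> happens here: cocycles and
  coboundaries in the sense of Ext are the extensional ones among those of the shifted complex.\<close>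

lemma Ext_trivial_iff:
  assumes R: "cring R" and N: "module R N" and M: "module R M"
    and res: "(SOME res. free_resolution R N res) = (b, d, \<epsilon>)" "free_resolution R N (b, d, \<epsilon>)"
  shows "carrier (Ext R i N M) = {\<one>\<^bsub>Ext R i N M\<^esub>} \<longleftrightarrow>
    free_complex.cohomology_vanishes R (shifted_ranks b) (shifted_maps R d) M i"
proof -
  interpret augmented_free_complex R "shifted_ranks b" "shifted_maps R d" N \<epsilon>
    by (rule free_resolution_augmented) fact+
  interpret M: module R M by fact
  let ?X = "\<lambda>j. carrier (free_module R (b j))"
  let ?C = "\<lambda>j. Hom_module R (free_module R (b j)) M"
  let ?\<delta> = "\<lambda>j f. compose (?X (Suc j)) f (d j)"
  define Z where "Z = {f \<in> extensional (?X i). cocycle M i f}"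
  define B where "B = {f \<in> extensional (?X i). coboundary M i f}"
  have Fm: "module R (free_module R j)" for j by (rule free_module_module)
  have dl: "d j \<in> linear_maps R (free_module R (b (Suc j))) (free_module R (b j))" for j
    using d_linear[of "Suc j"] by simp
  have Z: "a_kernel (?C i) (?C (Suc i)) (?\<delta> i) = Z"
  proof -
    have "compose (?X (Suc i)) f (d i) = (\<lambda>x\<in>?X (Suc i). \<zero>\<^bsub>M\<^esub>) \<longleftrightarrow>
      (\<forall>x\<in>?X (Suc i). f (d i x) = \<zero>\<^bsub>M\<^esub>)" for f
      by (auto simp: compose_def fun_eq_iff restrict_def)
    then show ?thesis
      by (auto simp: Z_def a_kernel_eq Hom_module_def module_hom_iff cocycle_def)
  qed
  have B: "(case i of 0 \<Rightarrow> {\<zero>\<^bsub>?C 0\<^esub>} | Suc j \<Rightarrow> ?\<delta> j ` carrier (?C j)) = B"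
  proof (cases i)
    case 0
    have g0: "g \<zero>\<^bsub>free_module R 0\<^esub> = \<zero>\<^bsub>M\<^esub>" if "g \<in> linear_maps R (free_module R 0) M" for g
      using linear_maps_zero[OF Fm M that] .
    have "coboundary M 0 f \<longleftrightarrow> (\<forall>x\<in>?X 0. f x = \<zero>\<^bsub>M\<^esub>)" for f
    proof
      assume "coboundary M 0 f"
      then obtain g where g: "g \<in> linear_maps R (free_module R 0) M"
        and "\<forall>x\<in>?X 0. f x = g \<zero>\<^bsub>free_module R 0\<^esub>"
        unfolding coboundary_def shifted_simps by metis
      then show "\<forall>x\<in>?X 0. f x = \<zero>\<^bsub>M\<^esub>" by (simp only: g0[OF g])
    next
      assume "\<forall>x\<in>?X 0. f x = \<zero>\<^bsub>M\<^esub>"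
      then show "coboundary M 0 f" by (intro coboundaryI[OF linear_maps_zero_map[OF M]]) simp
    qed
    then show ?thesis unfolding B_def 0
      by (auto simp: Hom_module_def extensional_def restrict_def fun_eq_iff)
  next
    case (Suc j)
    show ?thesis
    proof (intro equalityI subsetI)
      fix f assume "f \<in> (case i of 0 \<Rightarrow> {\<zero>\<^bsub>?C 0\<^esub>} | Suc j \<Rightarrow> ?\<delta> j ` carrier (?C j))"
      then obtain g where "g \<in> module_hom R (free_module R (b j)) M" "f = compose (?X (Suc j)) g (d j)"
        by (auto simp: Suc Hom_module_def)
      then show "f \<in> B"
        by (auto simp: B_def Suc module_hom_iff compose_eq intro!: coboundaryI[of g])
    next
      fix f assume "f \<in> B"
      then obtain g where g: "g \<in> linear_maps R (free_module R (b j)) M"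
        and f: "f \<in> extensional (?X i)" "\<And>x. x \<in> ?X i \<Longrightarrow> f x = g (d j x)"
        unfolding B_def Suc coboundary_def mem_Collect_eq shifted_simps by metis
      have "f = compose (?X (Suc j)) (restrict g (?X j)) (d j)"
        using f linear_maps_closed[OF dl]
        by (intro extensionalityI[of _ "?X i"]) (auto simp: Suc compose_eq)
      then show "f \<in> (case i of 0 \<Rightarrow> {\<zero>\<^bsub>?C 0\<^esub>} | Suc j \<Rightarrow> ?\<delta> j ` carrier (?C j))"
        using restrict_module_hom[OF Fm g] by (auto simp: Suc Hom_module_def)
    qed
  qed
  let ?G = "(?C i)\<lparr>carrier := Z\<rparr>"
  have "Ext R i N M = ?G A_Mod B"
    using Z B unfolding Ext_def res(1) Let_def by simp
  moreover have "carrier (?G A_Mod B) = {\<one>\<^bsub>?G A_Mod B\<^esub>} \<longleftrightarrow> carrier ?G \<subseteq> B"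
  proof (rule A_Mod_trivial_iff)
    have cb: "\<exists>g\<in>linear_maps R (free_module R (shifted_ranks b i)) M. \<forall>x\<in>?X i. f x = g (shifted_maps R d i x)"
      if "f \<in> B" for f
      using that by (simp add: B_def coboundary_def)
    have cbI: "restrict (\<lambda>x. g (shifted_maps R d i x)) (?X i) \<in> B"
      if "g \<in> linear_maps R (free_module R (shifted_ranks b i)) M" for g
      using that by (auto simp: B_def intro!: coboundaryI[of g])
    have add: "f \<oplus>\<^bsub>?G\<^esub> h = (\<lambda>x\<in>?X i. f x \<oplus>\<^bsub>M\<^esub> h x)" "\<zero>\<^bsub>?G\<^esub> = (\<lambda>x\<in>?X i. \<zero>\<^bsub>M\<^esub>)" for f h
      by (simp_all add: Hom_module_def)
    show "B \<subseteq> carrier ?G"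
    proof
      fix f assume f: "f \<in> B"
      then obtain g where g: "g \<in> linear_maps R (free_module R (shifted_ranks b i)) M"
        and fg: "\<And>x. x \<in> ?X i \<Longrightarrow> f x = g (shifted_maps R d i x)"
        using cb by metis
      have "f \<in> linear_maps R (free_module R (b i)) M"
        using linear_maps_comp[OF d_linear[of i] g] linear_maps_cong[of "free_module R (b i)" f "\<lambda>x. g (shifted_maps R d i x)" R M] fg Fm
        by simp
      moreover have "f (d i x) = \<zero>\<^bsub>M\<^esub>" if x: "x \<in> ?X (Suc i)" for x
      proof -
        have "shifted_maps R d i (d i x) = \<zero>\<^bsub>free_module R (shifted_ranks b i)\<^esub>"
          using d_d[of x i] x by simp
        then show ?thesis
          using fg[OF linear_maps_closed[OF dl x]] linear_maps_zero[OF Fm M g] by simp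
      qed
      ultimately show "f \<in> carrier ?G" using f by (simp add: Z_def B_def cocycle_def)
    qed
    show "\<zero>\<^bsub>?G\<^esub> \<in> B"
      using cbI[OF linear_maps_zero_map[OF M]] by (simp add: add)
    show "\<zero>\<^bsub>?G\<^esub> \<oplus>\<^bsub>?G\<^esub> a = a" if "a \<in> carrier ?G" for a
    proof -
      have "a \<in> extensional (?X i)" "a \<in> linear_maps R (free_module R (b i)) M"
        using that by (simp_all add: Z_def cocycle_def)
      then show ?thesis unfolding add
        by (intro extensionalityI[of _ "?X i"]) (auto dest: linear_maps_closed)
    qed
    fix a h assume a: "a \<in> B" and h: "h \<in> B"
    obtain g where g: "g \<in> linear_maps R (free_module R (shifted_ranks b i)) M"
        and ga: "\<And>x. x \<in> ?X i \<Longrightarrow> a x = g (shifted_maps R d i x)"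
      using cb[OF a] by metis
    obtain k where k: "k \<in> linear_maps R (free_module R (shifted_ranks b i)) M"
        and kh: "\<And>x. x \<in> ?X i \<Longrightarrow> h x = k (shifted_maps R d i x)"
      using cb[OF h] by metis
    have cl: "g (shifted_maps R d i x) \<in> carrier M" "k (shifted_maps R d i x) \<in> carrier M"
      if "x \<in> ?X i" for x
      using that linear_maps_closed[OF g] linear_maps_closed[OF k] d_closed[of x i] by auto
    have "h \<oplus>\<^bsub>?G\<^esub> a = restrict (\<lambda>x. k (shifted_maps R d i x) \<oplus>\<^bsub>M\<^esub> g (shifted_maps R d i x)) (?X i)"
      unfolding add by (rule restrict_ext) (simp add: ga kh)
    then show "h \<oplus>\<^bsub>?G\<^esub> a \<in> B"
      using cbI[OF linear_maps_plus_map[OF M k g]] by simp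
    let ?h = "restrict (\<lambda>x. k (shifted_maps R d i x) \<ominus>\<^bsub>M\<^esub> g (shifted_maps R d i x)) (?X i)"
    have "?h \<oplus>\<^bsub>?G\<^esub> a = h"
      unfolding add using h cl 
      by (intro extensionalityI[of _ "?X i"])
        (auto simp: B_def ga kh M.add_minus_cancel M.a_comm[of "_ \<ominus>\<^bsub>M\<^esub> _"])
    then show "\<exists>h'\<in>B. h' \<oplus>\<^bsub>?G\<^esub> a = h"
      using cbI[OF linear_maps_minus_map[OF M k g]] by blast
  qed
  moreover have "carrier ?G \<subseteq> B \<longleftrightarrow> cohomology_vanishes M i"
  proof
    assume *: "carrier ?G \<subseteq> B"
    show "cohomology_vanishes M i" unfolding cohomology_vanishes_def
    proof (intro allI impI)
      fix f assume f: "cocycle M i f"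
      let ?f = "restrict f (?X i)"
      have "?f \<in> linear_maps R (free_module R (b i)) M"
        using f linear_maps_cong[of "free_module R (b i)" ?f f R M] Fm by (simp add: cocycle_def)
      then have "?f \<in> carrier ?G"
        using f linear_maps_closed[OF dl] by (simp add: Z_def cocycle_def)
      with * have "coboundary M i ?f" by (auto simp: B_def)
      then show "coboundary M i f" by (simp add: coboundary_def)
    qed
  qed (auto simp: Z_def B_def cohomology_vanishes_def)
  ultimately show ?thesis by simp
qed


subsection \<open>Resolutions by iterated mapping cones\<close>

text \<open>The decomposition \<open>R^(b + c) = R^b \<oplus> R^c\<close> in coordinates.\<close>

definition glue :: "nat \<Rightarrow> nat \<Rightarrow> (nat \<Rightarrow> 'a) \<Rightarrow> (nat \<Rightarrow> 'a) \<Rightarrow> (nat \<Rightarrow> 'a)" where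
  "glue b c p q = (\<lambda>k\<in>{..<b + c}. if k < b then p k else q (k - b))"

definition left_part :: "nat \<Rightarrow> (nat \<Rightarrow> 'a) \<Rightarrow> (nat \<Rightarrow> 'a)" where
  "left_part b z = restrict z {..<b}"

definition right_part :: "nat \<Rightarrow> nat \<Rightarrow> (nat \<Rightarrow> 'a) \<Rightarrow> (nat \<Rightarrow> 'a)" where
  "right_part b c z = (\<lambda>k\<in>{..<c}. z (b + k))"

lemma glue_closed:
  "p \<in> carrier (free_module R b) \<Longrightarrow> q \<in> carrier (free_module R c) \<Longrightarrow>
   glue b c p q \<in> carrier (free_module R (b + c))"
  by (auto simp: glue_def free_module_simps PiE_def Pi_def)

lemma left_part_glue: "p \<in> carrier (free_module R b) \<Longrightarrow> left_part b (glue b c p q) = p"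
  by (auto simp: glue_def left_part_def free_module_simps PiE_def extensional_def fun_eq_iff)

lemma right_part_glue: "q \<in> carrier (free_module R c) \<Longrightarrow> right_part b c (glue b c p q) = q"
  by (auto simp: glue_def right_part_def free_module_simps PiE_def extensional_def fun_eq_iff)

lemma glue_parts:
  "z \<in> carrier (free_module R (b + c)) \<Longrightarrow> glue b c (left_part b z) (right_part b c z) = z"
  by (auto simp: glue_def left_part_def right_part_def free_module_simps PiE_def extensional_def fun_eq_iff)

lemma glue_zero:
  "glue b c \<zero>\<^bsub>free_module R b\<^esub> \<zero>\<^bsub>free_module R c\<^esub> = \<zero>\<^bsub>free_module R (b + c)\<^esub>"
  by (auto simp: glue_def free_module_simps fun_eq_iff)

lemma left_part_linear: "left_part b \<in> linear_maps R (free_module R (b + c)) (free_module R b)"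
  by (rule linear_mapsI) (auto simp: left_part_def free_module_simps PiE_def Pi_def intro!: restrict_ext)

lemma right_part_linear: "right_part b c \<in> linear_maps R (free_module R (b + c)) (free_module R c)"
  by (rule linear_mapsI) (auto simp: right_part_def free_module_simps PiE_def Pi_def intro!: restrict_ext)

lemma glue_linear:
  assumes f: "f \<in> linear_maps R M (free_module R b)" and g: "g \<in> linear_maps R M (free_module R c)"
  shows "(\<lambda>x. glue b c (f x) (g x)) \<in> linear_maps R M (free_module R (b + c))"
proof (rule linear_mapsI)
  show "glue b c (f x) (g x) \<in> carrier (free_module R (b + c))" if "x \<in> carrier M" for x
    by (intro glue_closed linear_maps_closed[OF f that] linear_maps_closed[OF g that])
  show "glue b c (f (x \<oplus>\<^bsub>M\<^esub> y)) (g (x \<oplus>\<^bsub>M\<^esub> y)) =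
      glue b c (f x) (g x) \<oplus>\<^bsub>free_module R (b + c)\<^esub> glue b c (f y) (g y)"
    if "x \<in> carrier M" "y \<in> carrier M" for x y
    unfolding linear_maps_add[OF f that] linear_maps_add[OF g that]
    by (auto simp: glue_def free_module_simps intro!: restrict_ext)
  show "glue b c (f (a \<odot>\<^bsub>M\<^esub> x)) (g (a \<odot>\<^bsub>M\<^esub> x)) = a \<odot>\<^bsub>free_module R (b + c)\<^esub> glue b c (f x) (g x)"
    if "a \<in> carrier R" "x \<in> carrier M" for a x
    unfolding linear_maps_smult[OF f that] linear_maps_smult[OF g that]
    by (auto simp: glue_def free_module_simps intro!: restrict_ext)
qed

text \<open>If \<open>F\<close> resolves \<open>N\<close> and \<open>r\<close> is \<open>N\<close>-regular, then the mapping cone of multiplication by \<open>r\<close>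
  on \<open>F\<close>, with terms \<open>F\<^sub>i \<oplus> F\<^sub>i\<^sub>-\<^sub>1\<close> and differential \<open>(p, q) \<mapsto> (d p + r q, - d q)\<close>, resolves \<open>N/rN\<close>.\<close>

definition cone_ranks :: "(nat \<Rightarrow> nat) \<Rightarrow> nat \<Rightarrow> nat" where
  "cone_ranks b i = (case i of 0 \<Rightarrow> 0 | Suc j \<Rightarrow> b (Suc j) + b j)"

definition cone_maps ::
  "('a, 'm) ring_scheme \<Rightarrow> (nat \<Rightarrow> nat) \<Rightarrow> (nat \<Rightarrow> (nat \<Rightarrow> 'a) \<Rightarrow> (nat \<Rightarrow> 'a)) \<Rightarrow> 'a
     \<Rightarrow> nat \<Rightarrow> (nat \<Rightarrow> 'a) \<Rightarrow> (nat \<Rightarrow> 'a)"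
  where
  "cone_maps R b d r i = (case i of 0 \<Rightarrow> (\<lambda>_. \<zero>\<^bsub>free_module R 0\<^esub>)
     | Suc j \<Rightarrow> (\<lambda>z. let p = left_part (b (Suc i)) z; q = right_part (b (Suc i)) (b i) z in
         glue (b i) (b j) (d i p \<oplus>\<^bsub>free_module R (b i)\<^esub> r \<odot>\<^bsub>free_module R (b i)\<^esub> q)
           (\<ominus>\<^bsub>free_module R (b j)\<^esub> d j q)))"

lemma cone_simps [simp]:
  "cone_ranks b 0 = 0" "cone_ranks b (Suc i) = b (Suc i) + b i"
  by (simp_all add: cone_ranks_def)

lemma (in augmented_free_complex) cone_augmented:
  assumes ses: "short_exact R N N C (\<lambda>x. r \<odot>\<^bsub>N\<^esub> x) \<beta>" and r: "r \<in> carrier R"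
  shows "augmented_free_complex R (cone_ranks b) (cone_maps R b d r) C (\<lambda>x. \<beta> (\<epsilon> x))"
proof -
  note C_module = ses_modules(3)[OF ses] and \<beta> = ses_linear(2)[OF ses]
  interpret N: module R N by (rule N_module)
  interpret C: module R C by (rule C_module)
  let ?G = "\<lambda>i. free_module R (cone_ranks b i)" and ?D = "cone_maps R b d r"
  have Fm: "module R (free_module R j)" for j by (rule free_module_module)
  have sc: "(\<lambda>x. r \<odot>\<^bsub>F i\<^esub> x) \<in> linear_maps R (F i) (F i)" for i
    by (rule linear_maps_scaling[OF Fm r])
  have neg: "(\<lambda>x. \<ominus>\<^bsub>F i\<^esub> d i x) \<in> linear_maps R (F (Suc i)) (F i)" for i
  proof -
    interpret F: module R "F i" by (rule Fm)
    have "(\<lambda>x. \<zero>\<^bsub>F i\<^esub> \<ominus>\<^bsub>F i\<^esub> d i x) \<in> linear_maps R (F (Suc i)) (F i)"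
      by (intro linear_maps_minus_map Fm linear_maps_zero_map d_linear)
    then show ?thesis
      using linear_maps_cong[of "F (Suc i)" "\<lambda>x. \<zero>\<^bsub>F i\<^esub> \<ominus>\<^bsub>F i\<^esub> d i x" "\<lambda>x. \<ominus>\<^bsub>F i\<^esub> d i x" R "F i"] d_closed Fm
      by (simp add: a_minus_def)
  qed
  define A where "A i p q = d (Suc i) p \<oplus>\<^bsub>F (Suc i)\<^esub> r \<odot>\<^bsub>F (Suc i)\<^esub> q" for i p q
  define B where "B i q = \<ominus>\<^bsub>F i\<^esub> d i q" for i q
  have D: "?D (Suc i) z = glue (b (Suc i)) (b i)
      (A i (left_part (b (Suc (Suc i))) z) (right_part (b (Suc (Suc i))) (b (Suc i)) z))
      (B i (right_part (b (Suc (Suc i))) (b (Suc i)) z))" for i z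
    by (simp add: cone_maps_def A_def B_def Let_def)
  have Acl: "A i p q \<in> carrier (F (Suc i))"
    if "p \<in> carrier (F (Suc (Suc i)))" "q \<in> carrier (F (Suc i))" for i p q
  proof -
    interpret F: module R "F (Suc i)" by (rule Fm)
    show "A i p q \<in> carrier (F (Suc i))" using that d_closed r by (simp add: A_def)
  qed
  have Bcl: "B i q \<in> carrier (F i)" if "q \<in> carrier (F (Suc i))" for i q
    using linear_maps_closed[OF neg that] by (simp add: B_def)
  have D_glue: "?D (Suc i) (glue (b (Suc (Suc i))) (b (Suc i)) p q) = glue (b (Suc i)) (b i) (A i p q) (B i q)"
    if "p \<in> carrier (F (Suc (Suc i)))" "q \<in> carrier (F (Suc i))" for i p q
    unfolding D left_part_glue[OF that(1)] right_part_glue[OF that(2)] ..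
  have elim: "\<exists>p\<in>carrier (F (Suc i)). \<exists>q\<in>carrier (F i). z = glue (b (Suc i)) (b i) p q"
    if "z \<in> carrier (?G (Suc i))" for i z
  proof (intro bexI)
    show "z = glue (b (Suc i)) (b i) (left_part (b (Suc i)) z) (right_part (b (Suc i)) (b i) z)"
      using glue_parts[of z R "b (Suc i)" "b i"] that by simp
    show "right_part (b (Suc i)) (b i) z \<in> carrier (F i)"
      using linear_maps_closed[OF right_part_linear, of z R "b (Suc i)" "b i"] that by simp
    show "left_part (b (Suc i)) z \<in> carrier (F (Suc i))"
      using linear_maps_closed[OF left_part_linear, of z R "b (Suc i)" "b i"] that by simp
  qed
  have glue0: "glue (b (Suc i)) (b i) p q = \<zero>\<^bsub>?G (Suc i)\<^esub> \<longleftrightarrow> p = \<zero>\<^bsub>F (Suc i)\<^esub> \<and> q = \<zero>\<^bsub>F i\<^esub>"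
    if "p \<in> carrier (F (Suc i))" "q \<in> carrier (F i)" for i p q
  proof -
    interpret F: module R "F i" by (rule Fm)
    interpret F': module R "F (Suc i)" by (rule Fm)
    have z: "glue (b (Suc i)) (b i) \<zero>\<^bsub>F (Suc i)\<^esub> \<zero>\<^bsub>F i\<^esub> = \<zero>\<^bsub>?G (Suc i)\<^esub>"
      by (simp add: glue_zero)
    show ?thesis
    proof
      assume "glue (b (Suc i)) (b i) p q = \<zero>\<^bsub>?G (Suc i)\<^esub>"
      then have *: "glue (b (Suc i)) (b i) p q = glue (b (Suc i)) (b i) \<zero>\<^bsub>F (Suc i)\<^esub> \<zero>\<^bsub>F i\<^esub>"
        by (simp only: z)
      show "p = \<zero>\<^bsub>F (Suc i)\<^esub> \<and> q = \<zero>\<^bsub>F i\<^esub>"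
        using arg_cong[OF *, of "left_part (b (Suc i))"] arg_cong[OF *, of "right_part (b (Suc i)) (b i)"]
        unfolding left_part_glue[OF that(1)] left_part_glue[OF F'.M.zero_closed]
          right_part_glue[OF that(2)] right_part_glue[OF F.M.zero_closed]
        by (rule conjI)
    qed (simp only: z)
  qed
  have B0: "B i q = \<zero>\<^bsub>F i\<^esub> \<longleftrightarrow> d i q = \<zero>\<^bsub>F i\<^esub>" if "q \<in> carrier (F (Suc i))" for i q
  proof -
    interpret F: module R "F i" by (rule Fm)
    show ?thesis unfolding B_def using d_closed[OF that] by (simp add: F.M.add.inv_eq_1_iff)
  qed
  have dA: "d i (A i p q) = r \<odot>\<^bsub>F i\<^esub> d i q"
    if "p \<in> carrier (F (Suc (Suc i)))" "q \<in> carrier (F (Suc i))" for i p q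
  proof -
    interpret F: module R "F i" by (rule Fm)
    interpret F': module R "F (Suc i)" by (rule Fm)
    show ?thesis unfolding A_def using that d_closed r
      by (simp add: linear_maps_add[OF d_linear] linear_maps_smult[OF d_linear] d_d)
  qed
  have AB: "A i (A (Suc i) p q) (B (Suc i) q) = \<zero>\<^bsub>F (Suc i)\<^esub>"
    if "p \<in> carrier (F (Suc (Suc (Suc i))))" "q \<in> carrier (F (Suc (Suc i)))" for i p q
  proof -
    interpret F': module R "F (Suc i)" by (rule Fm)
    show "A i (A (Suc i) p q) (B (Suc i) q) = \<zero>\<^bsub>F (Suc i)\<^esub>"
      unfolding A_def[of i] dA[OF that] B_def using d_closed[OF that(2)] r
      by (simp add: F'.smult_r_minus F'.r_neg)
  qed
  have dB: "d i (B (Suc i) q) = \<zero>\<^bsub>F i\<^esub>" if "q \<in> carrier (F (Suc (Suc i)))" for i q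
  proof -
    interpret F: module R "F i" by (rule Fm)
    have "d i (\<ominus>\<^bsub>F (Suc i)\<^esub> d (Suc i) q) = \<ominus>\<^bsub>F i\<^esub> d i (d (Suc i) q)"
      using abelian_group_hom.hom_a_inv[OF linear_maps_group_hom[OF Fm Fm d_linear]] d_closed[OF that] by simp
    then show "d i (B (Suc i) q) = \<zero>\<^bsub>F i\<^esub>" unfolding B_def using that by (simp add: d_d)
  qed
  have exact: "?D (Suc i) ` carrier (?G (Suc (Suc i))) = {z \<in> carrier (?G (Suc i)). P z}"
    if P: "\<And>p q. p \<in> carrier (F (Suc i)) \<Longrightarrow> q \<in> carrier (F i) \<Longrightarrow>
        P (glue (b (Suc i)) (b i) p q) \<longleftrightarrow>
        (\<exists>t\<in>carrier (F (Suc i)). q = B i t \<and> (\<exists>u\<in>carrier (F (Suc (Suc i))). p = A i u t))" for i P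
  proof (intro equalityI subsetI)
    fix z assume "z \<in> ?D (Suc i) ` carrier (?G (Suc (Suc i)))"
    then obtain u t where ut: "u \<in> carrier (F (Suc (Suc i)))" "t \<in> carrier (F (Suc i))"
      "z = glue (b (Suc i)) (b i) (A i u t) (B i t)"
      using elim[of _ "Suc i"] D_glue by force
    then show "z \<in> {z \<in> carrier (?G (Suc i)). P z}"
      using P[OF Acl[OF ut(1,2)] Bcl[OF ut(2)]] glue_closed[OF Acl[OF ut(1,2)] Bcl[OF ut(2)]] by auto
  next
    fix z assume z: "z \<in> {z \<in> carrier (?G (Suc i)). P z}"
    then obtain p q where pq: "p \<in> carrier (F (Suc i))" "q \<in> carrier (F i)" "z = glue (b (Suc i)) (b i) p q"
      using elim by blast
    then obtain t u where "t \<in> carrier (F (Suc i))" "q = B i t" "u \<in> carrier (F (Suc (Suc i)))" "p = A i u t"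
      using z P[OF pq(1,2)] by blast
    then show "z \<in> ?D (Suc i) ` carrier (?G (Suc (Suc i)))"
      using D_glue[of u i t] glue_closed[of u R "b (Suc (Suc i))" t "b (Suc i)"] pq(3) by (metis cone_simps(2) image_eqI)
  qed
  \<comment> \<open>The boundaries with given second component are found by solving for \<open>u\<close> in the first.\<close>
  have eqA: "(\<exists>u\<in>carrier (F (Suc (Suc i))). p = A i u t) \<longleftrightarrow>
      p \<ominus>\<^bsub>F (Suc i)\<^esub> r \<odot>\<^bsub>F (Suc i)\<^esub> t \<in> d (Suc i) ` carrier (F (Suc (Suc i)))"
    if "p \<in> carrier (F (Suc i))" "t \<in> carrier (F (Suc i))" for i p t
  proof -
    interpret F: module R "F (Suc i)" by (rule Fm)
    have "p = A i u t \<longleftrightarrow> p \<ominus>\<^bsub>F (Suc i)\<^esub> r \<odot>\<^bsub>F (Suc i)\<^esub> t = d (Suc i) u"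
      if "u \<in> carrier (F (Suc (Suc i)))" for u
      unfolding A_def a_minus_def using that \<open>p \<in> _\<close> \<open>t \<in> _\<close> d_closed[OF that] r
      by (metis F.M.add.inv_solve_right' F.smult_closed)
    then show ?thesis by auto
  qed
  show ?thesis
  proof unfold_locales
    show "?D i \<in> linear_maps R (?G (Suc i)) (?G i)" for i
    proof (cases i)
      case 0 then show ?thesis using linear_maps_zero_map[OF Fm] by (simp add: cone_maps_def)
    next
      case (Suc j)
      have "(\<lambda>z. glue (b (Suc j)) (b j)
        (d (Suc j) (left_part (b (Suc (Suc j))) z) \<oplus>\<^bsub>F (Suc j)\<^esub>
           r \<odot>\<^bsub>F (Suc j)\<^esub> (right_part (b (Suc (Suc j))) (b (Suc j)) z))
        (\<ominus>\<^bsub>F j\<^esub> d j (right_part (b (Suc (Suc j))) (b (Suc j)) z)))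
        \<in> linear_maps R (free_module R (b (Suc (Suc j)) + b (Suc j))) (free_module R (b (Suc j) + b j))"
        by (intro glue_linear linear_maps_plus_map Fm
            linear_maps_comp[OF left_part_linear d_linear] linear_maps_comp[OF right_part_linear sc]
            linear_maps_comp[OF right_part_linear neg])
      then show ?thesis by (simp add: Suc cone_maps_def Let_def)
    qed
    show "?D i (?D (Suc i) x) = \<zero>\<^bsub>?G i\<^esub>" if xc: "x \<in> carrier (?G (Suc (Suc i)))" for i x
    proof (cases i)
      case 0 then show ?thesis by (simp add: cone_maps_def)
    next
      case (Suc j)
      obtain p q where pq: "p \<in> carrier (F (Suc (Suc (Suc j))))" "q \<in> carrier (F (Suc (Suc j)))"
        and x: "x = glue (b (Suc (Suc (Suc j)))) (b (Suc (Suc j))) p q"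
        using elim[OF xc[unfolded Suc]] by metis
      have "?D i (?D (Suc i) x) = glue (b (Suc j)) (b j) (A j (A (Suc j) p q) (B (Suc j) q)) (B j (B (Suc j) q))"
        using pq Acl[OF pq] Bcl[OF pq(2)] by (simp only: x Suc D_glue)
      also have "\<dots> = \<zero>\<^bsub>?G i\<^esub>"
        using AB[OF pq] dB[OF pq(2)] B0[OF Bcl[OF pq(2)]] glue_zero[of "b (Suc j)" "b j" R] by (simp add: Suc)
      finally show ?thesis .
    qed
    show "(\<lambda>x. \<beta> (\<epsilon> x)) \<in> linear_maps R (?G 1) C"
      using linear_maps_comp[OF \<epsilon>_linear \<beta>] by (simp add: b_0)
    show "(\<lambda>x. \<beta> (\<epsilon> x)) ` carrier (?G 1) = carrier C"
      using \<epsilon>_surj ses_surj[OF ses] b_0 by (simp add: image_image[symmetric])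
    have \<epsilon>d: "\<epsilon> (d (Suc 0) u) = \<zero>\<^bsub>N\<^esub>" if "u \<in> carrier (F (Suc (Suc 0)))" for u
      using \<epsilon>_exact that by (auto simp: numeral_2_eq_2)
    interpret F1: module R "F (Suc 0)" by (rule Fm)
    have cl: "\<epsilon> p \<in> carrier N" if "p \<in> carrier (F (Suc 0))" for p
      using linear_maps_closed[OF \<epsilon>_linear] that by simp
    have *: "?D (Suc 0) ` carrier (?G (Suc (Suc 0))) = {z \<in> carrier (?G (Suc 0)). \<beta> (\<epsilon> z) = \<zero>\<^bsub>C\<^esub>}"
    proof (rule exact)
      fix p q assume p: "p \<in> carrier (F (Suc 0))" and q: "q \<in> carrier (F 0)"
      have jp: "glue (b (Suc 0)) (b 0) p q = p"
        using p by (auto simp: b_0 glue_def free_module_simps PiE_def extensional_def fun_eq_iff)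
      have Bq: "B 0 t = q" if "t \<in> carrier (F (Suc 0))" for t
        using Bcl[OF that] q by (auto simp: b_0 free_module_simps)
      have "\<beta> (\<epsilon> p) = \<zero>\<^bsub>C\<^esub> \<longleftrightarrow> \<epsilon> p \<in> (\<lambda>x. r \<odot>\<^bsub>N\<^esub> x) ` carrier N"
        using ses_exact[OF ses] cl[OF p] by blast
      also have "\<dots> \<longleftrightarrow> (\<exists>t\<in>carrier (F (Suc 0)). \<epsilon> p = r \<odot>\<^bsub>N\<^esub> \<epsilon> t)"
        by (simp add: \<epsilon>_surj[symmetric] image_image image_iff)
      also have "\<dots> \<longleftrightarrow> (\<exists>t\<in>carrier (F (Suc 0)). \<epsilon> (p \<ominus>\<^bsub>F (Suc 0)\<^esub> r \<odot>\<^bsub>F (Suc 0)\<^esub> t) = \<zero>\<^bsub>N\<^esub>)"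
      proof (intro bex_cong refl)
        fix t assume t: "t \<in> carrier (F (Suc 0))"
        have "\<epsilon> (p \<ominus>\<^bsub>F (Suc 0)\<^esub> r \<odot>\<^bsub>F (Suc 0)\<^esub> t) = \<epsilon> p \<ominus>\<^bsub>N\<^esub> r \<odot>\<^bsub>N\<^esub> \<epsilon> t"
          using linear_maps_minus[OF Fm N_module \<epsilon>_linear, of p "r \<odot>\<^bsub>F (Suc 0)\<^esub> t"]
            linear_maps_smult[OF \<epsilon>_linear r, of t] p t r by simp
        then show "\<epsilon> p = r \<odot>\<^bsub>N\<^esub> \<epsilon> t \<longleftrightarrow> \<epsilon> (p \<ominus>\<^bsub>F (Suc 0)\<^esub> r \<odot>\<^bsub>F (Suc 0)\<^esub> t) = \<zero>\<^bsub>N\<^esub>"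
          using cl[OF p] cl[OF t] r by (metis N.M.add_minus_cancel N.M.r_zero N.M.r_neg N.smult_closed a_minus_def)
      qed
      also have "\<dots> \<longleftrightarrow> (\<exists>t\<in>carrier (F (Suc 0)). p \<ominus>\<^bsub>F (Suc 0)\<^esub> r \<odot>\<^bsub>F (Suc 0)\<^esub> t \<in> d (Suc 0) ` carrier (F (Suc (Suc 0))))"
        using \<epsilon>_exact p r by (intro bex_cong refl) (simp add: numeral_2_eq_2)
      finally show "\<beta> (\<epsilon> (glue (b (Suc 0)) (b 0) p q)) = \<zero>\<^bsub>C\<^esub> \<longleftrightarrow>
        (\<exists>t\<in>carrier (F (Suc 0)). q = B 0 t \<and> (\<exists>u\<in>carrier (F (Suc (Suc 0))). p = A 0 u t))"
        unfolding jp using eqA[OF p] Bq by auto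
    qed
    then show "?D 1 ` carrier (?G 2) = {x \<in> carrier (?G 1). \<beta> (\<epsilon> x) = \<zero>\<^bsub>C\<^esub>}"
      by (simp add: numeral_2_eq_2)
    show "?D (Suc (Suc i)) ` carrier (?G (Suc (Suc (Suc i)))) =
       {x \<in> carrier (?G (Suc (Suc i))). ?D (Suc i) x = \<zero>\<^bsub>?G (Suc i)\<^esub>}" for i
    proof (rule exact)
      let ?i = "Suc i"
      fix p q assume p: "p \<in> carrier (F (Suc ?i))" and q: "q \<in> carrier (F ?i)"
      interpret F: module R "F (Suc i)" by (rule Fm)
      interpret F': module R "F (Suc ?i)" by (rule Fm)
      have *: "d ?i (p \<ominus>\<^bsub>F (Suc ?i)\<^esub> r \<odot>\<^bsub>F (Suc ?i)\<^esub> t) = A i p (B ?i t)"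
        if t: "t \<in> carrier (F (Suc ?i))" for t
        using p t r d_closed[OF p] d_closed[OF t]
        by (simp add: linear_maps_minus[OF Fm Fm d_linear] linear_maps_smult[OF d_linear] A_def B_def
            a_minus_def[of "F ?i"] F.smult_r_minus)
      have im_B: "\<exists>t\<in>carrier (F (Suc ?i)). q = B ?i t" if qd: "q \<in> d ?i ` carrier (F (Suc ?i))"
      proof -
        obtain t where t: "t \<in> carrier (F (Suc ?i))" "q = d ?i t" using qd by (rule imageE)
        have "B ?i (\<ominus>\<^bsub>F (Suc ?i)\<^esub> t) = q"
          unfolding B_def
          using abelian_group_hom.hom_a_inv[OF linear_maps_group_hom[OF Fm Fm d_linear] t(1)] d_closed[OF t(1)] t(2)
          by simp
        then show ?thesis using t(1) by (intro bexI[of _ "\<ominus>\<^bsub>F (Suc ?i)\<^esub> t"]) auto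
      qed
      \<comment> \<open>In the lowest degree the condition \<open>d q = 0\<close> is void; there \<open>d p + r q = 0\<close> gives \<open>r \<epsilon>(q) = 0\<close>,
        and regularity of \<open>r\<close> on \<open>N\<close> makes \<open>q\<close> a boundary.\<close>
      have boundary: "q \<in> d ?i ` carrier (F (Suc ?i))" if A0: "A i p q = \<zero>\<^bsub>F (Suc i)\<^esub>" and "d i q = \<zero>\<^bsub>F i\<^esub>"
      proof (cases i)
        case 0
        have q': "q \<in> carrier (F (Suc 0))" and p': "p \<in> carrier (F (Suc (Suc 0)))" using p q 0 by auto
        have "r \<odot>\<^bsub>N\<^esub> \<epsilon> q = \<epsilon> (d (Suc 0) p) \<oplus>\<^bsub>N\<^esub> \<epsilon> (r \<odot>\<^bsub>F (Suc 0)\<^esub> q)"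
          using linear_maps_smult[OF \<epsilon>_linear r, of q] \<epsilon>d[OF p'] q' cl[OF q'] r by simp
        also have "\<dots> = \<epsilon> (A 0 p q)"
          unfolding A_def using linear_maps_add[OF \<epsilon>_linear, of "d (Suc 0) p" "r \<odot>\<^bsub>F (Suc 0)\<^esub> q"]
            q' r d_closed[OF p'] by simp
        also have "\<dots> = r \<odot>\<^bsub>N\<^esub> \<zero>\<^bsub>N\<^esub>"
          using linear_maps_zero[OF Fm N_module \<epsilon>_linear] A0 r 0 by simp
        finally have "\<epsilon> q = \<zero>\<^bsub>N\<^esub>"
          using inj_onD[OF ses_inj[OF ses]] cl[OF q'] by blast
        then show ?thesis using \<epsilon>_exact q' 0 by (simp add: numeral_2_eq_2)
      next
        case (Suc j)
        then show ?thesis using d_exact[of j] q that(2) by simp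
      qed
      have "?D (Suc i) (glue (b (Suc ?i)) (b ?i) p q) = \<zero>\<^bsub>?G (Suc i)\<^esub> \<longleftrightarrow>
          A i p q = \<zero>\<^bsub>F (Suc i)\<^esub> \<and> d i q = \<zero>\<^bsub>F i\<^esub>"
        unfolding D_glue[OF p q] glue0[OF Acl[OF p q] Bcl[OF q]] B0[OF q] ..
      also have "\<dots> \<longleftrightarrow> A i p q = \<zero>\<^bsub>F (Suc i)\<^esub> \<and> (\<exists>t\<in>carrier (F (Suc ?i)). q = B ?i t)"
        using boundary im_B dB by (intro conj_cong refl iffI) auto
      also have "\<dots> \<longleftrightarrow> (\<exists>t\<in>carrier (F (Suc ?i)). q = B ?i t \<and> A i p (B ?i t) = \<zero>\<^bsub>F (Suc i)\<^esub>)"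
        by blast
      also have "\<dots> \<longleftrightarrow> (\<exists>t\<in>carrier (F (Suc ?i)). q = B ?i t \<and>
          p \<ominus>\<^bsub>F (Suc ?i)\<^esub> r \<odot>\<^bsub>F (Suc ?i)\<^esub> t \<in> d (Suc ?i) ` carrier (F (Suc (Suc ?i))))"
        using d_exact[of i] p r * by (intro bex_cong refl) (auto simp del: )
      finally show "?D (Suc i) (glue (b (Suc ?i)) (b ?i) p q) = \<zero>\<^bsub>?G (Suc i)\<^esub> \<longleftrightarrow>
          (\<exists>t\<in>carrier (F (Suc ?i)). q = B ?i t \<and> (\<exists>u\<in>carrier (F (Suc (Suc ?i))). p = A ?i u t))"
        using eqA[OF p] by (simp cong: bex_cong)
    qed
  qed (use C_module in \<open>auto simp: module_def\<close>)
qed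


lemma free_module_0_trivial: "x \<in> carrier (free_module R 0) \<Longrightarrow> x = \<zero>\<^bsub>free_module R 0\<^esub>"
  by (simp add: free_module_simps restrict_def)

text \<open>A free module of rank one is its own resolution; this starts the iteration of cones.\<close>

lemma (in cring) free_rank_one_augmented:
  assumes N: "module R N" and \<epsilon>: "\<epsilon> \<in> linear_maps R (free_module R 1) N"
    and inj: "inj_on \<epsilon> (carrier (free_module R 1))" and surj: "\<epsilon> ` carrier (free_module R 1) = carrier N"
  shows "augmented_free_complex R (\<lambda>i. if i = 1 then 1 else 0)
    (\<lambda>i _. \<zero>\<^bsub>free_module R (if i = 1 then 1 else 0)\<^esub>) N \<epsilon>"
proof -
  have Fm: "module R (free_module R j)" for j by (rule free_module_module)
  interpret N: module R N by (rule N)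
  interpret F1: module R "free_module R 1" by (rule Fm)
  interpret F0: module R "free_module R 0" by (rule Fm)
  have e0: "\<epsilon> \<zero>\<^bsub>free_module R 1\<^esub> = \<zero>\<^bsub>N\<^esub>" by (rule linear_maps_zero[OF Fm N \<epsilon>])
  have ker: "{x \<in> carrier (free_module R 1). \<epsilon> x = \<zero>\<^bsub>N\<^esub>} = {\<zero>\<^bsub>free_module R 1\<^esub>}"
  proof (intro equalityI subsetI)
    fix x assume "x \<in> {x \<in> carrier (free_module R 1). \<epsilon> x = \<zero>\<^bsub>N\<^esub>}"
    then have "x \<in> carrier (free_module R 1)" "\<epsilon> x = \<epsilon> \<zero>\<^bsub>free_module R 1\<^esub>" unfolding e0 by auto
    then show "x \<in> {\<zero>\<^bsub>free_module R 1\<^esub>}" using inj_onD[OF inj] F1.M.zero_closed by blast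
  qed (use e0 F1.M.zero_closed in simp)
  have c0: "carrier (free_module R 0) = {\<zero>\<^bsub>free_module R 0\<^esub>}"
    using free_module_0_trivial F0.M.zero_closed by blast
  let ?b = "\<lambda>i::nat. if i = 1 then 1 else 0 :: nat"
  have F: "?b 1 = 1" "?b 2 = 0" "?b 0 = 0" "?b (Suc (Suc i)) = 0" for i by simp_all
  show ?thesis
  proof (unfold_locales, unfold F)
    show "(\<lambda>_. \<zero>\<^bsub>free_module R 1\<^esub>) ` carrier (free_module R 0) = {x \<in> carrier (free_module R 1). \<epsilon> x = \<zero>\<^bsub>N\<^esub>}"
      by (simp only: ker c0 image_insert image_empty)
    show "(\<lambda>_. \<zero>\<^bsub>free_module R 0\<^esub>) ` carrier (free_module R 0) =
        {x \<in> carrier (free_module R 0). \<zero>\<^bsub>free_module R (?b (Suc i))\<^esub> = \<zero>\<^bsub>free_module R (?b (Suc i))\<^esub>}" for i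
      by (simp only: c0 image_insert image_empty) blast
  qed (use \<epsilon> surj in \<open>simp_all only: linear_maps_zero_map[OF Fm]\<close>)
qed

lemma augmented_free_complex_iso:
  assumes "augmented_free_complex R b d N \<epsilon>" and N': "module R N'"
    and \<phi>: "\<phi> \<in> linear_maps R N N'" "inj_on \<phi> (carrier N)" "\<phi> ` carrier N = carrier N'"
  shows "augmented_free_complex R b d N' (\<lambda>x. \<phi> (\<epsilon> x))"
proof -
  interpret augmented_free_complex R b d N \<epsilon> by fact
  interpret N: module R N by (rule N_module)
  interpret N': module R N' by fact
  have eq: "\<phi> (\<epsilon> x) = \<zero>\<^bsub>N'\<^esub> \<longleftrightarrow> \<epsilon> x = \<zero>\<^bsub>N\<^esub>" if "x \<in> carrier (F 1)" for x
    using inj_on_eq_iff[OF \<phi>(2) linear_maps_closed[OF \<epsilon>_linear that] N.M.zero_closed]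
    unfolding linear_maps_zero[OF N_module N' \<phi>(1)] .
  show ?thesis
  proof unfold_locales
    show "(\<lambda>x. \<phi> (\<epsilon> x)) \<in> linear_maps R (F 1) N'" by (rule linear_maps_comp[OF \<epsilon>_linear \<phi>(1)])
    show "(\<lambda>x. \<phi> (\<epsilon> x)) ` carrier (F 1) = carrier N'"
      using \<epsilon>_surj \<phi>(3) by (simp add: image_image[symmetric])
    show "d 1 ` carrier (F 2) = {x \<in> carrier (F 1). \<phi> (\<epsilon> x) = \<zero>\<^bsub>N'\<^esub>}"
      using eq unfolding \<epsilon>_exact by auto
    show "d (Suc (Suc i)) ` carrier (F (Suc (Suc (Suc i)))) =
       {x \<in> carrier (F (Suc (Suc i))). d (Suc i) x = \<zero>\<^bsub>F (Suc i)\<^esub>}" for i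
      by (rule d_exact)
  qed (rule b_0)
qed

lemma augmented_free_complex_resolution:
  assumes "augmented_free_complex R b d N \<epsilon>"
  shows "\<exists>res. free_resolution R N res"
proof -
  interpret augmented_free_complex R b d N \<epsilon> by fact
  define b' where "b' i = b (Suc i)" for i
  define d' where "d' i = restrict (d (Suc i)) (carrier (F (Suc (Suc i))))" for i
  define \<epsilon>' where "\<epsilon>' = restrict \<epsilon> (carrier (F 1))"
  have "\<epsilon>' \<in> module_hom R (F 1) N" unfolding \<epsilon>'_def
    by (rule restrict_module_hom[OF F_module \<epsilon>_linear])
  moreover have "d' i \<in> module_hom R (F (Suc (Suc i))) (F (Suc i))" for i unfolding d'_def
    by (rule restrict_module_hom[OF F_module d_linear])
  moreover have "\<epsilon>' ` carrier (F 1) = carrier N" using \<epsilon>_surj by (simp add: \<epsilon>'_def)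
  moreover have "d' 0 ` carrier (F 2) = {x \<in> carrier (F 1). \<epsilon>' x = \<zero>\<^bsub>N\<^esub>}"
  proof -
    have "d' 0 ` carrier (F 2) = d 1 ` carrier (F 2)" by (simp add: d'_def numeral_2_eq_2)
    also note \<epsilon>_exact
    finally show ?thesis by (auto simp: \<epsilon>'_def)
  qed
  moreover have "d' (Suc i) ` carrier (F (Suc (Suc (Suc i)))) =
      {x \<in> carrier (F (Suc (Suc i))). d' i x = \<zero>\<^bsub>F (Suc i)\<^esub>}" for i
    using d_exact[of i] by (auto simp: d'_def)
  ultimately have "free_resolution R N (b', d', \<epsilon>')"
    by (simp add: free_resolution_def a_kernel_eq b'_def numeral_2_eq_2)
  then show ?thesis ..
qed


section \<open>Quotients by ideals\<close>

context cring
begin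

lemma quot_module_simps:
  assumes "ideal I R"
  shows "carrier (quot_module R I) = (\<lambda>p. I +> p) ` carrier R"
    and "\<zero>\<^bsub>quot_module R I\<^esub> = I"
    and "p \<in> carrier R \<Longrightarrow> q \<in> carrier R \<Longrightarrow> (I +> p) \<oplus>\<^bsub>quot_module R I\<^esub> (I +> q) = I +> (p \<oplus> q)"
    and "r \<in> carrier R \<Longrightarrow> p \<in> carrier R \<Longrightarrow> r \<odot>\<^bsub>quot_module R I\<^esub> (I +> p) = I +> (r \<otimes> p)"
proof -
  interpret ideal I R by fact
  show "carrier (quot_module R I) = (\<lambda>p. I +> p) ` carrier R"
    by (auto simp: quot_module_def FactRing_def A_RCOSETS_def')
  show "\<zero>\<^bsub>quot_module R I\<^esub> = I"
    by (simp add: quot_module_def FactRing_def)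
  show "p \<in> carrier R \<Longrightarrow> q \<in> carrier R \<Longrightarrow> (I +> p) \<oplus>\<^bsub>quot_module R I\<^esub> (I +> q) = I +> (p \<oplus> q)"
    by (simp add: quot_module_def FactRing_def a_rcos_sum)
  show "r \<in> carrier R \<Longrightarrow> p \<in> carrier R \<Longrightarrow> r \<odot>\<^bsub>quot_module R I\<^esub> (I +> p) = I +> (r \<otimes> p)"
    by (simp add: quot_module_def FactRing_def rcoset_mult_add)
qed

lemma quot_module_module:
  assumes "ideal I R"
  shows "module R (quot_module R I)"
proof (rule moduleI)
  interpret ideal I R by fact
  interpret Q: ring "R Quot I" by (rule quotient_is_ring)
  show "cring R" by (rule is_cring)
  show "abelian_group (quot_module R I)"
    by (rule abelian_groupI)
      (use Q.abelian_group_axioms Q.a_assoc Q.a_comm Q.add.inv_closed Q.l_neg in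
        \<open>auto simp: quot_module_def intro: bexI[of _ "\<ominus>\<^bsub>R Quot I\<^esub> _"]\<close>)
qed (auto simp: quot_module_simps[OF assms] l_distr r_distr m_assoc)

lemma quot_module_eq_iff:
  assumes "ideal I R" "p \<in> carrier R" "q \<in> carrier R"
  shows "I +> p = I +> q \<longleftrightarrow> p \<ominus> q \<in> I"
  using quotient_eq_iff_same_a_r_cos[OF assms] by auto

lemma quot_module_zero_iff:
  assumes "ideal I R" "p \<in> carrier R"
  shows "I +> p = I \<longleftrightarrow> p \<in> I"
proof -
  interpret ideal I R by fact
  show ?thesis using assms(2) a_rcos_zero[OF assms(1)] rcos_const_imp_mem by blast
qed

text \<open>The universal property of \<open>R/I\<close>.\<close>

lemma quot_module_induced:
  assumes I: "ideal I R" and N: "module R N"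
    and h: "\<And>p. p \<in> carrier R \<Longrightarrow> h p \<in> carrier N"
      "\<And>p q. p \<in> carrier R \<Longrightarrow> q \<in> carrier R \<Longrightarrow> h (p \<oplus> q) = h p \<oplus>\<^bsub>N\<^esub> h q"
      "\<And>r p. r \<in> carrier R \<Longrightarrow> p \<in> carrier R \<Longrightarrow> h (r \<otimes> p) = r \<odot>\<^bsub>N\<^esub> h p"
    and I0: "\<And>p. p \<in> I \<Longrightarrow> h p = \<zero>\<^bsub>N\<^esub>"
  shows "\<exists>f\<in>linear_maps R (quot_module R I) N. \<forall>p\<in>carrier R. f (I +> p) = h p"
proof (intro bexI ballI)
  interpret I: ideal I R by fact
  interpret N: module R N by fact
  define f where "f C = h (SOME p. p \<in> carrier R \<and> C = I +> p)" for C
  show f: "f (I +> p) = h p" if p: "p \<in> carrier R" for p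
  proof -
    define q where "q = (SOME q. q \<in> carrier R \<and> I +> p = I +> q)"
    have q: "q \<in> carrier R" "I +> p = I +> q"
      using someI[of "\<lambda>q. q \<in> carrier R \<and> I +> p = I +> q" p] p unfolding q_def by auto
    then have pq: "p \<ominus> q \<in> I" using quot_module_eq_iff[OF I p] by simp
    have "p = (p \<ominus> q) \<oplus> q" using p q by (simp add: a_minus_def a_assoc l_neg)
    then have "h p = h (p \<ominus> q) \<oplus>\<^bsub>N\<^esub> h q" using h(2)[of "p \<ominus> q" q] p q by simp
    also have "\<dots> = h q" using I0[OF pq] h(1)[OF q(1)] by simp
    finally show ?thesis by (simp add: f_def q_def)
  qed
  show "f \<in> linear_maps R (quot_module R I) N"
    by (rule linear_mapsI) (auto simp: quot_module_simps[OF I] f h)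
qed

text \<open>The hypotheses on \<open>J\<close> say that \<open>J = I + (x)\<close>, so this is the sequence
  \<open>0 \<rightarrow> R/(I : x) \<rightarrow> R/I \<rightarrow> R/(I + (x)) \<rightarrow> 0\<close>. The formula for \<open>\<alpha>\<close> identifies it as multiplication by \<open>x\<close>.\<close>

lemma quot_module_colon_exact:
  assumes I: "ideal I R" and L: "ideal L R" and J: "ideal J R" and x: "x \<in> carrier R"
    and colon: "L = {p \<in> carrier R. x \<otimes> p \<in> I}"
    and IJ: "I \<subseteq> J" "x \<in> J" "\<And>p. p \<in> J \<Longrightarrow> \<exists>q\<in>carrier R. p \<ominus> x \<otimes> q \<in> I"
  obtains \<alpha> \<beta> where "short_exact R (quot_module R L) (quot_module R I) (quot_module R J) \<alpha> \<beta>"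
    "\<And>p. p \<in> carrier R \<Longrightarrow> \<alpha> (L +> p) = I +> (x \<otimes> p)"
proof -
  interpret I: ideal I R by fact
  interpret J: ideal J R by fact
  interpret L: ideal L R by fact
  note mods = quot_module_module[OF L] quot_module_module[OF I] quot_module_module[OF J]
  note simps = quot_module_simps[OF L] quot_module_simps[OF I] quot_module_simps[OF J]
  have colon': "p \<in> L \<longleftrightarrow> p \<in> carrier R \<and> x \<otimes> p \<in> I" for p using colon by blast
  have "\<exists>f\<in>linear_maps R (quot_module R L) (quot_module R I). \<forall>p\<in>carrier R. f (L +> p) = I +> (x \<otimes> p)"
    by (rule quot_module_induced[OF L mods(2)])
      (auto simp: simps x r_distr m_lcomm quot_module_zero_iff[OF I] colon')
  then obtain \<alpha> where \<alpha>: "\<alpha> \<in> linear_maps R (quot_module R L) (quot_module R I)"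
    "\<And>p. p \<in> carrier R \<Longrightarrow> \<alpha> (L +> p) = I +> (x \<otimes> p)" by metis
  have "\<exists>f\<in>linear_maps R (quot_module R I) (quot_module R J). \<forall>p\<in>carrier R. f (I +> p) = J +> p"
    by (rule quot_module_induced[OF I mods(3)])
      (use IJ(1) in \<open>auto simp: simps quot_module_zero_iff[OF J]\<close>)
  then obtain \<beta> where \<beta>: "\<beta> \<in> linear_maps R (quot_module R I) (quot_module R J)"
    "\<And>p. p \<in> carrier R \<Longrightarrow> \<beta> (I +> p) = J +> p" by metis
  have "inj_on \<alpha> (carrier (quot_module R L))"
  proof (rule inj_onI, unfold simps(1), elim imageE)
    fix C D p q assume *: "\<alpha> C = \<alpha> D" "C = L +> p" "p \<in> carrier R" "D = L +> q" "q \<in> carrier R"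
    then have "x \<otimes> p \<ominus> x \<otimes> q \<in> I" using \<alpha>(2) x by (simp add: quot_module_eq_iff[OF I])
    moreover have "x \<otimes> p \<ominus> x \<otimes> q = x \<otimes> (p \<ominus> q)" using * x by (simp add: a_minus_def r_distr r_minus)
    ultimately have "p \<ominus> q \<in> L" using * by (simp add: colon')
    then show "C = D" using * by (simp add: quot_module_eq_iff[OF L])
  qed
  moreover have "\<alpha> ` carrier (quot_module R L) = {C \<in> carrier (quot_module R I). \<beta> C = \<zero>\<^bsub>quot_module R J\<^esub>}"
  proof (intro equalityI subsetI)
    fix C assume "C \<in> \<alpha> ` carrier (quot_module R L)"
    then obtain p where p: "p \<in> carrier R" "C = I +> (x \<otimes> p)" using \<alpha>(2) by (auto simp: simps)
    moreover have "x \<otimes> p \<in> J" using IJ(2) p(1) by (simp add: J.I_r_closed)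
    ultimately show "C \<in> {C \<in> carrier (quot_module R I). \<beta> C = \<zero>\<^bsub>quot_module R J\<^esub>}"
      using x by (auto simp: simps \<beta>(2) quot_module_zero_iff[OF J])
  next
    fix C assume C: "C \<in> {C \<in> carrier (quot_module R I). \<beta> C = \<zero>\<^bsub>quot_module R J\<^esub>}"
    then obtain p where p: "p \<in> carrier R" "C = I +> p" unfolding simps by blast
    then have pJ: "p \<in> J" using C \<beta>(2) by (simp add: simps quot_module_zero_iff[OF J])
    obtain q where q: "q \<in> carrier R" "p \<ominus> x \<otimes> q \<in> I" using IJ(3)[OF pJ] by blast
    then have "C = \<alpha> (L +> q)" using p x by (simp add: \<alpha>(2) quot_module_eq_iff[OF I])
    then show "C \<in> \<alpha> ` carrier (quot_module R L)" using q by (auto simp: simps)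
  qed
  moreover have "\<beta> ` carrier (quot_module R I) = carrier (quot_module R J)"
    by (simp add: simps(5,9) image_image \<beta>(2) cong: image_cong)
  ultimately have "short_exact R (quot_module R L) (quot_module R I) (quot_module R J) \<alpha> \<beta>"
    using mods \<alpha>(1) \<beta>(1) by (simp add: short_exact_def)
  then show thesis using that \<alpha>(2) by blast
qed

text \<open>For \<open>I : x = I\<close> the first map is scalar multiplication by \<open>x\<close>, so \<open>x\<close> is a regular element.\<close>

lemma quot_module_regular_exact:
  assumes I: "ideal I R" and J: "ideal J R" and x: "x \<in> carrier R"
    and colon: "I = {p \<in> carrier R. x \<otimes> p \<in> I}"
    and IJ: "I \<subseteq> J" "x \<in> J" "\<And>p. p \<in> J \<Longrightarrow> \<exists>q\<in>carrier R. p \<ominus> x \<otimes> q \<in> I"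
  shows "\<exists>\<beta>. short_exact R (quot_module R I) (quot_module R I) (quot_module R J)
    (\<lambda>C. x \<odot>\<^bsub>quot_module R I\<^esub> C) \<beta>"
proof -
  obtain \<alpha> \<beta> where se: "short_exact R (quot_module R I) (quot_module R I) (quot_module R J) \<alpha> \<beta>"
    and \<alpha>: "\<And>p. p \<in> carrier R \<Longrightarrow> \<alpha> (I +> p) = I +> (x \<otimes> p)"
    using quot_module_colon_exact[OF I I J x colon IJ] by metis
  have M: "module R (quot_module R I)" by (rule quot_module_module[OF I])
  have eq: "x \<odot>\<^bsub>quot_module R I\<^esub> C = \<alpha> C" if "C \<in> carrier (quot_module R I)" for C
    using that x by (auto simp: quot_module_simps[OF I] \<alpha>)
  have "inj_on (\<lambda>C. x \<odot>\<^bsub>quot_module R I\<^esub> C) (carrier (quot_module R I)) \<longleftrightarrow> inj_on \<alpha> (carrier (quot_module R I))"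
    by (rule inj_on_cong) (rule eq)
  moreover have "(\<lambda>C. x \<odot>\<^bsub>quot_module R I\<^esub> C) ` carrier (quot_module R I) = \<alpha> ` carrier (quot_module R I)"
    by (rule image_cong[OF refl]) (rule eq)
  ultimately show ?thesis
    using se linear_maps_scaling[OF M x] by (intro exI[of _ \<beta>]) (simp add: short_exact_def)
qed

end


section \<open>Stanley--Reisner rings\<close>

lemma mpoly_ring_simps [simp]:
  "p \<in> carrier (mpoly_ring V) \<longleftrightarrow> (\<forall>m\<in>Poly_Mapping.keys p. Poly_Mapping.keys m \<subseteq> V)"
  "p \<otimes>\<^bsub>mpoly_ring V\<^esub> q = p * q" "\<one>\<^bsub>mpoly_ring V\<^esub> = 1"
  "p \<oplus>\<^bsub>mpoly_ring V\<^esub> q = p + q" "\<zero>\<^bsub>mpoly_ring V\<^esub> = 0"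
  by (simp_all add: mpoly_ring_def)

lemma keys_add_nat: "Poly_Mapping.keys (a + b :: 'v \<Rightarrow>\<^sub>0 nat) = Poly_Mapping.keys a \<union> Poly_Mapping.keys b"
  by (auto simp: in_keys_iff lookup_add)

lemma keys_uminus_mpoly: "Poly_Mapping.keys (- p :: ('v, 'k::field) mpoly) = Poly_Mapping.keys p"
  by (auto simp: in_keys_iff)

lemma keys_addE:
  assumes "m \<in> Poly_Mapping.keys (p + q)"
  obtains "m \<in> Poly_Mapping.keys p" | "m \<in> Poly_Mapping.keys q"
  using subsetD[OF Poly_Mapping.keys_add assms] by blast

lemma keys_diffE:
  assumes "m \<in> Poly_Mapping.keys (p - q :: ('v, 'k::field) mpoly)"
  obtains "m \<in> Poly_Mapping.keys p" | "m \<in> Poly_Mapping.keys q"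
  using assms by (cases "Poly_Mapping.lookup p m = 0") (auto simp: in_keys_iff lookup_minus)

lemma keys_multE:
  assumes "m \<in> Poly_Mapping.keys (p * q)"
  obtains a b where "m = a + b" "a \<in> Poly_Mapping.keys p" "b \<in> Poly_Mapping.keys q"
  using assms keys_mult[of p q] by blast

lemma mpoly_ring_cring: "cring (mpoly_ring V :: ('v, 'k::field) mpoly ring)"
proof (rule cringI)
  show "abelian_group (mpoly_ring V :: ('v, 'k) mpoly ring)"
  proof (rule abelian_groupI)
    fix p :: "('v, 'k) mpoly" assume "p \<in> carrier (mpoly_ring V)"
    then show "\<exists>q\<in>carrier (mpoly_ring V). q \<oplus>\<^bsub>mpoly_ring V\<^esub> p = \<zero>\<^bsub>mpoly_ring V\<^esub>"
      by (intro bexI[of _ "- p"]) (auto simp: keys_uminus_mpoly)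
  qed (auto simp: add_ac elim!: keys_addE)
  show "comm_monoid (mpoly_ring V :: ('v, 'k) mpoly ring)"
    by (rule comm_monoidI) (force simp: mult_ac keys_add_nat elim!: keys_multE)+
qed (auto simp: distrib_right)

lemma mpoly_ring_minus:
  assumes "p \<in> carrier (mpoly_ring V)" "q \<in> carrier (mpoly_ring V)"
  shows "p \<ominus>\<^bsub>mpoly_ring V\<^esub> (q :: ('v, 'k::field) mpoly) = p - q"
proof -
  interpret cring "mpoly_ring V :: ('v, 'k) mpoly ring" by (rule mpoly_ring_cring)
  have "p - q \<in> carrier (mpoly_ring V)"
    using assms by (auto elim!: keys_diffE)
  then have "p \<ominus>\<^bsub>mpoly_ring V\<^esub> q = ((p - q) \<oplus>\<^bsub>mpoly_ring V\<^esub> q) \<ominus>\<^bsub>mpoly_ring V\<^esub> q"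
    by (simp del: mpoly_ring_simps(1))  
  also have "\<dots> = p - q"
    using \<open>p - q \<in> _\<close> assms(2) by (simp add: a_minus_def a_assoc r_neg del: mpoly_ring_simps)
  finally show ?thesis .
qed

lemma lookup_single_mult:
  "Poly_Mapping.lookup (Poly_Mapping.single a c * p) (a + m) = (c :: 'k::field) * Poly_Mapping.lookup p (m :: 'v \<Rightarrow>\<^sub>0 nat)"
  by (simp add: lookup_mult lookup_single mult_when when_mult)

lemma keys_var_mult:
  "Poly_Mapping.keys (mpoly_var v * p :: ('v, 'k::field) mpoly) = (\<lambda>m. Poly_Mapping.single v 1 + m) ` Poly_Mapping.keys p"
proof (intro equalityI subsetI)
  fix m assume "m \<in> Poly_Mapping.keys (mpoly_var v * p)"
  then show "m \<in> (\<lambda>m. Poly_Mapping.single v 1 + m) ` Poly_Mapping.keys p"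
    by (elim keys_multE) (auto simp: mpoly_var_def)
next
  fix m assume "m \<in> (\<lambda>m. Poly_Mapping.single v 1 + m) ` Poly_Mapping.keys p"
  then obtain a where "m = Poly_Mapping.single v 1 + a" "a \<in> Poly_Mapping.keys p" by blast
  then show "m \<in> Poly_Mapping.keys (mpoly_var v * p)"
    by (simp add: in_keys_iff mpoly_var_def lookup_single_mult)
qed

lemma var_carrier: "v \<in> V \<Longrightarrow> mpoly_var v \<in> carrier (mpoly_ring V)"
  by (simp add: mpoly_var_def)

lemma mpoly_sum_monomials:
  "(\<Sum>m\<in>Poly_Mapping.keys p. Poly_Mapping.single m (Poly_Mapping.lookup p m)) = (p :: ('v, 'k::field) mpoly)"
proof (rule poly_mapping_eqI)
  fix k
  have "Poly_Mapping.lookup (\<Sum>m\<in>Poly_Mapping.keys p. Poly_Mapping.single m (Poly_Mapping.lookup p m)) k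
      = (\<Sum>m\<in>Poly_Mapping.keys p. if m = k then Poly_Mapping.lookup p m else 0)"
    unfolding lookup_sum by (intro sum.cong refl) (simp add: lookup_single when_def)
  also have "\<dots> = Poly_Mapping.lookup p k" by (simp add: in_keys_iff)
  finally show "Poly_Mapping.lookup (\<Sum>m\<in>Poly_Mapping.keys p. Poly_Mapping.single m (Poly_Mapping.lookup p m)) k
      = Poly_Mapping.lookup p k" .
qed

lemma monomial_split_var:
  assumes "v \<in> Poly_Mapping.keys (m :: 'v \<Rightarrow>\<^sub>0 nat)"
  shows "Poly_Mapping.single v 1 + (m - Poly_Mapping.single v 1) = m"
proof (rule poly_mapping_eqI)
  fix k show "Poly_Mapping.lookup (Poly_Mapping.single v 1 + (m - Poly_Mapping.single v 1)) k = Poly_Mapping.lookup m k"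
    using assms by (auto simp: lookup_add lookup_minus lookup_single when_def in_keys_iff)
qed

lemma keys_minus_nat: "Poly_Mapping.keys (m - m' :: 'v \<Rightarrow>\<^sub>0 nat) \<subseteq> Poly_Mapping.keys m"
  by (auto simp: in_keys_iff lookup_minus)

text \<open>Division by a variable: the monomials divisible by \<open>x\<^sub>v\<close> are collected in \<open>x\<^sub>v q\<close>, and the remainder is
  made of the other monomials of \<open>p\<close>.\<close>

lemma mpoly_split_var:
  fixes p :: "('v, 'k::field) mpoly"
  assumes "p \<in> carrier (mpoly_ring V)"
  shows "\<exists>q\<in>carrier (mpoly_ring V).
    Poly_Mapping.keys (p - mpoly_var v * q) \<subseteq> {m \<in> Poly_Mapping.keys p. v \<notin> Poly_Mapping.keys m}"
proof -
  define s where "s m = Poly_Mapping.single (m - Poly_Mapping.single v 1) (Poly_Mapping.lookup p m)" for m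
  define A where "A = {m \<in> Poly_Mapping.keys p. v \<in> Poly_Mapping.keys m}"
  define q where "q = sum s A"
  have A: "finite A" "A \<subseteq> Poly_Mapping.keys p" by (auto simp: A_def)
  have "Poly_Mapping.keys q \<subseteq> (\<lambda>m. m - Poly_Mapping.single v 1) ` A"
    unfolding q_def using A
  proof (induction A rule: finite_induct)
    case (insert x B)
    then show ?case by (auto simp: s_def elim!: keys_addE split: if_splits)
  qed simp
  then have "Poly_Mapping.keys m \<subseteq> V" if mq: "m \<in> Poly_Mapping.keys q" for m
  proof -
    obtain a where "a \<in> Poly_Mapping.keys p" "m = a - Poly_Mapping.single v 1"
      using mq \<open>Poly_Mapping.keys q \<subseteq> _\<close> A(2) by blast
    then show ?thesis using keys_minus_nat[of a "Poly_Mapping.single v 1"] assms by auto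
  qed
  then have q: "q \<in> carrier (mpoly_ring V)" by simp
  have "mpoly_var v * q = (\<Sum>m\<in>A. Poly_Mapping.single m (Poly_Mapping.lookup p m))"
    unfolding q_def sum_distrib_left
  proof (intro sum.cong refl)
    fix m assume "m \<in> A"
    then show "mpoly_var v * s m = Poly_Mapping.single m (Poly_Mapping.lookup p m)"
      using monomial_split_var[of v m] by (simp add: A_def s_def mpoly_var_def mult_single)
  qed
  moreover have "p = (\<Sum>m\<in>Poly_Mapping.keys p - A. Poly_Mapping.single m (Poly_Mapping.lookup p m))
      + (\<Sum>m\<in>A. Poly_Mapping.single m (Poly_Mapping.lookup p m))"
    using mpoly_sum_monomials[of p] sum.subset_diff[OF A(2), of "\<lambda>m. Poly_Mapping.single m (Poly_Mapping.lookup p m)"] by simp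
  ultimately have eq: "p - mpoly_var v * q = (\<Sum>m\<in>Poly_Mapping.keys p - A. Poly_Mapping.single m (Poly_Mapping.lookup p m))"
    by (metis add_diff_cancel_right')
  have "Poly_Mapping.keys (\<Sum>m\<in>B. Poly_Mapping.single m (Poly_Mapping.lookup p m)) \<subseteq> B" if "finite B" for B
    using that by (induction B rule: finite_induct) (auto elim!: keys_addE split: if_splits)
  from this[of "Poly_Mapping.keys p - A"]
  have "Poly_Mapping.keys (p - mpoly_var v * q) \<subseteq> {m \<in> Poly_Mapping.keys p. v \<notin> Poly_Mapping.keys m}"
    unfolding eq A_def by auto
  with q show ?thesis by (rule bexI[rotated])
qed

definition simplicial_complex :: "'v set set \<Rightarrow> bool" where
  "simplicial_complex \<Delta> \<longleftrightarrow> (\<forall>F\<in>\<Delta>. \<forall>F'\<subseteq>F. F' \<in> \<Delta>)"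

definition vertex_star :: "'v \<Rightarrow> 'v set set \<Rightarrow> 'v set set" where
  "vertex_star v \<Delta> = {F. insert v F \<in> \<Delta>}"

definition vertex_deletion :: "'v \<Rightarrow> 'v set set \<Rightarrow> 'v set set" where
  "vertex_deletion v \<Delta> = {F \<in> \<Delta>. v \<notin> F}"

definition stanley_reisner_ideal :: "'v set \<Rightarrow> 'v set set \<Rightarrow> ('v, 'k::field) mpoly set" where
  "stanley_reisner_ideal V \<Delta> =
     {p \<in> carrier (mpoly_ring V). \<forall>m\<in>Poly_Mapping.keys p. Poly_Mapping.keys m \<notin> \<Delta>}"

lemma simplicial_complexD: "simplicial_complex \<Delta> \<Longrightarrow> F \<in> \<Delta> \<Longrightarrow> F' \<subseteq> F \<Longrightarrow> F' \<in> \<Delta>"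
  by (auto simp: simplicial_complex_def)

lemma simplicial_complex_star: "simplicial_complex \<Delta> \<Longrightarrow> simplicial_complex (vertex_star v \<Delta>)"
  unfolding simplicial_complex_def vertex_star_def by (auto, meson insert_mono)

lemma simplicial_complex_deletion: "simplicial_complex \<Delta> \<Longrightarrow> simplicial_complex (vertex_deletion v \<Delta>)"
  unfolding simplicial_complex_def vertex_deletion_def by blast

lemma simplicial_complex_Pow: "simplicial_complex (Pow T)"
  by (auto simp: simplicial_complex_def)

lemma stanley_reisner_ideal_ideal:
  assumes "simplicial_complex \<Delta>"
  shows "ideal (stanley_reisner_ideal V \<Delta> :: ('v, 'k::field) mpoly set) (mpoly_ring V)"
proof (rule idealI)
  interpret cring "mpoly_ring V :: ('v, 'k) mpoly ring" by (rule mpoly_ring_cring)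
  show "ring (mpoly_ring V :: ('v, 'k) mpoly ring)" by (rule ring_axioms)
  let ?I = "stanley_reisner_ideal V \<Delta> :: ('v, 'k) mpoly set"
  show "subgroup ?I (add_monoid (mpoly_ring V))"
  proof (rule add.subgroupI)
    show "?I \<noteq> {}" by (auto simp: stanley_reisner_ideal_def intro: exI[of _ 0])
    fix p assume p: "p \<in> ?I"
    then have "\<ominus>\<^bsub>mpoly_ring V\<^esub> p = - p"
      using mpoly_ring_minus[of 0 V p] by (simp add: stanley_reisner_ideal_def a_minus_def)
    then show "\<ominus>\<^bsub>mpoly_ring V\<^esub> p \<in> ?I" using p by (simp add: stanley_reisner_ideal_def keys_uminus_mpoly)
  qed (auto simp: stanley_reisner_ideal_def elim!: keys_addE)
  have *: "p * x \<in> ?I" if "p \<in> ?I" "x \<in> carrier (mpoly_ring V)" for p x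
  proof -
    have "Poly_Mapping.keys m \<subseteq> V \<and> Poly_Mapping.keys m \<notin> \<Delta>" if m: "m \<in> Poly_Mapping.keys (p * x)" for m
    proof -
      obtain a b where ab: "m = a + b" "a \<in> Poly_Mapping.keys p" "b \<in> Poly_Mapping.keys x"
        using m by (rule keys_multE)
      have "Poly_Mapping.keys a \<notin> \<Delta>" using ab(2) \<open>p \<in> ?I\<close> by (simp add: stanley_reisner_ideal_def)
      then have "Poly_Mapping.keys m \<notin> \<Delta>"
        using simplicial_complexD[OF assms, of "Poly_Mapping.keys m" "Poly_Mapping.keys a"]
        by (auto simp: ab(1) keys_add_nat)
      then show ?thesis
        using ab \<open>p \<in> ?I\<close> \<open>x \<in> carrier _\<close> by (auto simp: keys_add_nat stanley_reisner_ideal_def)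
    qed
    then show ?thesis by (simp add: stanley_reisner_ideal_def)
  qed
  fix p x :: "('v, 'k) mpoly" assume "p \<in> ?I" "x \<in> carrier (mpoly_ring V)"
  then show "p \<otimes>\<^bsub>mpoly_ring V\<^esub> x \<in> ?I" "x \<otimes>\<^bsub>mpoly_ring V\<^esub> p \<in> ?I"
    using * by (simp_all add: mult.commute del: mpoly_ring_simps(1))
qed

text \<open>Multiplication by \<open>x\<^sub>v\<close> shifts the monomials of \<open>p\<close> injectively and adds \<open>v\<close> to each support, so nothing
  cancels and membership of \<open>x\<^sub>v p\<close> can be read off monomial by monomial.\<close>

lemma stanley_reisner_star:
  assumes "v \<in> V"
  shows "stanley_reisner_ideal V (vertex_star v \<Delta>) =
    {p \<in> carrier (mpoly_ring V). mpoly_var v * p \<in> (stanley_reisner_ideal V \<Delta> :: ('v, 'k::field) mpoly set)}"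
  using assms by (auto simp: stanley_reisner_ideal_def keys_var_mult keys_add_nat vertex_star_def)

lemma stanley_reisner_deletion:
  assumes "p \<in> (stanley_reisner_ideal V (vertex_deletion v \<Delta>) :: ('v, 'k::field) mpoly set)" "v \<in> V"
  shows "\<exists>q\<in>carrier (mpoly_ring V). p \<ominus>\<^bsub>mpoly_ring V\<^esub> mpoly_var v * q \<in> stanley_reisner_ideal V \<Delta>"
proof -
  have p: "p \<in> carrier (mpoly_ring V)" using assms(1) by (simp add: stanley_reisner_ideal_def)
  obtain q where q: "q \<in> carrier (mpoly_ring V)"
    "Poly_Mapping.keys (p - mpoly_var v * q) \<subseteq> {m \<in> Poly_Mapping.keys p. v \<notin> Poly_Mapping.keys m}"
    using mpoly_split_var[OF p, of v] by blast
  have "mpoly_var v * q \<in> carrier (mpoly_ring V)"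
    using q(1) assms(2) by (auto simp: keys_var_mult keys_add_nat)
  then have eq: "p \<ominus>\<^bsub>mpoly_ring V\<^esub> mpoly_var v * q = p - mpoly_var v * q"
    by (rule mpoly_ring_minus[OF p])
  have "p - mpoly_var v * q \<in> stanley_reisner_ideal V \<Delta>"
    using q(2) assms(1) by (force simp: stanley_reisner_ideal_def vertex_deletion_def)
  with q(1) show ?thesis unfolding eq[symmetric] by blast
qed

abbreviation stanley_reisner_ring :: "'v set \<Rightarrow> 'v set set \<Rightarrow> (('v, 'k::field) mpoly, ('v, 'k) mpoly set) module" where
  "stanley_reisner_ring V \<Delta> \<equiv> quot_module (mpoly_ring V) (stanley_reisner_ideal V \<Delta>)"

lemma stanley_reisner_module:
  "simplicial_complex \<Delta> \<Longrightarrow> module (mpoly_ring V) (stanley_reisner_ring V \<Delta>)"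
  by (intro cring.quot_module_module mpoly_ring_cring stanley_reisner_ideal_ideal)

lemma stanley_reisner_deletion_mono:
  assumes "v \<in> V"
  shows "stanley_reisner_ideal V \<Delta> \<subseteq> stanley_reisner_ideal V (vertex_deletion v \<Delta>)"
    and "mpoly_var v \<in> stanley_reisner_ideal V (vertex_deletion v \<Delta>)"
  using assms by (auto simp: stanley_reisner_ideal_def vertex_deletion_def mpoly_var_def)

text \<open>Colon by a variable is passing to the star of the vertex, adding the variable is deleting
  the vertex.\<close>

lemma star_deletion_exact:
  assumes "simplicial_complex \<Delta>" "v \<in> V"
  shows "\<exists>\<alpha> \<beta>. short_exact (mpoly_ring V :: ('v, 'k::field) mpoly ring)
    (stanley_reisner_ring V (vertex_star v \<Delta>)) (stanley_reisner_ring V \<Delta>)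
    (stanley_reisner_ring V (vertex_deletion v \<Delta>)) \<alpha> \<beta>"
  by (rule cring.quot_module_colon_exact[OF mpoly_ring_cring, of "stanley_reisner_ideal V \<Delta>" V
        "stanley_reisner_ideal V (vertex_star v \<Delta>)" "stanley_reisner_ideal V (vertex_deletion v \<Delta>)" "mpoly_var v"])
    (use assms var_carrier[OF assms(2)] stanley_reisner_star[OF assms(2), of \<Delta>] stanley_reisner_deletion[OF _ assms(2), of _ \<Delta>]
        stanley_reisner_deletion_mono[OF assms(2), of \<Delta>] in
      \<open>auto simp del: mpoly_ring_simps(1) simp: stanley_reisner_ideal_ideal simplicial_complex_star simplicial_complex_deletion\<close>)

text \<open>A vertex in all maximal faces gives a regular variable.\<close>

lemma cone_vertex_exact:
  assumes "simplicial_complex \<Delta>" "v \<in> V" "vertex_star v \<Delta> = \<Delta>"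
  shows "\<exists>\<beta>. short_exact (mpoly_ring V :: ('v, 'k::field) mpoly ring)
    (stanley_reisner_ring V \<Delta>) (stanley_reisner_ring V \<Delta>)
    (stanley_reisner_ring V (vertex_deletion v \<Delta>)) (\<lambda>C. mpoly_var v \<odot>\<^bsub>stanley_reisner_ring V \<Delta>\<^esub> C) \<beta>"
  by (rule cring.quot_module_regular_exact[OF mpoly_ring_cring])
    (use assms var_carrier[OF assms(2)] stanley_reisner_star[OF assms(2), of \<Delta>] stanley_reisner_deletion[OF _ assms(2), of _ \<Delta>]
        stanley_reisner_deletion_mono[OF assms(2), of \<Delta>] in
      \<open>simp_all del: mpoly_ring_simps(1) add: stanley_reisner_ideal_ideal simplicial_complex_deletion\<close>)


subsection \<open>The residue field\<close>

lemma keys_empty_iff: "Poly_Mapping.keys (m :: 'v \<Rightarrow>\<^sub>0 nat) = {} \<longleftrightarrow> m = 0"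
  by (auto intro!: poly_mapping_eqI simp: in_keys_iff set_eq_iff)

lemma lookup_mult_0:
  fixes p q :: "('v, 'k::field) mpoly"
  shows "Poly_Mapping.lookup (p * q) 0 = Poly_Mapping.lookup p 0 * Poly_Mapping.lookup q 0"
proof -
  define p' where "p' = p - Poly_Mapping.single 0 (Poly_Mapping.lookup p 0)"
  have p0: "0 \<notin> Poly_Mapping.keys p'" by (simp add: p'_def in_keys_iff lookup_minus)
  have "0 \<notin> Poly_Mapping.keys (p' * q)"
  proof
    assume "0 \<in> Poly_Mapping.keys (p' * q)"
    then obtain a b where ab: "0 = a + b" "a \<in> Poly_Mapping.keys p'" by (rule keys_multE)
    have "Poly_Mapping.keys a = {}" using keys_add_nat[of a b] by (simp add: ab(1)[symmetric])
    then have "a = 0" by (simp only: keys_empty_iff)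
    then show False using ab(2) p0 by simp
  qed
  moreover have "p * q = p' * q + Poly_Mapping.single 0 (Poly_Mapping.lookup p 0) * q"
    by (simp add: p'_def algebra_simps)
  moreover have "Poly_Mapping.lookup (Poly_Mapping.single 0 (Poly_Mapping.lookup p 0) * q) 0 =
      Poly_Mapping.lookup p 0 * Poly_Mapping.lookup q 0"
    using lookup_single_mult[of 0 "Poly_Mapping.lookup p 0" q 0] by simp
  ultimately show ?thesis by (simp add: lookup_add in_keys_iff)
qed

lemma coeff_field_simps [simp]:
  "carrier coeff_field_module = (UNIV :: 'k::field set)"
  "c \<oplus>\<^bsub>(coeff_field_module :: (('v, 'k) mpoly, 'k) module)\<^esub> c' = c + c'"
  "\<zero>\<^bsub>(coeff_field_module :: (('v, 'k) mpoly, 'k) module)\<^esub> = 0"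
  "p \<odot>\<^bsub>(coeff_field_module :: (('v, 'k) mpoly, 'k) module)\<^esub> c = Poly_Mapping.lookup p 0 * c"
  by (simp_all add: coeff_field_module_def)

lemma coeff_field_module_module:
  "module (mpoly_ring V) (coeff_field_module :: (('v, 'k::field) mpoly, 'k) module)"
proof (rule moduleI)
  show "cring (mpoly_ring V :: ('v, 'k) mpoly ring)" by (rule mpoly_ring_cring)
  show "abelian_group (coeff_field_module :: (('v, 'k) mpoly, 'k) module)"
  proof (rule abelian_groupI)
    fix x :: 'k
    show "\<exists>y\<in>carrier (coeff_field_module :: (('v, 'k) mpoly, 'k) module).
        y \<oplus>\<^bsub>(coeff_field_module :: (('v, 'k) mpoly, 'k) module)\<^esub> x =
        \<zero>\<^bsub>(coeff_field_module :: (('v, 'k) mpoly, 'k) module)\<^esub>"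
      by (intro bexI[of _ "- x"]) auto
  qed (auto simp: add_ac)
qed (auto simp: lookup_add lookup_mult_0 algebra_simps)

text \<open>The Koszul complex of the variables, built one variable at a time: the mapping cone of \<open>x\<^sub>v\<close>
  turns a resolution of \<open>K[x\<^sub>u : u \<in> T]\<close> into one of \<open>K[x\<^sub>u : u \<in> T - {v}]\<close>.\<close>

lemma star_simplex: "v \<in> T \<Longrightarrow> vertex_star v (Pow T) = Pow T"
  and deletion_simplex: "vertex_deletion v (Pow T) = Pow (T - {v})"
  by (auto simp: vertex_star_def vertex_deletion_def)

lemma simplex_resolution:
  assumes "finite Y" "Y \<subseteq> V"
  shows "\<exists>b d \<epsilon>. augmented_free_complex (mpoly_ring V :: ('v, 'k::field) mpoly ring) b d
    (stanley_reisner_ring V (Pow (V - Y))) \<epsilon>"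
  using assms
proof (induction Y rule: finite_induct)
  case empty
  let ?R = "mpoly_ring V :: ('v, 'k) mpoly ring"
  let ?I = "stanley_reisner_ideal V (Pow V) :: ('v, 'k) mpoly set"
  interpret cring ?R by (rule mpoly_ring_cring)
  have I: "ideal ?I ?R" by (rule stanley_reisner_ideal_ideal[OF simplicial_complex_Pow])
  have I0: "?I = {0}"
  proof -
    have "p = 0" if "p \<in> ?I" for p
    proof -
      have "Poly_Mapping.keys p = {}" using that by (auto simp: stanley_reisner_ideal_def)
      then show ?thesis by (intro poly_mapping_eqI) (auto simp: in_keys_iff set_eq_iff)
    qed
    then show ?thesis by (auto simp: stanley_reisner_ideal_def)
  qed
  define \<epsilon> where "\<epsilon> x = ?I +>\<^bsub>?R\<^esub> (x 0)" for x :: "nat \<Rightarrow> ('v, 'k) mpoly"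
  note simps = quot_module_simps[OF I]
  have cl: "x 0 \<in> carrier ?R" if "x \<in> carrier (free_module ?R 1)" for x
    using that by (auto simp: free_module_simps simp del: mpoly_ring_simps)
  have "augmented_free_complex ?R (\<lambda>i. if i = 1 then 1 else 0)
    (\<lambda>i _. \<zero>\<^bsub>free_module ?R (if i = 1 then 1 else 0)\<^esub>) (stanley_reisner_ring V (Pow V)) \<epsilon>"
  proof (rule free_rank_one_augmented)
    show "module ?R (stanley_reisner_ring V (Pow V))"
      by (rule stanley_reisner_module[OF simplicial_complex_Pow])
    show "\<epsilon> \<in> linear_maps ?R (free_module ?R 1) (stanley_reisner_ring V (Pow V))"
      by (rule linear_mapsI; drule cl; (drule cl)?)
        (simp_all add: \<epsilon>_def simps free_module_simps del: mpoly_ring_simps)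
    show "inj_on \<epsilon> (carrier (free_module ?R 1))"
    proof (rule inj_onI)
      fix x y assume xy: "x \<in> carrier (free_module ?R 1)" "y \<in> carrier (free_module ?R 1)" "\<epsilon> x = \<epsilon> y"
      then have "x 0 \<ominus>\<^bsub>?R\<^esub> y 0 \<in> ?I"
        using cl by (simp add: \<epsilon>_def quot_module_eq_iff[OF I] del: mpoly_ring_simps)
      then have "x 0 = y 0" using mpoly_ring_minus[OF cl[OF xy(1)] cl[OF xy(2)]] by (simp add: I0)
      then show "x = y"
        using xy(1,2) by (intro extensionalityI[of _ "{..<1}"]) (auto simp: free_module_simps PiE_def)
    qed
    show "\<epsilon> ` carrier (free_module ?R 1) = carrier (stanley_reisner_ring V (Pow V))"
    proof (intro equalityI subsetI)
      fix C assume "C \<in> carrier (stanley_reisner_ring V (Pow V) :: (('v, 'k) mpoly, ('v, 'k) mpoly set) module)"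
      then obtain p where p: "p \<in> carrier ?R" "C = ?I +>\<^bsub>?R\<^esub> p" unfolding simps by blast
      have "(\<lambda>i\<in>{..<1}. p) \<in> carrier (free_module ?R 1)" using p(1) by (auto simp: free_module_simps)
      moreover have "\<epsilon> (\<lambda>i\<in>{..<1}. p) = C" using p(2) by (simp add: \<epsilon>_def)
      ultimately show "C \<in> \<epsilon> ` carrier (free_module ?R 1)" by (metis image_eqI)
    qed (use cl in \<open>auto simp: \<epsilon>_def simps simp del: mpoly_ring_simps\<close>)
  qed
  then show ?case unfolding Diff_empty by blast
next
  case (insert v Y)
  let ?R = "mpoly_ring V :: ('v, 'k) mpoly ring"
  obtain b d \<epsilon> where aug: "augmented_free_complex ?R b d (stanley_reisner_ring V (Pow (V - Y))) \<epsilon>"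
    using insert by blast
  have v: "v \<in> V" "v \<in> V - Y" using insert by auto
  have del: "vertex_deletion v (Pow (V - Y)) = Pow (V - insert v Y)"
    using deletion_simplex[of v "V - Y"] by (simp add: Diff_insert[symmetric])
  have "\<exists>\<beta>. short_exact ?R (stanley_reisner_ring V (Pow (V - Y))) (stanley_reisner_ring V (Pow (V - Y)))
    (stanley_reisner_ring V (Pow (V - insert v Y)))
    (\<lambda>C. mpoly_var v \<odot>\<^bsub>stanley_reisner_ring V (Pow (V - Y))\<^esub> C) \<beta>"
    using cone_vertex_exact[OF simplicial_complex_Pow v(1) star_simplex[OF v(2)], where 'k = 'k]
    unfolding del .
  then obtain \<beta> where "short_exact ?R (stanley_reisner_ring V (Pow (V - Y))) (stanley_reisner_ring V (Pow (V - Y)))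
    (stanley_reisner_ring V (Pow (V - insert v Y)))
    (\<lambda>C. mpoly_var v \<odot>\<^bsub>stanley_reisner_ring V (Pow (V - Y))\<^esub> C) \<beta>" ..
  from augmented_free_complex.cone_augmented[OF aug this var_carrier[OF v(1)]]
  show ?case by blast
qed

text \<open>The last stage of the Koszul complex resolves \<open>S/(x\<^sub>u : u \<in> V)\<close>, which the constant coefficient
  identifies with \<open>K\<close>.\<close>

lemma coeff_field_resolution:
  assumes "finite V"
  shows "\<exists>res. free_resolution (mpoly_ring V) (coeff_field_module :: (('v, 'k::field) mpoly, 'k) module) res"
proof -
  let ?R = "mpoly_ring V :: ('v, 'k) mpoly ring"
  let ?K = "coeff_field_module :: (('v, 'k) mpoly, 'k) module"
  let ?I = "stanley_reisner_ideal V (Pow {}) :: ('v, 'k) mpoly set"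
  interpret cring ?R by (rule mpoly_ring_cring)
  have I: "ideal ?I ?R" by (rule stanley_reisner_ideal_ideal[OF simplicial_complex_Pow])
  have Iff: "p \<in> ?I \<longleftrightarrow> p \<in> carrier ?R \<and> Poly_Mapping.lookup p 0 = 0" for p
  proof -
    have "Poly_Mapping.keys m = {} \<longleftrightarrow> m = 0" for m :: "'v \<Rightarrow>\<^sub>0 nat" by (rule keys_empty_iff)
    then show ?thesis by (auto simp: stanley_reisner_ideal_def in_keys_iff)
  qed
  obtain b d \<epsilon> where aug: "augmented_free_complex ?R b d (stanley_reisner_ring V (Pow {})) \<epsilon>"
    using simplex_resolution[OF assms subset_refl] unfolding Diff_cancel by blast
  have "\<exists>f\<in>linear_maps ?R (stanley_reisner_ring V (Pow {})) ?K. \<forall>p\<in>carrier ?R. f (?I +>\<^bsub>?R\<^esub> p) = Poly_Mapping.lookup p 0"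
    by (rule quot_module_induced[OF I coeff_field_module_module])
      (auto simp: lookup_add lookup_mult_0 Iff simp del: Pow_empty)
  then obtain \<phi> where \<phi>: "\<phi> \<in> linear_maps ?R (stanley_reisner_ring V (Pow {})) ?K"
    "\<And>p. p \<in> carrier ?R \<Longrightarrow> \<phi> (?I +>\<^bsub>?R\<^esub> p) = Poly_Mapping.lookup p 0" by blast
  have "inj_on \<phi> (carrier (stanley_reisner_ring V (Pow {})))"
  proof (rule inj_onI, unfold quot_module_simps(1)[OF I], elim imageE)
    fix C D p q assume *: "\<phi> C = \<phi> D" "C = ?I +>\<^bsub>?R\<^esub> p" "p \<in> carrier ?R" "D = ?I +>\<^bsub>?R\<^esub> q" "q \<in> carrier ?R"
    have "p \<ominus>\<^bsub>?R\<^esub> q \<in> carrier ?R" using *(3,5) by (rule minus_closed)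
    moreover have "Poly_Mapping.lookup (p \<ominus>\<^bsub>?R\<^esub> q) 0 = 0"
      using *(1) unfolding *(2,4) \<phi>(2)[OF *(3)] \<phi>(2)[OF *(5)] mpoly_ring_minus[OF *(3,5)]
      by (simp add: lookup_minus)
    ultimately have "p \<ominus>\<^bsub>?R\<^esub> q \<in> ?I" unfolding Iff by blast
    then show "C = D" unfolding *(2,4) quot_module_eq_iff[OF I *(3,5)] .
  qed
  moreover have "\<phi> ` carrier (stanley_reisner_ring V (Pow {})) = carrier ?K"
  proof -
    have "c \<in> \<phi> ` carrier (stanley_reisner_ring V (Pow {}))" for c
    proof -
      have c: "Poly_Mapping.single 0 c \<in> carrier ?R" by simp
      have "\<phi> (?I +>\<^bsub>?R\<^esub> (Poly_Mapping.single 0 c)) = c" unfolding \<phi>(2)[OF c] by simp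
      then show ?thesis using c unfolding quot_module_simps(1)[OF I] by (metis image_eqI)
    qed
    then show ?thesis by auto
  qed
  ultimately show ?thesis
    using augmented_free_complex_resolution[OF augmented_free_complex_iso[OF aug coeff_field_module_module \<phi>(1)]] by blast
qed

section \<open>Depth of Stanley--Reisner rings\<close>

locale residue_field_resolution =
  augmented_free_complex "mpoly_ring V :: ('v, 'k::field) mpoly ring" b d
    "coeff_field_module :: (('v, 'k) mpoly, 'k) module" \<epsilon>
  for V b d \<epsilon>
begin

abbreviation ext_vanishes :: "'v set set \<Rightarrow> nat \<Rightarrow> bool" where
  "ext_vanishes \<Delta> i \<equiv> cohomology_vanishes (stanley_reisner_ring V \<Delta>) i"

definition depth_at_least :: "'v set set \<Rightarrow> nat \<Rightarrow> bool" where
  "depth_at_least \<Delta> s \<longleftrightarrow> (\<forall>i<s. ext_vanishes \<Delta> i)"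

definition has_depth :: "'v set set \<Rightarrow> nat \<Rightarrow> bool" where
  "has_depth \<Delta> s \<longleftrightarrow> depth_at_least \<Delta> s \<and> \<not> ext_vanishes \<Delta> s"

lemma depth_at_least_mono: "depth_at_least \<Delta> s \<Longrightarrow> t \<le> s \<Longrightarrow> depth_at_least \<Delta> t"
  by (simp add: depth_at_least_def)

lemma depth_at_least_star_deletion:
  assumes "simplicial_complex \<Delta>" "v \<in> V"
    and "depth_at_least (vertex_star v \<Delta>) s" "depth_at_least (vertex_deletion v \<Delta>) s"
  shows "depth_at_least \<Delta> s"
  using star_deletion_exact[OF assms(1,2)] cohomology_vanishes_middle assms(3,4)
  unfolding depth_at_least_def by metis

text \<open>The nonzero group in degree \<open>s\<close> of the star survives in \<open>\<Delta>\<close>, since the preceding term of the long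
  exact sequence is the group of the deletion in degree \<open>s - 1\<close>, which vanishes.\<close>

lemma has_depth_star_deletion:
  assumes \<Delta>: "simplicial_complex \<Delta>" "v \<in> V"
    and star: "has_depth (vertex_star v \<Delta>) s" and del: "depth_at_least (vertex_deletion v \<Delta>) s" and "s > 0"
  shows "has_depth \<Delta> s"
proof -
  obtain i where i: "s = Suc i" using \<open>s > 0\<close> gr0_implies_Suc by blast
  have "\<not> ext_vanishes \<Delta> s"
    using star_deletion_exact[OF \<Delta>] cohomology_vanishes_sub star del
    unfolding has_depth_def depth_at_least_def i by (metis lessI)
  then show ?thesis
    using depth_at_least_star_deletion[OF \<Delta> _ del] star by (simp add: has_depth_def)
qed

lemma variable_kills_residue_field:
  "mpoly_var v \<odot>\<^bsub>(coeff_field_module :: (('v, 'k) mpoly, 'k) module)\<^esub> c = \<zero>\<^bsub>(coeff_field_module :: (('v, 'k) mpoly, 'k) module)\<^esub>"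
proof -
  have "Poly_Mapping.single v (1::nat) \<noteq> 0" by (metis lookup_single_eq lookup_zero one_neq_zero)
  then show ?thesis by (simp add: mpoly_var_def lookup_single)
qed

text \<open>\<open>Hom(K, K) \<noteq> 0\<close>, where the second \<open>K\<close> is presented as the Stanley--Reisner ring of \<open>{\<emptyset>}\<close>.\<close>

lemma has_depth_empty: "has_depth (Pow {}) 0"
proof -
  let ?R = "mpoly_ring V :: ('v, 'k) mpoly ring"
  let ?K = "coeff_field_module :: (('v, 'k) mpoly, 'k) module"
  let ?I = "stanley_reisner_ideal V (Pow {}) :: ('v, 'k) mpoly set"
  let ?c = "\<lambda>c::'k. Poly_Mapping.single 0 c :: ('v, 'k) mpoly"
  have I: "ideal ?I ?R" by (rule stanley_reisner_ideal_ideal[OF simplicial_complex_Pow])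
  note simps = quot_module_simps[OF I]
  have c: "?c a \<in> carrier ?R" for a by simp
  have lin: "(\<lambda>c. ?I +>\<^bsub>?R\<^esub> ?c c) \<in> linear_maps ?R ?K (stanley_reisner_ring V (Pow {}))"
  proof (rule linear_mapsI)
    show "?I +>\<^bsub>?R\<^esub> ?c x \<in> carrier (stanley_reisner_ring V (Pow {}))" for x
      using c unfolding simps(1) by blast
    show "?I +>\<^bsub>?R\<^esub> ?c (x \<oplus>\<^bsub>?K\<^esub> y) = (?I +>\<^bsub>?R\<^esub> ?c x) \<oplus>\<^bsub>stanley_reisner_ring V (Pow {})\<^esub> (?I +>\<^bsub>?R\<^esub> ?c y)" for x y
      unfolding simps(3)[OF c c] by (simp add: single_add)
    fix p x assume p: "p \<in> carrier ?R"
    have pc: "p * ?c x \<in> carrier ?R" using p c[of x] m_closed[of p "?c x"] by (simp del: mpoly_ring_simps(1))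
    have "Poly_Mapping.keys m \<noteq> {}" if m: "m \<in> Poly_Mapping.keys (?c (Poly_Mapping.lookup p 0 * x) - p * ?c x)" for m
    proof
      assume "Poly_Mapping.keys m = {}"
      then have "m = 0" by (simp only: keys_empty_iff)
      then show False using m by (simp add: in_keys_iff lookup_minus lookup_mult_0)
    qed
    moreover have "?c (Poly_Mapping.lookup p 0 * x) - p * ?c x \<in> carrier ?R"
      using minus_closed[OF c pc] by (simp only: mpoly_ring_minus[OF c pc])
    ultimately have "?c (Poly_Mapping.lookup p 0 * x) \<ominus>\<^bsub>?R\<^esub> p * ?c x \<in> ?I"
      unfolding mpoly_ring_minus[OF c pc] by (simp add: stanley_reisner_ideal_def)
    then show "?I +>\<^bsub>?R\<^esub> ?c (p \<odot>\<^bsub>?K\<^esub> x) = p \<odot>\<^bsub>stanley_reisner_ring V (Pow {})\<^esub> (?I +>\<^bsub>?R\<^esub> ?c x)"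
      unfolding simps(4)[OF p c] coeff_field_simps mpoly_ring_simps(2) quot_module_eq_iff[OF I c pc] .
  qed
  have ne: "?I +>\<^bsub>?R\<^esub> ?c 1 \<noteq> \<zero>\<^bsub>stanley_reisner_ring V (Pow {})\<^esub>"
    unfolding simps(2) quot_module_zero_iff[OF I c] by (simp add: stanley_reisner_ideal_def)
  have "\<not> ext_vanishes (Pow {}) 0"
    by (rule cohomology_0_self[OF lin stanley_reisner_module[OF simplicial_complex_Pow], of 1], simp, rule ne)
  then show ?thesis by (simp add: has_depth_def depth_at_least_def)
qed

text \<open>The Stanley--Reisner ring is the polynomial ring in the variables \<open>T\<close>. Each of them is regular and
  annihilates the residue field, and dividing by it leaves the polynomial ring in the others.\<close>

lemma has_depth_simplex:
  assumes "finite T" "T \<subseteq> V"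
  shows "has_depth (Pow T) (card T)"
  using assms
proof (induction T rule: finite_induct)
  case empty
  then show ?case using has_depth_empty by simp
next
  case (insert v T)
  let ?T = "insert v T"
  have v: "v \<in> V" using insert by auto
  have T: "?T - {v} = T" using insert by auto
  have "\<exists>\<beta>. short_exact (mpoly_ring V :: ('v, 'k) mpoly ring) (stanley_reisner_ring V (Pow ?T)) (stanley_reisner_ring V (Pow ?T))
    (stanley_reisner_ring V (Pow T)) (\<lambda>C. mpoly_var v \<odot>\<^bsub>stanley_reisner_ring V (Pow ?T)\<^esub> C) \<beta>"
    using cone_vertex_exact[OF simplicial_complex_Pow v star_simplex[OF insertI1, of v T], where 'k = 'k]
    unfolding deletion_simplex T .
  then obtain \<beta> where ses: "short_exact (mpoly_ring V :: ('v, 'k) mpoly ring) (stanley_reisner_ring V (Pow ?T)) (stanley_reisner_ring V (Pow ?T))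
    (stanley_reisner_ring V (Pow T)) (\<lambda>C. mpoly_var v \<odot>\<^bsub>stanley_reisner_ring V (Pow ?T)\<^esub> C) \<beta>" ..
  note reg = regular_element_vanishing[OF ses var_carrier[OF v] variable_kills_residue_field]
  have IH: "has_depth (Pow T) (card T)" using insert by simp
  have *: "depth_at_least (Pow ?T) (Suc (card T))"
    unfolding depth_at_least_def
  proof (intro allI impI)
    fix i assume "i < Suc (card T)"
    then show "ext_vanishes (Pow ?T) i"
      using reg IH by (cases i) (auto simp: has_depth_def depth_at_least_def)
  qed
  moreover have "\<not> ext_vanishes (Pow ?T) (Suc (card T))"
    using cohomology_vanishes_quotient[OF ses] * IH by (auto simp: has_depth_def depth_at_least_def)
  ultimately show ?case using insert by (simp add: has_depth_def)
qed

end


text \<open>For a disjoint family these are the partial transversals, and at the same time the independent sets of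
  the disjoint union of the complete graphs on its members.\<close>

definition transversal_complex :: "'v set set \<Rightarrow> 'v set set" where
  "transversal_complex \<C> = {F. F \<subseteq> \<Union>\<C> \<and> (\<forall>C\<in>\<C>. \<forall>a\<in>F \<inter> C. \<forall>b\<in>F \<inter> C. a = b)}"

lemma transversal_complexI:
  assumes "\<And>a. a \<in> F \<Longrightarrow> \<exists>C\<in>\<C>. a \<in> C"
    and "\<And>C a b. C \<in> \<C> \<Longrightarrow> a \<in> F \<Longrightarrow> a \<in> C \<Longrightarrow> b \<in> F \<Longrightarrow> b \<in> C \<Longrightarrow> a = b"
  shows "F \<in> transversal_complex \<C>"
  using assms unfolding transversal_complex_def by auto

lemma transversal_complexD:
  assumes "F \<in> transversal_complex \<C>"
  shows "a \<in> F \<Longrightarrow> \<exists>C\<in>\<C>. a \<in> C"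
    and "C \<in> \<C> \<Longrightarrow> a \<in> F \<Longrightarrow> a \<in> C \<Longrightarrow> b \<in> F \<Longrightarrow> b \<in> C \<Longrightarrow> a = b"
  using assms unfolding transversal_complex_def by auto

lemma simplicial_complex_transversal: "simplicial_complex (transversal_complex \<C>)"
  unfolding simplicial_complex_def transversal_complex_def by blast

lemma transversal_complex_star:
  assumes "disjoint \<C>" "C \<in> \<C>" "v \<in> C"
  shows "vertex_star v (transversal_complex \<C>) = transversal_complex (insert {v} (\<C> - {C}))"
proof (intro equalityI subsetI)
  fix F assume "F \<in> vertex_star v (transversal_complex \<C>)"
  then have F: "insert v F \<subseteq> \<Union>\<C>" "\<And>D a b. D \<in> \<C> \<Longrightarrow> a \<in> insert v F \<Longrightarrow> a \<in> D \<Longrightarrow> b \<in> insert v F \<Longrightarrow> b \<in> D \<Longrightarrow> a = b"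
    unfolding vertex_star_def transversal_complex_def by auto
  have "x \<in> \<Union>(insert {v} (\<C> - {C}))" if x: "x \<in> F" for x
  proof (cases "x = v")
    case False
    then have "x \<notin> C" using F(2)[OF assms(2) _ _ _ assms(3)] x by auto
    then show ?thesis using F(1) x by blast
  qed simp
  then show "F \<in> transversal_complex (insert {v} (\<C> - {C}))"
    using F(2) unfolding transversal_complex_def by blast
next
  have other: "v \<notin> D" if "D \<in> \<C>" "D \<noteq> C" for D
    using disjointD[OF assms(1) that(1) assms(2) that(2)] assms(3) by blast
  fix F assume "F \<in> transversal_complex (insert {v} (\<C> - {C}))"
  then have F: "F \<subseteq> insert v (\<Union>(\<C> - {C}))"
    "\<And>D a b. D \<in> \<C> \<Longrightarrow> D \<noteq> C \<Longrightarrow> a \<in> F \<Longrightarrow> a \<in> D \<Longrightarrow> b \<in> F \<Longrightarrow> b \<in> D \<Longrightarrow> a = b"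
    unfolding transversal_complex_def by auto
  have C: "a = v" if a: "a \<in> insert v F" "a \<in> C" for a
  proof (rule ccontr)
    assume "a \<noteq> v"
    then obtain D where "D \<in> \<C>" "D \<noteq> C" "a \<in> D" using a F(1) by blast
    then show False using disjointD[OF assms(1) \<open>D \<in> \<C>\<close> assms(2) \<open>D \<noteq> C\<close>] a(2) by blast
  qed
  have "a = b" if "D \<in> \<C>" "a \<in> insert v F" "a \<in> D" "b \<in> insert v F" "b \<in> D" for D a b
  proof (cases "D = C")
    case True then show ?thesis using C that by metis
  next
    case False then show ?thesis using F(2)[OF that(1) False] other[OF that(1) False] that by blast
  qed
  moreover have "insert v F \<subseteq> \<Union>\<C>" using F(1) assms(2,3) by blast
  ultimately show "F \<in> vertex_star v (transversal_complex \<C>)"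
    unfolding vertex_star_def transversal_complex_def by blast
qed

lemma transversal_complex_deletion:
  assumes "disjoint \<C>" "C \<in> \<C>" "v \<in> C"
  shows "vertex_deletion v (transversal_complex \<C>) = transversal_complex (insert (C - {v}) (\<C> - {C}))"
proof (intro equalityI subsetI)
  fix F assume "F \<in> vertex_deletion v (transversal_complex \<C>)"
  then have F: "F \<in> transversal_complex \<C>" and v: "v \<notin> F" by (auto simp: vertex_deletion_def)
  show "F \<in> transversal_complex (insert (C - {v}) (\<C> - {C}))"
  proof (rule transversal_complexI)
    fix a assume "a \<in> F"
    then obtain D where "D \<in> \<C>" "a \<in> D" "a \<noteq> v" using transversal_complexD(1)[OF F] v by blast
    then show "\<exists>D\<in>insert (C - {v}) (\<C> - {C}). a \<in> D" by (cases "D = C") auto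
  next
    fix D a b assume "D \<in> insert (C - {v}) (\<C> - {C})" "a \<in> F" "a \<in> D" "b \<in> F" "b \<in> D"
    then show "a = b"
      using transversal_complexD(2)[OF F assms(2), of a b] transversal_complexD(2)[OF F, of D a b] by auto
  qed
next
  have other: "v \<notin> D" if "D \<in> \<C>" "D \<noteq> C" for D
    using disjointD[OF assms(1) that(1) assms(2) that(2)] assms(3) by blast
  fix F assume F: "F \<in> transversal_complex (insert (C - {v}) (\<C> - {C}))"
  have v: "v \<notin> F" using transversal_complexD(1)[OF F, of v] other by auto
  have "F \<in> transversal_complex \<C>"
  proof (rule transversal_complexI)
    fix a assume "a \<in> F"
    then show "\<exists>D\<in>\<C>. a \<in> D" using transversal_complexD(1)[OF F, of a] assms(2) by auto
  next
    fix D a b assume *: "D \<in> \<C>" "a \<in> F" "a \<in> D" "b \<in> F" "b \<in> D"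
    then have "a \<noteq> v" "b \<noteq> v" using v by auto
    then show "a = b"
      using * transversal_complexD(2)[OF F, of "C - {v}" a b] transversal_complexD(2)[OF F, of D a b]
      by (cases "D = C") auto
  qed
  then show "F \<in> vertex_deletion v (transversal_complex \<C>)" using v by (simp add: vertex_deletion_def)
qed

lemma transversal_complex_singletons:
  assumes "\<And>C. C \<in> \<C> \<Longrightarrow> \<exists>x. C = {x}"
  shows "transversal_complex \<C> = Pow (\<Union>\<C>)" "card (\<Union>\<C>) = card \<C>"
proof -
  show "transversal_complex \<C> = Pow (\<Union>\<C>)"
    using assms unfolding transversal_complex_def by fastforce
  have "\<C> = (\<lambda>x. {x}) ` \<Union>\<C>" using assms by force
  then show "card (\<Union>\<C>) = card \<C>" by (metis card_image inj_singleton)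
qed

text \<open>Both the star and the deletion of a vertex in a member with at least two elements are complexes of the
  same kind, with as many members and a smaller union, so induction applies to both; a family of
  singletons gives a simplex.\<close>

lemma (in residue_field_resolution) has_depth_transversal:
  assumes "finite \<C>" "disjoint \<C>" "\<And>C. C \<in> \<C> \<Longrightarrow> finite C \<and> C \<noteq> {}" "\<Union>\<C> \<subseteq> V"
  shows "has_depth (transversal_complex \<C>) (card \<C>)"
  using assms
proof (induction "card (\<Union>\<C>)" arbitrary: \<C> rule: less_induct)
  case less
  have fin: "finite (\<Union>\<C>)" using less.prems by blast
  show ?case
  proof (cases "\<forall>C\<in>\<C>. \<exists>x. C = {x}")
    case True
    then show ?thesis
      using transversal_complex_singletons[of \<C>] has_depth_simplex[OF fin less.prems(4)] by simp
  next
    case False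
    then obtain C where C1: "C \<in> \<C>" "\<nexists>x. C = {x}" by auto
    then obtain v where "v \<in> C" using less.prems(3)[OF C1(1)] by auto
    with C1 have C: "C \<in> \<C>" "v \<in> C" "C \<noteq> {v}" by auto
    have disj: "D \<inter> C = {}" if "D \<in> \<C> - {C}" for D
      using disjointD[OF less.prems(2), of D C] that C(1) by blast
    have *: "has_depth (transversal_complex (insert C' (\<C> - {C}))) (card \<C>)"
      if C': "C' \<subset> C" "C' \<noteq> {}" for C'
    proof -
      let ?\<C>' = "insert C' (\<C> - {C})"
      have notin: "C' \<notin> \<C> - {C}" using disj[of C'] C' by blast
      have c: "card ?\<C>' = card \<C>"
        using card_insert_disjoint[OF _ notin] less.prems(1) card_Suc_Diff1[OF less.prems(1) C(1)] by simp
      have sub: "\<Union>?\<C>' \<subset> \<Union>\<C>"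
      proof
        show "\<Union>?\<C>' \<subseteq> \<Union>\<C>" using C' C(1) by blast
        obtain x where "x \<in> C" "x \<notin> C'" using C' by blast
        then have "x \<notin> \<Union>?\<C>'" "x \<in> \<Union>\<C>" using disj C(1) by blast+
        then show "\<Union>?\<C>' \<noteq> \<Union>\<C>" by blast
      qed
      have dj: "disjoint ?\<C>'"
      proof (rule disjointI)
        fix D E assume "D \<in> ?\<C>'" "E \<in> ?\<C>'" "D \<noteq> E"
        then show "D \<inter> E = {}"
          using disj[of D] disj[of E] C'(1) disjointD[OF less.prems(2), of D E] by blast
      qed
      have fn: "\<And>D. D \<in> ?\<C>' \<Longrightarrow> finite D \<and> D \<noteq> {}"
        using less.prems(3)[OF C(1)] less.prems(3) C' by (auto intro: finite_subset[of C' C])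
      have "finite ?\<C>'" "\<Union>?\<C>' \<subseteq> V" using less.prems(1,4) sub by auto
      from less.hyps[OF psubset_card_mono[OF fin sub] this(1) dj fn this(2)] show ?thesis
        unfolding c .
    qed
    have "has_depth (vertex_star v (transversal_complex \<C>)) (card \<C>)"
      unfolding transversal_complex_star[OF less.prems(2) C(1,2)] by (rule *) (use C in auto)
    moreover have "has_depth (vertex_deletion v (transversal_complex \<C>)) (card \<C>)"
      unfolding transversal_complex_deletion[OF less.prems(2) C(1,2)] by (rule *) (use C in auto)
    moreover have "card \<C> > 0" using C(1) less.prems(1) card_gt_0_iff by blast
    moreover have "v \<in> V" using C less.prems(4) by blast
    ultimately show ?thesis
      using has_depth_star_deletion[OF simplicial_complex_transversal] has_depth_def by blast
  qed
qed

text \<open>Downward induction on \<open>Y\<close>: deleting the vertices of \<open>N\<close> one after another, the bound for the last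
  complex and the bounds for the stars met on the way give the bound for the first.\<close>

lemma (in residue_field_resolution) depth_at_least_avoiding:
  assumes \<Delta>: "simplicial_complex \<Delta>" and N: "finite N" "N \<subseteq> V"
    and star: "\<And>v Y. v \<in> N \<Longrightarrow> Y \<subseteq> N - {v} \<Longrightarrow> depth_at_least (vertex_star v {F \<in> \<Delta>. F \<inter> Y = {}}) s"
    and last: "depth_at_least {F \<in> \<Delta>. F \<inter> N = {}} s"
    and "Y \<subseteq> N"
  shows "depth_at_least {F \<in> \<Delta>. F \<inter> Y = {}} s"
  using \<open>Y \<subseteq> N\<close>
proof (induction "card (N - Y)" arbitrary: Y rule: less_induct)
  case less
  show ?case
  proof (cases "Y = N")
    case False
    then obtain v where v: "v \<in> N" "v \<notin> Y" using less.prems by blast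
    have "card (N - insert v Y) < card (N - Y)"
      using v N(1) by (intro psubset_card_mono) auto
    then have "depth_at_least {F \<in> \<Delta>. F \<inter> insert v Y = {}} s" using less v by blast
    also have "{F \<in> \<Delta>. F \<inter> insert v Y = {}} = vertex_deletion v {F \<in> \<Delta>. F \<inter> Y = {}}"
      by (auto simp: vertex_deletion_def)
    finally have del: "depth_at_least (vertex_deletion v {F \<in> \<Delta>. F \<inter> Y = {}}) s" .
    have "simplicial_complex {F \<in> \<Delta>. F \<inter> Y = {}}" using \<Delta> unfolding simplicial_complex_def by blast
    then show ?thesis
      using depth_at_least_star_deletion[OF _ _ star[OF v(1)] del] v less.prems N(2) by blast
  qed (use last in simp)
qed

section \<open>From Ext to depth\<close>

text \<open>The hypothesis is asked for every resolution because the one inside Ext is an arbitrary choice.\<close>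

lemma depth_stanley_reisner:
  assumes "finite V" and \<Delta>: "simplicial_complex \<Delta>"
    and *: "\<And>b d \<epsilon>. residue_field_resolution V b d (\<epsilon> :: (nat \<Rightarrow> ('v, 'k::field) mpoly) \<Rightarrow> 'k) \<Longrightarrow>
      residue_field_resolution.has_depth V b d \<Delta> s"
  shows "depth V (stanley_reisner_ring V \<Delta> :: (('v, 'k) mpoly, _) module) = enat s"
proof -
  let ?R = "mpoly_ring V :: ('v, 'k) mpoly ring"
  let ?K = "coeff_field_module :: (('v, 'k) mpoly, 'k) module"
  let ?M = "stanley_reisner_ring V \<Delta> :: (('v, 'k) mpoly, ('v, 'k) mpoly set) module"
  obtain b d \<epsilon> where some: "(SOME res. free_resolution ?R ?K res) = (b, d, \<epsilon>)"
    by (metis prod_cases3)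
  have res: "free_resolution ?R ?K (b, d, \<epsilon>)"
    using someI_ex[OF coeff_field_resolution[OF \<open>finite V\<close>, where 'k = 'k]] unfolding some .
  have aug: "augmented_free_complex ?R (shifted_ranks b) (shifted_maps ?R d) ?K \<epsilon>"
    by (rule free_resolution_augmented[OF mpoly_ring_cring coeff_field_module_module res])
  interpret residue_field_resolution V "shifted_ranks b" "shifted_maps ?R d" \<epsilon>
    unfolding residue_field_resolution_def by (rule aug)
  have "has_depth \<Delta> s" by (rule *) (rule residue_field_resolution_axioms)
  then have hd: "\<And>i. i < s \<Longrightarrow> ext_vanishes \<Delta> i" and nv: "\<not> ext_vanishes \<Delta> s"
    by (auto simp: has_depth_def depth_at_least_def)
  have Ext: "carrier (Ext ?R i ?K ?M) \<noteq> {\<one>\<^bsub>Ext ?R i ?K ?M\<^esub>} \<longleftrightarrow> \<not> ext_vanishes \<Delta> i" for i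
    unfolding Ext_trivial_iff[OF mpoly_ring_cring coeff_field_module_module stanley_reisner_module[OF \<Delta>] some res] ..
  have "depth V ?M = Inf {enat i |i. \<not> ext_vanishes \<Delta> i}"
    unfolding depth_def Ext ..
  also have "\<dots> = enat s"
  proof (rule antisym)
    show "Inf {enat i |i. \<not> ext_vanishes \<Delta> i} \<le> enat s" using nv by (intro Inf_lower) auto
    show "enat s \<le> Inf {enat i |i. \<not> ext_vanishes \<Delta> i}"
      using hd by (intro Inf_greatest) (auto simp: not_less[symmetric])
  qed
  finally show ?thesis .
qed

section \<open>Edge ideals\<close>

definition independence_complex :: "'v ugraph \<Rightarrow> 'v set set" where
  "independence_complex G = {F. F \<subseteq> verts G \<and> (\<forall>u\<in>F. \<forall>v\<in>F. {u, v} \<notin> edges G)}"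

lemma simplicial_complex_independence: "simplicial_complex (independence_complex G)"
  unfolding simplicial_complex_def independence_complex_def by blast

text \<open>A monomial whose support is not independent is divisible by \<open>x\<^sub>u x\<^sub>v\<close> for some edge \<open>{u, v}\<close>; two
  different variables are split off one after the other.\<close>

lemma edge_ideal_stanley_reisner:
  assumes simple: "\<And>u v. {u, v} \<in> edges G \<Longrightarrow> u \<noteq> v \<and> u \<in> verts G \<and> v \<in> verts G"
  shows "edge_ideal G = (stanley_reisner_ideal (verts G) (independence_complex G) :: ('v, 'k::field) mpoly set)"
proof (intro equalityI)
  let ?R = "mpoly_ring (verts G) :: ('v, 'k) mpoly ring"
  let ?I = "stanley_reisner_ideal (verts G) (independence_complex G) :: ('v, 'k) mpoly set"
  let ?S = "{mpoly_var u * mpoly_var v |u v. {u, v} \<in> edges G} :: ('v, 'k) mpoly set"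
  interpret cring ?R by (rule mpoly_ring_cring)
  have I: "ideal ?I ?R" by (rule stanley_reisner_ideal_ideal[OF simplicial_complex_independence])
  have "?S \<subseteq> ?I"
  proof
    fix p assume "p \<in> ?S"
    then obtain u v where uv: "{u, v} \<in> edges G" "p = mpoly_var u * mpoly_var v" by blast
    have p: "p = Poly_Mapping.single (Poly_Mapping.single u 1 + Poly_Mapping.single v 1) 1"
      by (simp add: uv mpoly_var_def mult_single)
    show "p \<in> ?I"
      using simple[OF uv(1)] uv(1) unfolding p
      by (auto simp: stanley_reisner_ideal_def keys_add_nat independence_complex_def)
  qed
  then show "edge_ideal G \<subseteq> ?I" unfolding edge_ideal_def by (rule genideal_minimal[OF I])
  show "?I \<subseteq> edge_ideal G"
  proof
    fix p assume p: "p \<in> ?I"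
    have "?I \<subseteq> carrier ?R" unfolding stanley_reisner_ideal_def by (rule Collect_restrict)
    with \<open>?S \<subseteq> ?I\<close> have SR: "?S \<subseteq> carrier ?R" by (rule subset_trans)
    interpret J: ideal "edge_ideal G :: ('v, 'k) mpoly set" ?R
      unfolding edge_ideal_def by (rule genideal_ideal[OF SR])
    have monomial: "Poly_Mapping.single m c \<in> edge_ideal G" if m: "m \<in> Poly_Mapping.keys p" for m and c :: 'k
    proof -
      have "Poly_Mapping.keys m \<subseteq> verts G" "Poly_Mapping.keys m \<notin> independence_complex G"
        using p m by (auto simp: stanley_reisner_ideal_def)
      then obtain u v where uv: "u \<in> Poly_Mapping.keys m" "v \<in> Poly_Mapping.keys m" "{u, v} \<in> edges G"
        by (auto simp: independence_complex_def)
      define m1 where "m1 = m - Poly_Mapping.single u 1"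
      have m1: "Poly_Mapping.single u 1 + m1 = m" unfolding m1_def by (rule monomial_split_var[OF uv(1)])
      have "v \<in> Poly_Mapping.keys m1"
        using uv simple[OF uv(3)] unfolding m1[symmetric] keys_add_nat by auto
      define m2 where "m2 = m1 - Poly_Mapping.single v 1"
      have m2: "Poly_Mapping.single v 1 + m2 = m1"
        unfolding m2_def by (rule monomial_split_var[OF \<open>v \<in> Poly_Mapping.keys m1\<close>])
      have "Poly_Mapping.keys m2 \<subseteq> verts G"
        using \<open>Poly_Mapping.keys m \<subseteq> verts G\<close> unfolding m1[symmetric] m2[symmetric] keys_add_nat by blast
      then have r: "Poly_Mapping.single m2 c \<in> carrier ?R" by simp
      have "mpoly_var u * mpoly_var v \<in> ?S" using uv(3) by auto
      then have "mpoly_var u * mpoly_var v \<in> (edge_ideal G :: ('v, 'k) mpoly set)"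
        unfolding edge_ideal_def by (rule subsetD[OF genideal_self[OF SR]])
      from J.I_r_closed[OF this r] have "mpoly_var u * mpoly_var v * Poly_Mapping.single m2 c \<in> edge_ideal G"
        by (simp only: mpoly_ring_simps(2))
      then show ?thesis
        by (simp add: mpoly_var_def mult_single m1[symmetric] m2[symmetric] add.assoc)
    qed
    have sum: "(\<Sum>m\<in>B. Poly_Mapping.single m (Poly_Mapping.lookup p m)) \<in> edge_ideal G"
      if "B \<subseteq> Poly_Mapping.keys p" "finite B" for B
      using that(2,1)
    proof (induction B rule: finite_induct)
      case empty then show ?case using J.zero_closed by simp
    next
      case (insert m B)
      then show ?case using J.a_closed[OF monomial, of m] by simp
    qed
    from sum[of "Poly_Mapping.keys p"] show "p \<in> edge_ideal G" by (simp add: mpoly_sum_monomials)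
  qed
qed


section \<open>Complete graphs with attached cliques\<close>

text \<open>Fan graphs are of this kind, with the cliques of all fans put into one family: the order within a fan
  only matters for the number of cliques through a vertex.\<close>

locale clique_attachment =
  fixes N :: "'v set" and P :: "'p set" and A :: "'p \<Rightarrow> 'v set" and G :: "'v ugraph"
  assumes finite_N: "finite N" and finite_P: "finite P"
    and finite_A: "p \<in> P \<Longrightarrow> finite (A p)"
    and new_vertex: "p \<in> P \<Longrightarrow> A p - N \<noteq> {}"
    and new_disjoint: "p \<in> P \<Longrightarrow> q \<in> P \<Longrightarrow> p \<noteq> q \<Longrightarrow> (A p - N) \<inter> (A q - N) = {}"
    and verts_G: "verts G = N \<union> (\<Union>p\<in>P. A p)"
    and edges_G: "{u, v} \<in> edges G \<longleftrightarrow> u \<noteq> v \<and> (u \<in> N \<and> v \<in> N \<or> (\<exists>p\<in>P. u \<in> A p \<and> v \<in> A p))"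
begin

definition avoiding :: "'v \<Rightarrow> 'p set" where
  "avoiding v = {p \<in> P. v \<notin> A p}"

lemma finite_verts: "finite (verts G)"
  unfolding verts_G using finite_N finite_P finite_A by blast

lemma new_part_unique:
  assumes "p \<in> P" "q \<in> P" "x \<in> A p" "x \<in> A q" "x \<notin> N"
  shows "p = q"
  using new_disjoint[OF assms(1,2)] assms(3-5) by blast

lemma new_parts_inj: "inj_on (\<lambda>p. A p - N) P"
proof (rule inj_onI)
  fix p q assume *: "p \<in> P" "q \<in> P" "A p - N = A q - N"
  then obtain x where "x \<in> A p - N" using new_vertex by auto
  then show "p = q" using * new_part_unique[of p q x] by auto
qed

text \<open>Without vertices of \<open>N\<close>, an independent set is a partial transversal of the sets of new
  vertices; with the vertex \<open>v\<close> of \<open>N\<close> it contains no other vertex of \<open>N\<close> and only new vertices from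
  cliques that avoid \<open>v\<close>.\<close>

lemma independence_complex_new:
  "{F \<in> independence_complex G. F \<inter> N = {}} = transversal_complex ((\<lambda>p. A p - N) ` P)"
proof (intro equalityI subsetI)
  fix F assume "F \<in> {F \<in> independence_complex G. F \<inter> N = {}}"
  then have F: "F \<subseteq> verts G" "F \<inter> N = {}" "\<And>u v. u \<in> F \<Longrightarrow> v \<in> F \<Longrightarrow> {u, v} \<notin> edges G"
    by (auto simp: independence_complex_def)
  show "F \<in> transversal_complex ((\<lambda>p. A p - N) ` P)"
  proof (rule transversal_complexI)
    fix a assume "a \<in> F"
    then show "\<exists>C\<in>(\<lambda>p. A p - N) ` P. a \<in> C" using F(1,2) unfolding verts_G by auto
  next
    fix C a b assume "C \<in> (\<lambda>p. A p - N) ` P" "a \<in> F" "a \<in> C" "b \<in> F" "b \<in> C"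
    then show "a = b" using F(3)[of a b] unfolding edges_G by auto
  qed
next
  fix F assume F: "F \<in> transversal_complex ((\<lambda>p. A p - N) ` P)"
  have new: "\<exists>p\<in>P. a \<in> A p \<and> a \<notin> N" if "a \<in> F" for a
    using transversal_complexD(1)[OF F that] by auto
  have "{u, v} \<notin> edges G" if uv: "u \<in> F" "v \<in> F" for u v
  proof
    assume "{u, v} \<in> edges G"
    then obtain p where "p \<in> P" "u \<in> A p" "v \<in> A p" "u \<noteq> v" using new[OF uv(1)] unfolding edges_G by auto
    then show False using transversal_complexD(2)[OF F, of "A p - N" u v] uv new by auto
  qed
  then show "F \<in> {F \<in> independence_complex G. F \<inter> N = {}}"
    using new unfolding independence_complex_def verts_G by auto
qed

lemma independence_complex_star:
  assumes v: "v \<in> N" and Y: "Y \<subseteq> N - {v}"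
  shows "vertex_star v {F \<in> independence_complex G. F \<inter> Y = {}} =
    transversal_complex (insert {v} ((\<lambda>p. A p - N) ` avoiding v))"
proof (intro equalityI subsetI)
  fix F assume "F \<in> vertex_star v {F \<in> independence_complex G. F \<inter> Y = {}}"
  then have F: "F \<subseteq> verts G" "\<And>x y. x \<in> insert v F \<Longrightarrow> y \<in> insert v F \<Longrightarrow> {x, y} \<notin> edges G"
    by (auto simp: vertex_star_def independence_complex_def)
  have N: "x = v" if "x \<in> F" "x \<in> N" for x using F(2)[of v x] that v unfolding edges_G by auto
  have avoid: "p \<in> avoiding v" if "x \<in> F" "x \<in> A p" "x \<notin> N" "p \<in> P" for x p
    using F(2)[of v x] that v unfolding edges_G avoiding_def by auto
  show "F \<in> transversal_complex (insert {v} ((\<lambda>p. A p - N) ` avoiding v))"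
  proof (rule transversal_complexI)
    fix a assume a: "a \<in> F"
    show "\<exists>C\<in>insert {v} ((\<lambda>p. A p - N) ` avoiding v). a \<in> C"
    proof (cases "a \<in> N")
      case False
      then obtain p where "p \<in> P" "a \<in> A p" using a F(1) unfolding verts_G by auto
      then show ?thesis using avoid[OF a _ False] False by auto
    qed (use N[OF a] in auto)
  next
    fix C a b assume "C \<in> insert {v} ((\<lambda>p. A p - N) ` avoiding v)" "a \<in> F" "a \<in> C" "b \<in> F" "b \<in> C"
    then show "a = b" using F(2)[of a b] unfolding edges_G avoiding_def by auto
  qed
next
  fix F assume F: "F \<in> transversal_complex (insert {v} ((\<lambda>p. A p - N) ` avoiding v))"
  have new: "a = v \<or> (\<exists>p\<in>P. v \<notin> A p \<and> a \<in> A p \<and> a \<notin> N)" if "a \<in> F" for a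
    using transversal_complexD(1)[OF F that] by (auto simp: avoiding_def)
  have "{x, y} \<notin> edges G" if xy: "x \<in> insert v F" "y \<in> insert v F" for x y
  proof
    assume e: "{x, y} \<in> edges G"
    have "\<not> (x \<in> N \<and> y \<in> N)" using e xy new unfolding edges_G by blast
    then obtain p where p: "p \<in> P" "x \<in> A p" "y \<in> A p" "x \<noteq> y" using e unfolding edges_G by auto
    \<comment> \<open>An endpoint outside \<open>N\<close> determines the clique, which then avoids \<open>v\<close>.\<close>
    have "v \<notin> A p"
    proof -
      obtain z where z: "z \<in> F" "z \<noteq> v" "z \<in> A p" using p xy by (cases "x = v") auto
      then obtain q where "q \<in> P" "v \<notin> A q" "z \<in> A q" "z \<notin> N" using new by blast
      then show ?thesis using new_part_unique[OF p(1) _ z(3)] by blast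
    qed
    then have "x \<noteq> v" "y \<noteq> v" "p \<in> avoiding v" using p by (auto simp: avoiding_def)
    moreover have "x \<notin> N" "y \<notin> N" using calculation xy new by blast+
    ultimately show False
      using transversal_complexD(2)[OF F, of "A p - N" x y] p xy by auto
  qed
  moreover have "insert v F \<subseteq> verts G" using new v unfolding verts_G by auto
  moreover have "insert v F \<inter> Y = {}" using new v Y by blast
  ultimately show "F \<in> vertex_star v {F \<in> independence_complex G. F \<inter> Y = {}}"
    unfolding vertex_star_def independence_complex_def mem_Collect_eq by blast
qed

lemma card_new_parts: "Q \<subseteq> P \<Longrightarrow> card ((\<lambda>p. A p - N) ` Q) = card Q"
  by (rule card_image) (rule inj_on_subset[OF new_parts_inj])

lemma disjoint_new_parts: "Q \<subseteq> P \<Longrightarrow> disjoint ((\<lambda>p. A p - N) ` Q)"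
  using new_disjoint by (intro disjointI) blast

text \<open>The vertex \<open>v\<^sub>0\<close> is deleted first. Its star has depth exactly \<open>s\<close>, whereas the stars of the vertices
  deleted later and the complex that is left at the end have depth at least \<open>s\<close>.\<close>

theorem depth_clique_attachment:
  assumes s: "v\<^sub>0 \<in> N" "s = 1 + card (avoiding v\<^sub>0)"
    and min: "\<And>v. v \<in> N \<Longrightarrow> s \<le> 1 + card (avoiding v)" "s \<le> card P"
  shows "depth (verts G) (quot_module (mpoly_ring (verts G)) (edge_ideal G :: ('v, 'k::field) mpoly set)) = enat s"
proof -
  let ?V = "verts G" and ?\<Delta> = "independence_complex G"
  have "u \<noteq> v \<and> u \<in> ?V \<and> v \<in> ?V" if "{u, v} \<in> edges G" for u v
    using that unfolding edges_G verts_G by blast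
  then have ideal: "edge_ideal G = (stanley_reisner_ideal ?V ?\<Delta> :: ('v, 'k) mpoly set)"
    by (rule edge_ideal_stanley_reisner)
  show ?thesis
    unfolding ideal
  proof (rule depth_stanley_reisner[OF finite_verts simplicial_complex_independence])
    fix b d and \<epsilon> :: "(nat \<Rightarrow> ('v, 'k) mpoly) \<Rightarrow> 'k"
    assume "residue_field_resolution ?V b d \<epsilon>"
    then interpret residue_field_resolution ?V b d \<epsilon> .
    have N: "N \<subseteq> ?V" by (auto simp: verts_G)
    have star: "has_depth (vertex_star v {F \<in> ?\<Delta>. F \<inter> Y = {}}) (1 + card (avoiding v))"
      if v: "v \<in> N" and Y: "Y \<subseteq> N - {v}" for v Y
    proof -
      let ?\<C> = "(\<lambda>p. A p - N) ` avoiding v"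
      have sub: "avoiding v \<subseteq> P" by (auto simp: avoiding_def)
      have fin: "finite (avoiding v)" using sub finite_P by (rule finite_subset)
      have notin: "{v} \<notin> ?\<C>" using v by blast
      have "has_depth (transversal_complex (insert {v} ?\<C>)) (card (insert {v} ?\<C>))"
      proof (rule has_depth_transversal)
        show "finite (insert {v} ?\<C>)" using fin by simp
        show "disjoint (insert {v} ?\<C>)"
        proof (rule disjointI)
          fix C D assume "C \<in> insert {v} ?\<C>" "D \<in> insert {v} ?\<C>" "C \<noteq> D"
          then show "C \<inter> D = {}" using disjointD[OF disjoint_new_parts[OF sub], of C D] v by auto
        qed
        show "finite C \<and> C \<noteq> {}" if "C \<in> insert {v} ?\<C>" for C
          using that finite_A new_vertex sub by auto
        show "\<Union>(insert {v} ?\<C>) \<subseteq> ?V" using v sub by (auto simp: verts_G)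
      qed
      also have "card (insert {v} ?\<C>) = 1 + card (avoiding v)"
        using fin notin card_new_parts[OF sub] by simp
      finally show ?thesis unfolding independence_complex_star[OF v Y] .
    qed
    have "has_depth {F \<in> ?\<Delta>. F \<inter> N = {}} (card P)"
    proof -
      let ?\<C> = "(\<lambda>p. A p - N) ` P"
      have "has_depth (transversal_complex ?\<C>) (card ?\<C>)"
      proof (rule has_depth_transversal)
        show "finite ?\<C>" using finite_P by simp
        show "disjoint ?\<C>" by (rule disjoint_new_parts) simp
        show "finite C \<and> C \<noteq> {}" if "C \<in> ?\<C>" for C
          using that finite_A new_vertex by auto
        show "\<Union>?\<C> \<subseteq> ?V" by (auto simp: verts_G)
      qed
      then show ?thesis unfolding independence_complex_new card_new_parts[OF subset_refl] .
    qed
    then have last: "depth_at_least {F \<in> ?\<Delta>. F \<inter> N = {}} s"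
      using depth_at_least_mono min(2) by (auto simp: has_depth_def)
    have "depth_at_least {F \<in> ?\<Delta>. F \<inter> {v\<^sub>0} = {}} s"
    proof (rule depth_at_least_avoiding[OF simplicial_complex_independence finite_N N _ last])
      show "depth_at_least (vertex_star v {F \<in> ?\<Delta>. F \<inter> Y = {}}) s" if "v \<in> N" "Y \<subseteq> N - {v}" for v Y
        using star[OF that] depth_at_least_mono min(1)[OF that(1)] by (auto simp: has_depth_def)
    qed (use s(1) in simp)
    also have "{F \<in> ?\<Delta>. F \<inter> {v\<^sub>0} = {}} = vertex_deletion v\<^sub>0 ?\<Delta>"
      by (auto simp: vertex_deletion_def)
    finally have del: "depth_at_least (vertex_deletion v\<^sub>0 ?\<Delta>) s" .
    have "has_depth (vertex_star v\<^sub>0 ?\<Delta>) s"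
      using star[OF s(1), of "{}"] s(2) by simp
    then show "has_depth ?\<Delta> s"
      using has_depth_star_deletion[OF simplicial_complex_independence _ _ del] s N by auto
  qed
qed

end

section \<open>Fan graphs\<close>

text \<open>The attached cliques are indexed by the pairs \<open>(i, j)\<close> with \<open>1 \<le> j \<le> |W\<^sub>i|\<close>, hence by \<open>|W|\<close> elements.
  Since the \<open>W\<^sub>i\<close> are disjoint, all attached cliques through a vertex of \<open>[n]\<close> belong to one fan.\<close>

theorem theorem2p6:
  fixes n k :: nat and W :: "nat set" and Wpart :: "nat \<Rightarrow> nat set" and G :: "nat ugraph"
  assumes "n \<ge> 2" and "k \<ge> 1"
    and "W \<subseteq> {1..n}"
    and "\<And>i. i \<in> {1..k} \<Longrightarrow> Wpart i \<noteq> {}"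
    and "disjoint_family_on Wpart {1..k}"
    and "(\<Union>i\<in>{1..k}. Wpart i) = W"
    and "k_fan_graph n k Wpart G"
  shows "depth (verts G)
           (quot_module (mpoly_ring (verts G)) (edge_ideal G :: (nat, 'k::field) mpoly set))
         = enat (1 + card W - Max ((\<lambda>i. card (Wpart i)) ` {1..k}))"
proof -
  obtain us A where fan': "\<forall>i\<in>{1..k}. set (us i) = Wpart i \<and> fan_branch {1..n} (us i) (A i)"
    and disj: "disjoint_family_on (\<lambda>i. \<Union>j\<in>{1..length (us i)}. A i j - {1..n}) {1..k}"
    and G: "G = graph_Union (insert (complete_graph {1..n})
                 {complete_graph (A i j) |i j. i \<in> {1..k} \<and> j \<in> {1..length (us i)}})"
    using assms(7) unfolding k_fan_graph_def by (elim exE conjE) (rule that)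
  have fan: "set (us i) = Wpart i \<and> fan_branch {1..n} (us i) (A i)" if "i \<in> {1..k}" for i
    using fan' that by blast
  define P where "P = (SIGMA i:{1..k}. {1..length (us i)})"
  define B where "B p = A (fst p) (snd p)" for p
  have dist: "distinct (us i)" and us: "set (us i) = Wpart i" if "i \<in> {1..k}" for i
    using fan[OF that] by (simp_all add: fan_branch_def)
  have len: "length (us i) = card (Wpart i)" if "i \<in> {1..k}" for i
    using distinct_card[OF dist[OF that]] us[OF that] by simp
  have Wi: "Wpart i \<subseteq> {1..n}" if "i \<in> {1..k}" for i using assms(3,6) that by blast
  have finB: "finite (B p)" and cardB: "card (B p) > snd p" and NB: "{1..n} \<inter> B p = set (take (snd p) (us (fst p)))"
    if p: "p \<in> P" for p
  proof -
    have i: "fst p \<in> {1..k}" and j: "snd p \<in> {1..length (us (fst p))}" using p unfolding P_def by auto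
    have "\<forall>j\<in>{1..length (us (fst p))}. finite (A (fst p) j) \<and> card (A (fst p) j) > j \<and>
        {1..n} \<inter> A (fst p) j = set (take j (us (fst p)))"
      using fan[OF i] unfolding fan_branch_def by blast
    with j show "finite (B p)" "card (B p) > snd p" "{1..n} \<inter> B p = set (take (snd p) (us (fst p)))"
      unfolding B_def by blast+
  qed
  have disj2: "disjoint_family_on (\<lambda>j. A i j - {1..n}) {1..length (us i)}" if "i \<in> {1..k}" for i
    using fan[OF that] unfolding fan_branch_def by blast
  interpret clique_attachment "{1..n}" P B G
  proof
    show "finite P" unfolding P_def by simp
    show "finite (B p)" if "p \<in> P" for p by (rule finB[OF that])
    show "B p - {1..n} \<noteq> {}" if p: "p \<in> P" for p
    proof
      assume "B p - {1..n} = {}"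
      then have "B p = set (take (snd p) (us (fst p)))" using NB[OF p] by blast
      then have "card (B p) \<le> snd p" using card_length[of "take (snd p) (us (fst p))"] by simp
      then show False using cardB[OF p] by simp
    qed
    show "(B p - {1..n}) \<inter> (B q - {1..n}) = {}" if pq: "p \<in> P" "q \<in> P" "p \<noteq> q" for p q
    proof -
      obtain i j i' j' where p: "p = (i, j)" and q: "q = (i', j')" by (metis surj_pair)
      then have i: "i \<in> {1..k}" "j \<in> {1..length (us i)}" and i': "i' \<in> {1..k}" "j' \<in> {1..length (us i')}"
        using pq(1,2) unfolding P_def by auto
      show ?thesis
      proof (cases "i = i'")
        case True
        then have "j \<noteq> j'" "j' \<in> {1..length (us i)}" using pq(3) p q i' by auto
        then show ?thesis
          using disjoint_family_onD[OF disj2[OF i(1)] i(2)] unfolding B_def p q True[symmetric] fst_conv snd_conv by blast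
      next
        case False
        have "A i j - {1..n} \<subseteq> (\<Union>j\<in>{1..length (us i)}. A i j - {1..n})"
          "A i' j' - {1..n} \<subseteq> (\<Union>j\<in>{1..length (us i')}. A i' j - {1..n})"
          using i(2) i'(2) by blast+
        then show ?thesis
          using disjoint_family_onD[OF disj i(1) i'(1) False] unfolding B_def p q fst_conv snd_conv by blast
      qed
    qed
    have fam: "{complete_graph (A i j) |i j. i \<in> {1..k} \<and> j \<in> {1..length (us i)}} = (\<lambda>p. complete_graph (B p)) ` P"
      unfolding P_def B_def by force
    show "verts G = {1..n} \<union> (\<Union>p\<in>P. B p)"
      unfolding G fam by (simp add: graph_Union_def complete_graph_def)
    have edge: "{u, v} \<in> edges (complete_graph C) \<longleftrightarrow> u \<noteq> v \<and> u \<in> C \<and> v \<in> C" for u v :: nat and C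
      by (auto simp: complete_graph_def doubleton_eq_iff)
    show "{u, v} \<in> edges G \<longleftrightarrow> u \<noteq> v \<and> (u \<in> {1..n} \<and> v \<in> {1..n} \<or> (\<exists>p\<in>P. u \<in> B p \<and> v \<in> B p))" for u v
    proof -
      have "{u, v} \<in> edges G \<longleftrightarrow> {u, v} \<in> edges (complete_graph {1..n}) \<or> (\<exists>p\<in>P. {u, v} \<in> edges (complete_graph (B p)))"
        unfolding G fam by (simp add: graph_Union_def)
      then show ?thesis unfolding edge by blast
    qed
  qed simp
  \<comment> \<open>A vertex in two fans would lie in two of the disjoint sets \<open>W\<^sub>i\<close>, so the number of cliques through a
    vertex is at most the size \<open>?M\<close> of a largest part.\<close>
  let ?M = "Max ((\<lambda>i. card (Wpart i)) ` {1..k})"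
  have fin: "finite ((\<lambda>i. card (Wpart i)) ` {1..k})" "(\<lambda>i. card (Wpart i)) ` {1..k} \<noteq> {}"
    using assms(2) by auto
  have finW: "finite (Wpart i)" if "i \<in> {1..k}" for i using Wi[OF that] finite_subset by blast
  have cardP: "card P = card W"
  proof -
    have "card P = (\<Sum>i\<in>{1..k}. length (us i))" unfolding P_def by simp
    also have "\<dots> = (\<Sum>i\<in>{1..k}. card (Wpart i))" by (intro sum.cong refl len)
    also have "\<dots> = card W"
      unfolding assms(6)[symmetric] using finW assms(5)
      by (intro card_UN_disjoint[symmetric]) (auto simp: disjoint_family_on_def)
    finally show ?thesis .
  qed
  have avoid: "card (avoiding v) = card W - card {p \<in> P. v \<in> B p}" for v
  proof -
    have "avoiding v = P - {p \<in> P. v \<in> B p}" by (auto simp: avoiding_def)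
    then show ?thesis using finite_P by (simp add: card_Diff_subset cardP)
  qed
  have part: "fst p \<in> {1..k}" "v \<in> Wpart (fst p)" if p: "p \<in> P" and v: "v \<in> B p" "v \<in> {1..n}" for p v
  proof -
    show i: "fst p \<in> {1..k}" using p unfolding P_def by auto
    have "v \<in> set (take (snd p) (us (fst p)))" using NB[OF p] v by blast
    then have "v \<in> set (us (fst p))" by (rule in_set_takeD)
    then show "v \<in> Wpart (fst p)" using us[OF i] by simp
  qed
  have unique: "fst p = fst q" if "p \<in> P" "q \<in> P" "v \<in> B p" "v \<in> B q" "v \<in> {1..n}" for p q v
  proof (rule ccontr)
    assume "fst p \<noteq> fst q"
    then show False
      using disjoint_family_onD[OF assms(5) part(1)[OF that(1,3,5)] part(1)[OF that(2,4,5)]]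
        part(2)[OF that(1,3,5)] part(2)[OF that(2,4,5)] by blast
  qed
  have le: "card {p \<in> P. v \<in> B p} \<le> ?M" if v: "v \<in> {1..n}" for v
  proof (cases "{p \<in> P. v \<in> B p} = {}")
    case True
    then show ?thesis by (simp only: card.empty le0)
  next
    case False
    then obtain i j where ij: "(i, j) \<in> P" "v \<in> B (i, j)" by auto
    then have i: "i \<in> {1..k}" by (simp add: P_def)
    have "{p \<in> P. v \<in> B p} \<subseteq> {i} \<times> {1..length (us i)}"
    proof
      fix p assume p: "p \<in> {p \<in> P. v \<in> B p}"
      then have "fst p = i" using unique[OF ij(1) _ ij(2) _ v, of p] by simp
      then show "p \<in> {i} \<times> {1..length (us i)}" using p unfolding P_def by auto
    qed
    then have "card {p \<in> P. v \<in> B p} \<le> card ({i} \<times> {1..length (us i)})" by (intro card_mono) auto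
    also have "\<dots> = card (Wpart i)" using len[OF i] by simp
    also have "\<dots> \<le> ?M" using i by (intro Max_ge[OF fin(1)]) auto
    finally show ?thesis .
  qed
  \<comment> \<open>The first vertex of a largest part lies in all cliques of its fan.\<close>
  obtain i\<^sub>0 where i\<^sub>0: "i\<^sub>0 \<in> {1..k}" "card (Wpart i\<^sub>0) = ?M"
    using Max_in[OF fin] by auto
  define v\<^sub>0 where "v\<^sub>0 = hd (us i\<^sub>0)"
  have ne: "us i\<^sub>0 \<noteq> []" using us[OF i\<^sub>0(1)] assms(4)[OF i\<^sub>0(1)] by auto
  have v\<^sub>0: "v\<^sub>0 \<in> {1..n}" using hd_in_set[OF ne] us[OF i\<^sub>0(1)] Wi[OF i\<^sub>0(1)] unfolding v\<^sub>0_def by blast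
  have "{i\<^sub>0} \<times> {1..length (us i\<^sub>0)} \<subseteq> {p \<in> P. v\<^sub>0 \<in> B p}"
  proof
    fix p assume "p \<in> {i\<^sub>0} \<times> {1..length (us i\<^sub>0)}"
    then obtain j where p: "p = (i\<^sub>0, j)" "1 \<le> j" "p \<in> P" using i\<^sub>0(1) unfolding P_def by auto
    have "v\<^sub>0 \<in> set (take j (us i\<^sub>0))" unfolding v\<^sub>0_def using ne p(2) by (cases "us i\<^sub>0"; cases j) auto
    then have "v\<^sub>0 \<in> B p" using NB[OF p(3)] unfolding p(1) fst_conv snd_conv by blast
    with p(3) show "p \<in> {p \<in> P. v\<^sub>0 \<in> B p}" by simp
  qed
  then have "card ({i\<^sub>0} \<times> {1..length (us i\<^sub>0)}) \<le> card {p \<in> P. v\<^sub>0 \<in> B p}"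
    using finite_P by (intro card_mono) auto
  then have eq: "card {p \<in> P. v\<^sub>0 \<in> B p} = ?M"
    using le[OF v\<^sub>0] len[OF i\<^sub>0(1)] i\<^sub>0(2) by simp
  have "?M \<le> card W"
    using card_mono[OF finite_P, of "{p \<in> P. v\<^sub>0 \<in> B p}"] unfolding eq cardP by auto
  then have s: "1 + card W - ?M = 1 + card (avoiding v\<^sub>0)" by (simp add: avoid eq)
  have "?M \<ge> 1"
    using i\<^sub>0 assms(4) finW card_gt_0_iff[of "Wpart i\<^sub>0"] by (metis One_nat_def Suc_leI)
  show ?thesis
  proof (rule depth_clique_attachment[OF v\<^sub>0 s])
    show "1 + card W - ?M \<le> 1 + card (avoiding v)" if "v \<in> {1..n}" for v
      using le[OF that] by (simp add: avoid)
    show "1 + card W - ?M \<le> card P" using \<open>?M \<ge> 1\<close> cardP by simp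
  qed
qed

end
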